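(* Let $\sigma_C^2,\sigma_E^2$ be real numbers with $0\le\sigma_E^2<\sigma_C^2$. Suppose that, as $n\to\infty$, $$\sqrt{n}\begin{pmatrix}\widehat{\beta}_C-\beta_0\\ \widehat{\beta}_E-\beta_E\end{pmatrix}\xrightarrow{d}\mathcal{N}\left(0,\begin{pmatrix}\sigma_C^2&\sigma_E^2\\ \sigma_E^2&\sigma_E^2\end{pmatrix}\right),$$ and $n\widehat{V}(\widehat{\beta}_C)\xrightarrow{p}\sigma_C^2$, $n\widehat{V}(\widehat{\beta}_E)\xrightarrow{p}\sigma_E^2$, $n\widehat{\mathrm{cov}}(\widehat{\beta}_C,\widehat{\beta}_E)\xrightarrow{p}\sigma_E^2$. For a real number $\lambda\ge 0$, let $\widehat{\beta}_{MSE,\lambda}$ be the estimator defined in the context. Then: 1. If $\beta_0\neq\beta_E$ and $\beta_0$ and $\beta_E$ do not depend on $n$, then for every $\lambda\ge0$, $\sqrt{n}(\widehat{\beta}_{MSE,\lambda}-\beta_0)\xrightarrow{d}\mathcal{N}(0,\sigma_C^2)$. 2. If $\beta_0=\beta_E$, then for every $\lambda\ge0$, $\sqrt{n}(\widehat{\beta}_{MSE,\lambda}-\beta_0)\xrightarrow{d}U_{0,\lambda}$, where the random variables $U_{0,\lambda}$ are such that $E(U_{0,\lambda})=0$, $\lambda\mapsto V(U_{0,\lambda})$ is strictly decreasing, and $\lim_{\lambda\to+\infty}V(U_{0,\lambda})=\sigma_E^2$. 3. There is a family of random variables $(U_{h,\lambda})_{h\in\mathbb{R},\lambda\ge0}$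 such that, for every $h\in\mathbb{R}$ and $\lambda\ge0$, if $\beta_E=\beta_0+h/\sqrt{n}$ then $\sqrt{n}(\widehat{\beta}_{MSE,\lambda}-\beta_0)\xrightarrow{d}U_{h,\lambda}$, and for all $\lambda\neq0$, $$\max_{h\in\mathbb{R}}\left[E(U_{h,\lambda}^2)-E(U_{h,0}^2)\right]>\max_{h\in\mathbb{R}}\left[E(U_{h,0}^2)-E(U_{h,\lambda}^2)\right].$$
   Context: For each sample size $n$, $\widehat{\beta}_C$ and $\widehat{\beta}_E$ are real-valued random variables (estimators; the dependence on $n$ is suppressed), and $\beta_0,\beta_E\in\mathbb{R}$ are parameters, which may depend on $n$ unless stated otherwise (in Part 3, $\beta_E=\beta_0+h/\sqrt n$ does). $\widehat{V}(\widehat{\beta}_C)$, $\widehat{V}(\widehat{\beta}_E)$ and $\widehat{\mathrm{cov}}(\widehat{\beta}_C,\widehat{\beta}_E)$ are real-valued random variables (estimators of the variances of $\widehat{\beta}_C$, $\widehat{\beta}_E$ and of their covariance). In Part 3 the stated hypotheses are assumed to hold, with the same $\sigma_C^2,\sigma_E^2$, along the sequence with $\beta_E=\beta_0+h/\sqrt{n}$, for each $h$. Put $\widehat{V}(\widehat{\beta}_E-\widehat{\beta}_C)=\widehat{V}(\widehat{\beta}_E)+\widehat{V}(\widehat{\beta}_C)-2\widehat{\mathrm{cov}}(\widehat{\beta}_C,\widehat{\beta}_E)$. For $\lambda\ge0$, define $\widehat{\beta}_{MSE,\lambda}=\widehat{p}_\lambda\widehat{\beta}_E+(1-\widehat{p}_\lambda)\widehat{\beta}_C$,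 where $$\widehat{p}_\lambda=\arg\min_{p\in\mathbb{R}}\;p^2\max\left[0,(\widehat{\beta}_E-\widehat{\beta}_C)^2-\lambda\widehat{V}(\widehat{\beta}_E-\widehat{\beta}_C)\right]+p^2\widehat{V}(\widehat{\beta}_E)+(1-p)^2\widehat{V}(\widehat{\beta}_C)+2p(1-p)\widehat{\mathrm{cov}}(\widehat{\beta}_C,\widehat{\beta}_E),$$ that is, $$\widehat{p}_\lambda=\frac{\widehat{V}(\widehat{\beta}_C)-\widehat{\mathrm{cov}}(\widehat{\beta}_C,\widehat{\beta}_E)}{\max\left[0,(\widehat{\beta}_E-\widehat{\beta}_C)^2-\lambda\widehat{V}(\widehat{\beta}_E-\widehat{\beta}_C)\right]+\widehat{V}(\widehat{\beta}_E-\widehat{\beta}_C)}.$$ (The denominator is positive with probability tending to one; the value of $\widehat{p}_\lambda$ elsewhere is immaterial.) $V(U)$ denotes the variance of $U$; $\xrightarrow{d}$ and $\xrightarrow{p}$ denote convergence in distribution and in probability. *)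

theory Defs
  imports "HOL-Probability.Probability"
begin

section \<open>Modes of convergence along a sequence of probability spaces\<close>

text \<open>
  For real random variables the library provides \<^const>\<open>weak_conv_m\<close>; the vector-valued notion
  below is the usual one by bounded continuous test functions, and it agrees with
  \<^const>\<open>weak_conv_m\<close> on the real line (lemma \<open>converges_in_distribution_real\<close>).
\<close>

definition converges_in_distribution ::
    "(nat \<Rightarrow> 'a measure) \<Rightarrow> (nat \<Rightarrow> 'a \<Rightarrow> 'b::topological_space) \<Rightarrow> 'b measure \<Rightarrow> bool" where
  "converges_in_distribution M X N \<longleftrightarrow>
     (\<forall>f :: 'b \<Rightarrow> real. continuous_on UNIV f \<longrightarrow> bounded (range f) \<longrightarrow>
        (\<lambda>n. \<integral>\<omega>. f (X n \<omega>) \<partial>M n) \<longlonglongrightarrow> (\<integral>x. f x \<partial>N))"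

definition converges_in_probability ::
    "(nat \<Rightarrow> 'a measure) \<Rightarrow> (nat \<Rightarrow> 'a \<Rightarrow> real) \<Rightarrow> real \<Rightarrow> bool" where
  "converges_in_probability M X c \<longleftrightarrow>
     (\<forall>\<epsilon>>0. (\<lambda>n. measure (M n) {\<omega> \<in> space (M n). \<bar>X n \<omega> - c\<bar> > \<epsilon>}) \<longlonglongrightarrow> 0)"

lemma converges_in_distribution_real:
  fixes X :: "nat \<Rightarrow> 'a \<Rightarrow> real"
  assumes M: "\<And>n. prob_space (M n)" and X: "\<And>n. X n \<in> borel_measurable (M n)"
    and N: "real_distribution N"
  shows "converges_in_distribution M X N \<longleftrightarrow> weak_conv_m (\<lambda>n. distr (M n) borel (X n)) N"
proof -
  have D: "real_distribution (distr (M n) borel (X n))" for n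
    using prob_space.real_distribution_distr[OF M X] .
  have I: "(\<integral>\<omega>. f (X n \<omega>) \<partial>M n) = (\<integral>x. f x \<partial>distr (M n) borel (X n))"
    if "continuous_on UNIV f" for f :: "real \<Rightarrow> real" and n
    using that X by (subst integral_distr) (auto intro: borel_measurable_continuous_onI)
  show ?thesis
  proof
    assume C: "converges_in_distribution M X N"
    show "weak_conv_m (\<lambda>n. distr (M n) borel (X n)) N"
    proof (rule integral_bdd_continuous_conv_imp_weak_conv[OF D N])
      fix f :: "real \<Rightarrow> real" assume f: "\<And>x. isCont f x" "\<And>x. \<bar>f x\<bar> \<le> 1"
      then have c: "continuous_on UNIV f" by (simp add: continuous_at_imp_continuous_on)
      moreover have "bounded (range f)" using f(2) by (auto simp: bounded_iff)
      ultimately show "(\<lambda>n. integral\<^sup>L (distr (M n) borel (X n)) f) \<longlonglongrightarrow> integral\<^sup>L N f"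
        using C I[OF c] unfolding converges_in_distribution_def by auto
    qed
  next
    assume W: "weak_conv_m (\<lambda>n. distr (M n) borel (X n)) N"
    show "converges_in_distribution M X N"
      unfolding converges_in_distribution_def
    proof (intro allI impI)
      fix f :: "real \<Rightarrow> real" assume c: "continuous_on UNIV f" and "bounded (range f)"
      then obtain B where B: "\<And>x. norm (f x) \<le> B" by (auto simp: bounded_iff)
      have "\<And>x. isCont f x" using c by (simp add: continuous_on_eq_continuous_at)
      from weak_conv_imp_integral_bdd_continuous_conv[OF D N W this B]
      show "(\<lambda>n. \<integral>\<omega>. f (X n \<omega>) \<partial>M n) \<longlonglongrightarrow> (\<integral>x. f x \<partial>N)"
        by (simp add: I[OF c])
    qed
  qed
qed


section \<open>Normal distributions\<close>

abbreviation normal_distribution :: "real \<Rightarrow> real \<Rightarrow> real measure" where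
  "normal_distribution m v \<equiv> density lborel (normal_density m (sqrt v))"

definition std_normal_vector :: "(real ^ 'n) measure" where
  "std_normal_vector = density lborel (\<lambda>z. ennreal (\<Prod>i\<in>UNIV. std_normal_density (z $ i)))"

text \<open>
  The law of \<open>m + A Z\<close> with \<open>Z\<close> standard normal and \<open>A A\<^sup>T = S\<close>. Such an \<open>A\<close> exists iff \<open>S\<close> is
  symmetric positive semidefinite, and the law does not depend on the choice of \<open>A\<close>. A singular
  covariance matrix is allowed.
\<close>

definition multivariate_normal ::
    "real ^ 'n \<Rightarrow> real ^ 'n ^ 'n \<Rightarrow> (real ^ 'n) measure" where
  "multivariate_normal m S =
     distr std_normal_vector borel (\<lambda>z. m + (SOME A :: real ^ 'n ^ 'n. A ** transpose A = S) *v z)"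


section \<open>The estimator\<close>

text \<open>Arguments: realised values of \<open>\<beta>\<^sub>C\<close>, \<open>\<beta>\<^sub>E\<close>, their estimated variances and covariance.\<close>

definition var_diff :: "real \<Rightarrow> real \<Rightarrow> real \<Rightarrow> real" where
  "var_diff vC vE cv = vE + vC - 2 * cv"

definition mse_criterion ::
    "real \<Rightarrow> real \<Rightarrow> real \<Rightarrow> real \<Rightarrow> real \<Rightarrow> real \<Rightarrow> real \<Rightarrow> real" where
  "mse_criterion lam bC bE vC vE cv p =
     p\<^sup>2 * max 0 ((bE - bC)\<^sup>2 - lam * var_diff vC vE cv)
     + p\<^sup>2 * vE + (1 - p)\<^sup>2 * vC + 2 * p * (1 - p) * cv"

text \<open>
  Where the denominator in \<open>p_hat_eq\<close> is not positive, the minimiser need not exist or be unique,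
  and \<^const>\<open>arg_min\<close> returns a fixed choice; this happens with probability tending to zero.
\<close>

definition p_hat :: "real \<Rightarrow> real \<Rightarrow> real \<Rightarrow> real \<Rightarrow> real \<Rightarrow> real \<Rightarrow> real" where
  "p_hat lam bC bE vC vE cv = arg_min (mse_criterion lam bC bE vC vE cv) (\<lambda>_. True)"

definition beta_mse :: "real \<Rightarrow> real \<Rightarrow> real \<Rightarrow> real \<Rightarrow> real \<Rightarrow> real \<Rightarrow> real" where
  "beta_mse lam bC bE vC vE cv =
     p_hat lam bC bE vC vE cv * bE + (1 - p_hat lam bC bE vC vE cv) * bC"

lemma p_hat_eq:
  fixes lam bC bE vC vE cv :: real
  defines "D \<equiv> max 0 ((bE - bC)\<^sup>2 - lam * var_diff vC vE cv) + var_diff vC vE cv"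
  assumes D: "D > 0"
  shows "p_hat lam bC bE vC vE cv = (vC - cv) / D"
proof -
  let ?f = "mse_criterion lam bC bE vC vE cv"
  define q where "q = (vC - cv) / D"
  have q: "vC - cv = D * q" using D by (simp add: q_def)
  have e: "?f p = D * p\<^sup>2 - 2 * p * (vC - cv) + vC" for p
    unfolding mse_criterion_def D_def var_diff_def by (simp add: algebra_simps power2_eq_square)
  have f: "?f p = ?f q + D * (p - q)\<^sup>2" for p
    unfolding e[of p] e[of q] q by (simp add: algebra_simps power2_eq_square)
  have "is_arg_min ?f (\<lambda>_. True) x \<longleftrightarrow> x = q" for x
  proof
    assume "is_arg_min ?f (\<lambda>_. True) x"
    then have "?f x \<le> ?f q" by (auto simp: is_arg_min_linorder)
    then have "D * (x - q)\<^sup>2 \<le> 0" using f[of x] by linarith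
    then show "x = q" using D by (simp add: mult_le_0_iff)
  next
    assume "x = q"
    moreover have "?f q \<le> ?f y" for y using f[of y] D by simp
    ultimately show "is_arg_min ?f (\<lambda>_. True) x" by (simp add: is_arg_min_linorder)
  qed
  then show ?thesis unfolding p_hat_def arg_min_def q_def[symmetric] by (intro some_equality) auto
qed


section \<open>The asymptotic hypotheses\<close>

text \<open>
  The sample of size \<open>n\<close> lives on its own probability space \<open>M n\<close>; the parameters \<open>b0 n\<close> and
  \<open>b1 n\<close> (written \<open>\<beta>\<^sub>0\<close> and \<open>\<beta>\<^sub>E\<close> on paper) may depend on \<open>n\<close>.
\<close>

definition asymptotic_hyps ::
    "real \<Rightarrow> real \<Rightarrow> (nat \<Rightarrow> 'a measure) \<Rightarrow> (nat \<Rightarrow> real) \<Rightarrow> (nat \<Rightarrow> real) \<Rightarrow>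
     (nat \<Rightarrow> 'a \<Rightarrow> real) \<Rightarrow> (nat \<Rightarrow> 'a \<Rightarrow> real) \<Rightarrow>
     (nat \<Rightarrow> 'a \<Rightarrow> real) \<Rightarrow> (nat \<Rightarrow> 'a \<Rightarrow> real) \<Rightarrow> (nat \<Rightarrow> 'a \<Rightarrow> real) \<Rightarrow> bool" where
  "asymptotic_hyps sigC2 sigE2 M b0 b1 bC bE VC VE Cov \<longleftrightarrow>
     (\<forall>n. prob_space (M n) \<and>
          bC n \<in> borel_measurable (M n) \<and> bE n \<in> borel_measurable (M n) \<and>
          VC n \<in> borel_measurable (M n) \<and> VE n \<in> borel_measurable (M n) \<and>
          Cov n \<in> borel_measurable (M n)) \<and>
     converges_in_distribution M
       (\<lambda>n \<omega>. sqrt (real n) *\<^sub>R (vector [bC n \<omega> - b0 n, bE n \<omega> - b1 n] :: real ^ 2))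
       (multivariate_normal 0 (vector [vector [sigC2, sigE2], vector [sigE2, sigE2]])) \<and>
     converges_in_probability M (\<lambda>n \<omega>. real n * VC n \<omega>) sigC2 \<and>
     converges_in_probability M (\<lambda>n \<omega>. real n * VE n \<omega>) sigE2 \<and>
     converges_in_probability M (\<lambda>n \<omega>. real n * Cov n \<omega>) sigE2"

text \<open>The law of \<open>\<surd>n (\<beta>\<^sub>M\<^sub>S\<^sub>E\<^sub>,\<^sub>\<lambda> - \<beta>\<^sub>0)\<close>.\<close>

definition mse_law ::
    "real \<Rightarrow> (nat \<Rightarrow> 'a measure) \<Rightarrow> (nat \<Rightarrow> real) \<Rightarrow>
     (nat \<Rightarrow> 'a \<Rightarrow> real) \<Rightarrow> (nat \<Rightarrow> 'a \<Rightarrow> real) \<Rightarrow>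
     (nat \<Rightarrow> 'a \<Rightarrow> real) \<Rightarrow> (nat \<Rightarrow> 'a \<Rightarrow> real) \<Rightarrow> (nat \<Rightarrow> 'a \<Rightarrow> real) \<Rightarrow>
     nat \<Rightarrow> real measure" where
  "mse_law lam M b0 bC bE VC VE Cov n =
     distr (M n) borel (\<lambda>\<omega>. sqrt (real n) *
       (beta_mse lam (bC n \<omega>) (bE n \<omega>) (VC n \<omega>) (VE n \<omega>) (Cov n \<omega>) - b0 n))"

end

theory Submission
  imports Defs "HOL-Real_Asymp.Real_Asymp"
begin

text \<open>
  By Slutsky's theorem the normalised estimator has, locally, the same limit as a fixed continuous
  function of the limiting pair; writing the pair as \<open>(s Z\<^sub>2 - t Z\<^sub>1, s Z\<^sub>2)\<close> with \<open>s\<^sup>2 = \<sigma>\<^sub>E\<^sup>2\<close> and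
  \<open>t\<^sup>2 = \<sigma>\<^sub>C\<^sup>2 - \<sigma>\<^sub>E\<^sup>2\<close>, the limit is \<open>s Z\<^sub>2 + t (\<theta> - \<delta>\<^sub>\<lambda> (\<theta> + Z\<^sub>1))\<close> with \<open>\<theta> = h/t\<close> and
  \<open>\<delta>\<^sub>\<lambda>(x) = x (1 - 1 / (1 + max 0 (x\<^sup>2 - \<lambda>)))\<close>. Its second moment is \<open>s\<^sup>2\<close> plus \<open>t\<^sup>2\<close> times the quadratic risk
  at \<open>\<theta>\<close> of the estimator \<open>\<delta>\<^sub>\<lambda>\<close> of a normal mean, so everything reduces to comparing the risks of
  \<open>\<delta>\<^sub>\<lambda>\<close> and \<open>\<delta>\<^sub>0\<close>.

  Stein's identity turns the difference of the risks into the mean under \<open>N(\<theta>, 1)\<close> of an explicit even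
  function that is positive near the origin and changes sign once. A comparison of \<open>cosh (\<theta> x)\<close> with a
  quadratic function then shows that the improvement of \<open>\<delta>\<^sub>\<lambda>\<close> on \<open>\<delta>\<^sub>0\<close> is largest at \<open>\<theta> = 0\<close>. It remains to find
  one \<open>\<theta>\<close> at which \<open>\<delta>\<^sub>\<lambda>\<close> loses more than it gains at \<open>0\<close>. For \<open>\<lambda> > 22/5\<close> a crude estimate at
  \<open>\<theta> = \<surd>\<lambda>\<close> suffices. For smaller \<open>\<lambda>\<close> one may take \<open>\<theta> = 2\<close>: the sum of the risk differences at \<open>0\<close> and
  at \<open>\<plusminus>2\<close> (averaged) is one integral against the corresponding mixture of normal densities, which is
  bounded from below on a grid, for \<open>\<lambda>\<close> in each of \<open>(0, 1]\<close>, \<open>[1, 2]\<close>, \<open>[2, 3]\<close> and \<open>[3, 22/5]\<close>.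
\<close>

section \<open>Enclosures of the exponential function\<close>

text \<open>The maximal loss has no closed form and its location moves with the threshold, so
  nothing is computed at the maximiser. The risk difference is continuous and even in the parameter
  and tends to 0 at infinity; hence its extremum is attained as soon as it takes the right sign
  somewhere, and one parameter at which the loss beats the gain at the origin settles the
  comparison. Loss and gain both tend to 0 with \<open>l\<close>, so crude separate estimates of the
  risks cannot succeed for small thresholds. Under one integral the leading term becomes a
  nonnegative factor times the derivative of a single explicit function, and the remaining term is
  nonnegative; each grid cell then costs only an increment of that function. For
  \<open>l \<le> 1\<close> every bound carries a factor \<open>l\<close>. Maximality at the origin
  rests on two facts: the sign of the pointwise difference changes where \<open>x^2 \<le> 3\<close>,
  the range in which \<open>cosh\<close> stays below the matching Gaussian exponential, and the
  second derivative of the risk difference at 0 has the right sign.\<close>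

lemma exp_add_interval:
  fixes x y z :: real
  assumes "exp x \<in> {a..b}" "exp y \<in> {c..d}" "0 \<le> a" "0 \<le> c" "l \<le> a * c" "b * d \<le> u" "z = x + y"
  shows "exp z \<in> {l..u}"
proof -
  have "a * c \<le> exp x * exp y" "exp x * exp y \<le> b * d"
    using assms by (intro mult_mono; auto)+
  then show ?thesis using assms by (auto simp: exp_add)
qed

text \<open>\<open>(k / 4)^2 / 2 = k^2 / 32\<close>, so square values of \<open>n\<close> give the
  Gaussian exponential at multiples of \<open>1 / 4\<close>, the mesh of the grid.\<close>

abbreviation (input) exp_enclosed :: "real \<Rightarrow> real \<Rightarrow> real \<Rightarrow> bool" where
  "exp_enclosed n a b \<equiv> exp (- (n / 32)) \<in> {a / 10 ^ 9..b / 10 ^ 9}"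

text \<open>Only \<open>exp (- 1 / 32)\<close> comes from a Taylor polynomial. Odd multiples follow
  in steps of two, then the squares through \<open>(k + 1)^2 = k^2 + (2 * k + 1)\<close>, with one
  interval product each. Squares up to \<open>24^2\<close> occur because \<open>x + 2\<close>
  reaches \<open>6\<close> on the grid.\<close>

lemma exp_quarter_squares:
  shows "exp_enclosed 1 969233194 969233275"
    and "exp_enclosed 4 882496753 882497052"
    and "exp_enclosed 9 754839314 754839891"
    and "exp_enclosed 16 606530248 606531073"
    and "exp_enclosed 25 457832876 457833850"
    and "exp_enclosed 36 324651972 324652966"
    and "exp_enclosed 49 216264718 216265619"
    and "exp_enclosed 64 135334916 135335653"
    and "exp_enclosed 81 79559235 79559784"
    and "exp_enclosed 100 43936747 43937122"
    and "exp_enclosed 121 22794063 22794299"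
    and "exp_enclosed 144 11108928 11109065"
    and "exp_enclosed 169 5086032 5086106"
    and "exp_enclosed 196 2187472 2187510"
    and "exp_enclosed 225 883817 883836"
    and "exp_enclosed 256 335458 335467"
    and "exp_enclosed 289 119611 119615"
    and "exp_enclosed 324 40064 40067"
    and "exp_enclosed 361 12606 12608"
    and "exp_enclosed 400 3726 3727"
    and "exp_enclosed 441 1034 1035"
    and "exp_enclosed 484 269 270"
    and "exp_enclosed 529 65 67"
    and "exp_enclosed 576 14 16"
proof -
  obtain t where t: "\<bar>t\<bar> \<le> \<bar>- (1 / 32) :: real\<bar>"
    and e: "exp (- (1 / 32) :: real) = (\<Sum>m<4. ((- (1 / 32)) ^ m) / fact m) + (exp t / fact 4) * (- (1 / 32)) ^ 4"
    using Maclaurin_exp_le[of "- (1 / 32)" 4] by blast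
  \<comment> \<open>The bound \<open>2\<close> is enough: the remainder carries the factor
    \<open>(1 / 32)^4 / 24\<close> and stays below \<open>10^-7\<close>.\<close>
  have "exp t \<le> exp (1 / 32)" using t by simp
  also have "\<dots> \<le> 1 + 1 / 32 + (1 / 32)\<^sup>2" by (rule exp_bound) auto
  finally have t: "0 \<le> exp t" "exp t \<le> 2" by (simp_all add: power2_eq_square)
  define T where "T = exp t"
  show s1: "exp_enclosed 1 969233194 969233275"
    using t unfolding e T_def[symmetric] by (simp add: numeral_eq_Suc fact_numeral)
  have d2: "exp_enclosed 2 939412984 939413142"
    by (rule exp_add_interval[OF s1 s1]) simp_all
  have d3: "exp_enclosed 3 910510246 910510477"
    by (rule exp_add_interval[OF s1 d2]) simp_all
  have d5: "exp_enclosed 5 855345147 855345509"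
    by (rule exp_add_interval[OF d3 d2]) simp_all
  have d7: "exp_enclosed 7 803522336 803522813"
    by (rule exp_add_interval[OF d5 d2]) simp_all
  have d9: "exp_enclosed 9 754839315 754839891"
    by (rule exp_add_interval[OF d7 d2]) simp_all
  have d11: "exp_enclosed 11 709105853 709106514"
    by (rule exp_add_interval[OF d9 d2]) simp_all
  have d13: "exp_enclosed 13 666143245 666143979"
    by (rule exp_add_interval[OF d11 d2]) simp_all
  have d15: "exp_enclosed 15 625783613 625784409"
    by (rule exp_add_interval[OF d13 d2]) simp_all
  have d17: "exp_enclosed 17 587869251 587870098"
    by (rule exp_add_interval[OF d15 d2]) simp_all
  have d19: "exp_enclosed 19 552252007 552252896"
    by (rule exp_add_interval[OF d17 d2]) simp_all
  have d21: "exp_enclosed 21 518792705 518793629"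
    by (rule exp_add_interval[OF d19 d2]) simp_all
  have d23: "exp_enclosed 23 487360603 487361554"
    by (rule exp_add_interval[OF d21 d2]) simp_all
  have d25: "exp_enclosed 25 457832878 457833849"
    by (rule exp_add_interval[OF d23 d2]) simp_all
  have d27: "exp_enclosed 27 430094150 430095135"
    by (rule exp_add_interval[OF d25 d2]) simp_all
  have d29: "exp_enclosed 29 404036028 404037023"
    by (rule exp_add_interval[OF d27 d2]) simp_all
  have d31: "exp_enclosed 31 379556690 379557690"
    by (rule exp_add_interval[OF d29 d2]) simp_all
  have d33: "exp_enclosed 33 356560482 356561483"
    by (rule exp_add_interval[OF d31 d2]) simp_all
  have d35: "exp_enclosed 35 334957546 334958544"
    by (rule exp_add_interval[OF d33 d2]) simp_all
  have d37: "exp_enclosed 37 314663467 314664459"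
    by (rule exp_add_interval[OF d35 d2]) simp_all
  have d39: "exp_enclosed 39 295598946 295599929"
    by (rule exp_add_interval[OF d37 d2]) simp_all
  have d41: "exp_enclosed 41 277689487 277690459"
    by (rule exp_add_interval[OF d39 d2]) simp_all
  have d43: "exp_enclosed 43 260865109 260866067"
    by (rule exp_add_interval[OF d41 d2]) simp_all
  have d45: "exp_enclosed 45 245060070 245061012"
    by (rule exp_add_interval[OF d43 d2]) simp_all
  have d47: "exp_enclosed 47 230212611 230213536"
    by (rule exp_add_interval[OF d45 d2]) simp_all
  show s2: "exp_enclosed 4 882496753 882497052"
    by (rule exp_add_interval[OF s1 d3]) simp_all
  show s3: "exp_enclosed 9 754839314 754839891"
    by (rule exp_add_interval[OF s2 d5]) simp_all
  show s4: "exp_enclosed 16 606530248 606531073"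
    by (rule exp_add_interval[OF s3 d7]) simp_all
  show s5: "exp_enclosed 25 457832876 457833850"
    by (rule exp_add_interval[OF s4 d9]) simp_all
  show s6: "exp_enclosed 36 324651972 324652966"
    by (rule exp_add_interval[OF s5 d11]) simp_all
  show s7: "exp_enclosed 49 216264718 216265619"
    by (rule exp_add_interval[OF s6 d13]) simp_all
  show s8: "exp_enclosed 64 135334916 135335653"
    by (rule exp_add_interval[OF s7 d15]) simp_all
  show s9: "exp_enclosed 81 79559235 79559784"
    by (rule exp_add_interval[OF s8 d17]) simp_all
  show s10: "exp_enclosed 100 43936747 43937122"
    by (rule exp_add_interval[OF s9 d19]) simp_all
  show s11: "exp_enclosed 121 22794063 22794299"
    by (rule exp_add_interval[OF s10 d21]) simp_all
  show s12: "exp_enclosed 144 11108928 11109065"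
    by (rule exp_add_interval[OF s11 d23]) simp_all
  show s13: "exp_enclosed 169 5086032 5086106"
    by (rule exp_add_interval[OF s12 d25]) simp_all
  show s14: "exp_enclosed 196 2187472 2187510"
    by (rule exp_add_interval[OF s13 d27]) simp_all
  show s15: "exp_enclosed 225 883817 883836"
    by (rule exp_add_interval[OF s14 d29]) simp_all
  show s16: "exp_enclosed 256 335458 335467"
    by (rule exp_add_interval[OF s15 d31]) simp_all
  show s17: "exp_enclosed 289 119611 119615"
    by (rule exp_add_interval[OF s16 d33]) simp_all
  show s18: "exp_enclosed 324 40064 40067"
    by (rule exp_add_interval[OF s17 d35]) simp_all
  show s19: "exp_enclosed 361 12606 12608"
    by (rule exp_add_interval[OF s18 d37]) simp_all
  show s20: "exp_enclosed 400 3726 3727"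
    by (rule exp_add_interval[OF s19 d39]) simp_all
  show s21: "exp_enclosed 441 1034 1035"
    by (rule exp_add_interval[OF s20 d41]) simp_all
  show s22: "exp_enclosed 484 269 270"
    by (rule exp_add_interval[OF s21 d43]) simp_all
  show s23: "exp_enclosed 529 65 67"
    by (rule exp_add_interval[OF s22 d45]) simp_all
  show s24: "exp_enclosed 576 14 16"
    by (rule exp_add_interval[OF s23 d47]) simp_all
qed

section \<open>Thresholded weights and the three-point mixture\<close>

text \<open>The limit of \<open>p_hat\<close> when the difference of the two estimators, in units of
  its limiting standard deviation, equals \<open>x\<close>.\<close>

definition weight :: "real \<Rightarrow> real \<Rightarrow> real" where
  "weight l x = 1 / (max 0 (x\<^sup>2 - l) + 1)"

lemma weight_0: "weight 0 x = 1 / (1 + x\<^sup>2)"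
  by (simp add: weight_def add.commute)

lemma weight_pos: "0 < weight l x" and weight_le_1: "weight l x \<le> 1"
  by (auto simp: weight_def)

lemma weight_mono: "l \<le> l' \<Longrightarrow> weight l x \<le> weight l' x"
  unfolding weight_def by (intro divide_left_mono) (auto simp: max_def)

lemma weight_minus [simp]: "weight l (- x) = weight l x"
  by (simp add: weight_def)

lemma continuous_weight [continuous_intros]: "continuous_on A (weight l)"
  unfolding weight_def by (intro continuous_intros) (auto simp: max_def)

text \<open>\<open>x * excess l x\<close> is the amount by which the threshold moves the estimate of
  a normal mean towards 0.\<close>

definition excess :: "real \<Rightarrow> real \<Rightarrow> real" where
  "excess l x = weight l x - weight 0 x"

lemma excess_mono: "l \<le> l' \<Longrightarrow> excess l x \<le> excess l' x"
  using weight_mono by (simp add: excess_def)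

lemma excess_nonneg: "0 \<le> l \<Longrightarrow> 0 \<le> excess l x"
  using weight_mono[of 0 l x] by (simp add: excess_def)

lemma excess_inner:
  assumes "x\<^sup>2 \<le> l" shows "excess l x = x\<^sup>2 / (1 + x\<^sup>2)"
proof -
  have "1 + x\<^sup>2 \<noteq> 0" by (smt (verit) zero_le_power2)
  then show ?thesis using assms by (simp add: excess_def weight_0) (simp add: weight_def field_simps)
qed

lemma excess_outer:
  assumes "l \<le> x\<^sup>2" "0 \<le> l" shows "excess l x = l / ((1 + x\<^sup>2) * (1 + x\<^sup>2 - l))"
proof -
  have p: "0 < 1 + x\<^sup>2" "0 < 1 + x\<^sup>2 - l" using assms by (auto simp: add_pos_nonneg)
  have "weight l x = 1 / (1 + x\<^sup>2 - l)" using assms by (simp add: weight_def max_def add.commute)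
  then have "excess l x = 1 / (1 + x\<^sup>2 - l) - 1 / (1 + x\<^sup>2)" by (simp add: excess_def weight_0)
  also have "\<dots> = l / ((1 + x\<^sup>2) * (1 + x\<^sup>2 - l))"
    using p by (simp add: diff_frac_eq less_imp_neq[symmetric] mult.commute)
  finally show ?thesis .
qed

text \<open>
  Up to the factor \<open>1 / \<surd>(2\<pi>)\<close>, the density of an observation \<open>N(h, 1)\<close> summed over the measure that
  puts mass \<open>1\<close> at \<open>h = 0\<close> and mass \<open>1/2\<close> at each of \<open>h = \<plusminus>2\<close>. The integral of \<open>gain_density l\<close> is the
  risk of the rule with threshold \<open>l\<close> minus the risk of the rule with threshold \<open>0\<close>, integrated
  against this measure; by Tweedie's formula it depends on \<open>h\<close> only through \<open>mixture\<close> and its derivative.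
\<close>

definition mixture :: "real \<Rightarrow> real" where
  "mixture x = exp (- (x\<^sup>2 / 2)) + (exp (- ((x - 2)\<^sup>2 / 2)) + exp (- ((x + 2)\<^sup>2 / 2))) / 2"

definition mixture' :: "real \<Rightarrow> real" where
  "mixture' x = - x * exp (- (x\<^sup>2 / 2)) - ((x - 2) * exp (- ((x - 2)\<^sup>2 / 2)) + (x + 2) * exp (- ((x + 2)\<^sup>2 / 2))) / 2"

text \<open>\<open>sqrt (1 + x^2)\<close> is the integrating factor of
  \<open>mixture' x + x / (1 + x^2) * mixture x\<close>, the combination that multiplies
  \<open>2 * x * excess l x\<close> in \<open>gain_density\<close>.\<close>

definition scaled_mixture :: "real \<Rightarrow> real" where
  "scaled_mixture x = sqrt (1 + x\<^sup>2) * mixture x"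

definition mixture_slope :: "real \<Rightarrow> real" where
  "mixture_slope x = (1 + x\<^sup>2) * mixture' x + x * mixture x"

definition gain_density :: "real \<Rightarrow> real \<Rightarrow> real" where
  "gain_density l x = 2 * (x * excess l x) * mixture_slope x / (1 + x\<^sup>2) + x\<^sup>2 * (excess l x)\<^sup>2 * mixture x"

lemma mixture_pos: "0 < mixture x" by (auto simp: mixture_def intro!: add_pos_pos)

lemma scaled_mixture_pos: "0 < scaled_mixture x" using mixture_pos by (simp add: scaled_mixture_def add_pos_nonneg)

lemma mixture_deriv: "(mixture has_real_derivative mixture' x) (at x)"
  unfolding mixture_def[abs_def] mixture'_def by (auto intro!: derivative_eq_intros simp: field_simps)

lemma one_plus_square_pos: "0 < 1 + x\<^sup>2" for x :: real
  by (simp add: add_pos_nonneg)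

lemma scaled_mixture_deriv: "(scaled_mixture has_real_derivative mixture_slope x / sqrt (1 + x\<^sup>2)) (at x)"
proof -
  have p: "0 < 1 + x\<^sup>2" by (rule one_plus_square_pos)
  have s: "sqrt (1 + x\<^sup>2) * sqrt (1 + x\<^sup>2) = 1 + x\<^sup>2" using p by simp
  have "(scaled_mixture has_real_derivative (x / sqrt (1 + x\<^sup>2)) * mixture x + mixture' x * sqrt (1 + x\<^sup>2)) (at x)"
    unfolding scaled_mixture_def[abs_def]
    using p by (auto intro!: derivative_eq_intros mixture_deriv simp: field_simps)
  moreover have "(x / sqrt (1 + x\<^sup>2)) * mixture x + mixture' x * sqrt (1 + x\<^sup>2) = mixture_slope x / sqrt (1 + x\<^sup>2)"
    using p s by (simp add: mixture_slope_def field_simps)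
  ultimately show ?thesis by simp
qed

lemma continuous_mixture: "continuous_on A mixture" "continuous_on A mixture'"
  "continuous_on A scaled_mixture" "continuous_on A mixture_slope"
  unfolding mixture_def[abs_def] mixture'_def[abs_def] scaled_mixture_def[abs_def] mixture_slope_def[abs_def]
  by (intro continuous_intros; simp)+

lemma continuous_excess: "continuous_on A (excess l)"
  unfolding excess_def[abs_def] by (intro continuous_intros)

lemma continuous_gain_density: "continuous_on A (gain_density l)"
  unfolding gain_density_def[abs_def]
  by (intro continuous_intros continuous_excess continuous_mixture)
     (use one_plus_square_pos in \<open>auto simp: less_imp_neq[symmetric] add_nonneg_eq_0_iff\<close>)

text \<open>
  The sign of \<open>mixture_slope x\<close>, which is \<open>\<surd>(1 + x\<^sup>2)\<close> times the derivative of \<open>scaled_mixture\<close>, is that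
  of \<open>slope x - exp 2\<close>, and \<open>slope\<close> is decreasing; so \<open>scaled_mixture\<close> increases up to a point between
  \<open>7/4\<close> and \<open>2\<close> and decreases afterwards.
\<close>

definition slope :: "real \<Rightarrow> real" where
  "slope x = 2 * (1 / x ^ 3 + 1 / x) * sinh (2 * x) - cosh (2 * x)"

lemma mixture_slope_eq:
  assumes "0 < x"
  shows "mixture_slope x = exp (- (x\<^sup>2 / 2) - 2) * x ^ 3 * (slope x - exp 2)"
proof -
  have a: "exp (- ((x - 2)\<^sup>2 / 2)) = exp (- (x\<^sup>2 / 2) - 2) * exp (2 * x)"
    by (simp add: exp_add[symmetric] power2_eq_square field_simps)
  have b: "exp (- ((x + 2)\<^sup>2 / 2)) = exp (- (x\<^sup>2 / 2) - 2) * exp (- (2 * x))"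
    by (simp add: exp_add[symmetric] power2_eq_square field_simps)
  have c: "exp (- (x\<^sup>2 / 2)) = exp (- (x\<^sup>2 / 2) - 2) * exp 2"
    by (simp add: exp_add[symmetric])
  show ?thesis
    unfolding mixture_slope_def mixture_def mixture'_def a b c slope_def sinh_def cosh_def
    using assms by (simp add: field_simps power2_eq_square power3_eq_cube)
qed

lemma sinh_le_mult_cosh: "sinh y \<le> y * cosh y" if "0 \<le> y" for y :: real
proof -
  have "(\<lambda>y. y * cosh y - sinh y) 0 \<le> (\<lambda>y. y * cosh y - sinh y) y"
    by (rule DERIV_nonneg_imp_nondecreasing[OF that])
       (auto intro!: exI derivative_eq_intros mult_nonneg_nonneg)
  then show ?thesis by simp
qed

lemma mult_cosh_le_sinh: "y * cosh y \<le> sinh y * (1 + y\<^sup>2 / 3)" if "0 \<le> y" for y :: real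
proof -
  define g :: "real \<Rightarrow> real" where "g y = sinh y * (1 + y\<^sup>2 / 3) - y * cosh y" for y
  have "g 0 \<le> g y"
  proof (rule DERIV_nonneg_imp_nondecreasing[OF that])
    fix x :: real assume x: "0 \<le> x" "x \<le> y"
    have "(g has_real_derivative (cosh x * (1 + x\<^sup>2 / 3) + sinh x * (2 * x / 3) - (cosh x + x * sinh x))) (at x)"
      unfolding g_def[abs_def] by (auto intro!: derivative_eq_intros simp: field_simps)
    moreover have "cosh x * (1 + x\<^sup>2 / 3) + sinh x * (2 * x / 3) - (cosh x + x * sinh x) = x / 3 * (x * cosh x - sinh x)"
      by (simp add: field_simps power2_eq_square)
    ultimately show "\<exists>d. (g has_real_derivative d) (at x) \<and> 0 \<le> d"
      using sinh_le_mult_cosh[OF x(1)] x(1) by (metis diff_ge_0_iff_ge divide_nonneg_pos mult_nonneg_nonneg zero_less_numeral)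
  qed
  then show ?thesis by (simp add: g_def)
qed

text \<open>This is the numerator of the derivative of \<open>slope\<close>. Up to \<open>1\<close>
  the bound of \<open>y * cosh y\<close> by \<open>sinh y * (1 + y^2 / 3)\<close> is sharp enough;
  beyond \<open>1\<close> the ratio of \<open>sinh (2 * x)\<close> to \<open>cosh (2 * x)\<close>
  exceeds \<open>24 / 25\<close>, and a polynomial inequality remains.\<close>

lemma slope_aux:
  fixes x :: real assumes x: "0 < x"
  shows "(2 * x + 2 * x ^ 3) * cosh (2 * x) \<le> (3 + x\<^sup>2 + x ^ 4) * sinh (2 * x)"
proof (cases "x \<le> 1")
  case True
  have "2 * x * cosh (2 * x) \<le> sinh (2 * x) * (1 + (2 * x)\<^sup>2 / 3)" using mult_cosh_le_sinh[of "2 * x"] x by simp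
  then have "(1 + x\<^sup>2) * (2 * x * cosh (2 * x)) \<le> (1 + x\<^sup>2) * (sinh (2 * x) * (1 + (2 * x)\<^sup>2 / 3))"
    by (intro mult_left_mono) auto
  moreover have "(1 + x\<^sup>2) * (1 + (2 * x)\<^sup>2 / 3) \<le> 3 + x\<^sup>2 + x ^ 4"
  proof -
    have "x\<^sup>2 \<le> 1" "x ^ 4 \<le> 1" using True x by (auto intro: power_le_one)
    then have "4 * x\<^sup>2 + x ^ 4 \<le> 6" by simp
    then show ?thesis by (simp add: field_simps power2_eq_square power4_eq_xxxx)
  qed
  then have "sinh (2 * x) * ((1 + x\<^sup>2) * (1 + (2 * x)\<^sup>2 / 3)) \<le> sinh (2 * x) * (3 + x\<^sup>2 + x ^ 4)"
    using x by (intro mult_left_mono) auto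
  ultimately show ?thesis by (simp add: field_simps power2_eq_square power3_eq_cube)
next
  case False
  have "exp (- 4 * x) \<le> exp (- 4)" using False by simp
  also have "exp (- 4 :: real) \<in> {0..1 / 50}"
    by (rule exp_add_interval[OF exp_quarter_squares(8) exp_quarter_squares(8)]) simp_all
  then have "exp (- 4 :: real) \<le> 1 / 50" by simp
  finally have "exp (- 4 * x) \<le> 1 / 50" .
  then have e: "exp (- (2 * x)) * 50 \<le> exp (2 * x)"
  proof -
    assume a: "exp (- 4 * x) \<le> 1 / 50"
    have "exp (- (2 * x)) = exp (- 4 * x) * exp (2 * x)" by (simp add: exp_add[symmetric])
    then show ?thesis using a by simp
  qed
  have t: "24 / 25 * cosh (2 * x) \<le> sinh (2 * x)"
  proof -
    have "24 / 25 * ((a + b) / 2) \<le> (a - b) / 2" if "b * 50 \<le> a" "0 \<le> b" for a b :: real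
      using that by simp
    from this[OF e] show ?thesis by (simp add: sinh_field_def cosh_field_def)
  qed
  have p: "2 * x + 2 * x ^ 3 \<le> 24 / 25 * (3 + x\<^sup>2 + x ^ 4)"
  proof -
    \<comment> \<open>A sum of squares in which \<open>25 / 24\<close> is forced by the cubic term.
      The choices \<open>7 / 10\<close> and \<open>631 / 500\<close> then force
      \<open>850 / 631\<close> through the linear term and leave a nonnegative constant and a
      nonnegative multiple of \<open>x^2\<close>.\<close>
    have "24 / 25 * (3 + x\<^sup>2 + x ^ 4) - (2 * x + 2 * x ^ 3)
      = 24 / 25 * (x\<^sup>2 - 25 / 24 * x - 7 / 10)\<^sup>2 + 631 / 500 * (x - 850 / 631)\<^sup>2
        + (2.88 - 24 / 25 * 0.49 - 631 / 500 * (850 / 631)\<^sup>2)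
        + (24 / 25 * (1 - (25 / 24)\<^sup>2 + 1.4) - 631 / 500) * x\<^sup>2"
      by (simp add: field_simps power2_eq_square power3_eq_cube power4_eq_xxxx)
    moreover have "0 \<le> (2.88 - 24 / 25 * 0.49 - 631 / 500 * (850 / 631)\<^sup>2 :: real)"
      "0 \<le> (24 / 25 * (1 - (25 / 24)\<^sup>2 + 1.4) - 631 / 500) * x\<^sup>2"
      by (simp_all add: power2_eq_square)
    ultimately show ?thesis by (smt (verit) zero_le_power2 mult_nonneg_nonneg divide_nonneg_nonneg)
  qed
  have "(2 * x + 2 * x ^ 3) * cosh (2 * x) \<le> (3 + x\<^sup>2 + x ^ 4) * (24 / 25 * cosh (2 * x))"
    using p by (smt (verit) cosh_real_pos mult.assoc mult.commute mult_right_mono)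
  also have "\<dots> \<le> (3 + x\<^sup>2 + x ^ 4) * sinh (2 * x)"
    using t by (intro mult_left_mono) auto
  finally show ?thesis .
qed

lemma slope_antimono:
  assumes "0 < x" "x \<le> y" shows "slope y \<le> slope x"
proof (rule DERIV_nonpos_imp_nonincreasing[OF assms(2)])
  fix z assume z: "x \<le> z" "z \<le> y"
  then have z0: "0 < z" using assms by simp
  define d where "d = 2 * (- 3 / z ^ 4 - 1 / z\<^sup>2) * sinh (2 * z) + 4 * (1 / z ^ 3 + 1 / z) * cosh (2 * z) - 2 * sinh (2 * z)"
  have "(slope has_real_derivative d) (at z)"
    unfolding slope_def[abs_def] d_def using z0
    by (auto intro!: derivative_eq_intros simp: field_simps power2_eq_square power3_eq_cube power4_eq_xxxx)
  moreover have "d = 2 / z ^ 4 * ((2 * z + 2 * z ^ 3) * cosh (2 * z) - (3 + z\<^sup>2 + z ^ 4) * sinh (2 * z))"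
    using z0 by (simp add: d_def field_simps power2_eq_square power3_eq_cube power4_eq_xxxx)
  moreover have "\<dots> \<le> 0" using slope_aux[OF z0] z0 by (intro mult_nonneg_nonpos) auto
  ultimately show "\<exists>d. (slope has_real_derivative d) (at z) \<and> d \<le> 0" by auto
qed

text \<open>As \<open>slope\<close> is antitone, its values at \<open>7 / 4\<close> and
  \<open>2\<close> decide the sign outside the interval between them. Inside,
  \<open>slope x - exp 2\<close> is at least \<open>- 6 / 10\<close> and its positive factor at most
  \<open>3 / 100 * 2^3\<close>, which gives \<open>- 144 / 1000\<close>.\<close>

lemma mixture_slope_signs:
  shows mixture_slope_nonneg: "0 < x \<Longrightarrow> x \<le> 7 / 4 \<Longrightarrow> 0 \<le> mixture_slope x"
    and mixture_slope_nonpos: "2 \<le> x \<Longrightarrow> mixture_slope x \<le> 0"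
    and mixture_slope_mid: "7 / 4 \<le> x \<Longrightarrow> x \<le> 2 \<Longrightarrow> - (15 / 100) \<le> mixture_slope x"
proof -
  have e2: "exp (- 2 :: real) \<in> {13533 / 10 ^ 5..13534 / 10 ^ 5}"
    using exp_quarter_squares(8) by simp
  have e2': "exp 2 \<in> {10 ^ 5 / 13534..10 ^ 5 / 13533 :: real}"
    using e2 by (simp add: exp_minus field_simps)
  have e4: "exp (- 4 :: real) \<in> {18315 / 10 ^ 6..18317 / 10 ^ 6}"
    by (rule exp_add_interval[OF exp_quarter_squares(8) exp_quarter_squares(8)]) simp_all
  have e4': "exp 4 \<in> {10 ^ 6 / 18317..10 ^ 6 / 18315 :: real}"
    using e4 by (simp add: exp_minus field_simps)
  have e80: "exp (- (80 / 32) :: real) \<in> {82084 / 10 ^ 6..82086 / 10 ^ 6}"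
    by (rule exp_add_interval[OF exp_quarter_squares(8) exp_quarter_squares(4)]) simp_all
  have e96: "exp (- (96 / 32) :: real) \<in> {49786 / 10 ^ 6..49788 / 10 ^ 6}"
    by (rule exp_add_interval[OF e80 exp_quarter_squares(4)]) simp_all
  have e112: "exp (- (7 / 2) :: real) \<in> {30196 / 10 ^ 6..30199 / 10 ^ 6}"
    by (rule exp_add_interval[OF e96 exp_quarter_squares(4)]) simp_all
  have e112': "exp (7 / 2) \<in> {10 ^ 6 / 30199..10 ^ 6 / 30196 :: real}"
    using e112 by (simp add: exp_minus field_simps)
  have s2: "slope 2 = exp 4 / 8 - 9 / 8 * exp (- 4)"
    by (simp add: slope_def sinh_def cosh_def field_simps)
  have s2l: "exp 2 - 6 / 10 \<le> slope 2" and s2u: "slope 2 \<le> exp 2"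
    using e2' e4 e4' by (simp_all add: s2)
  have "slope (7 / 4) = (520 / 343 - 1) / 2 * exp (7 / 2) - (520 / 343 + 1) / 2 * exp (- (7 / 2))"
    by (simp add: slope_def sinh_def cosh_def field_simps power3_eq_cube)
  then have s7: "exp 2 \<le> slope (7 / 4)"
    using e2' e112 e112' by simp
  show "0 \<le> mixture_slope x" if "0 < x" "x \<le> 7 / 4"
    using mixture_slope_eq[of x] slope_antimono[of x "7 / 4"] s7 that by simp
  show "mixture_slope x \<le> 0" if "2 \<le> x"
    using mixture_slope_eq[of x] slope_antimono[of 2 x] s2u that by (simp add: mult_nonneg_nonpos)
  show "- (15 / 100) \<le> mixture_slope x" if x: "7 / 4 \<le> x" "x \<le> 2"
  proof -
    have a: "- (6 / 10) \<le> slope x - exp 2" using slope_antimono[of x 2] s2l x by simp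
    have "(7 / 4) * (7 / 4) \<le> x * x" using x by (intro mult_mono) auto
    then have "exp (- (x\<^sup>2 / 2) - 2) \<le> exp (- (113 / 32))"
      by (simp add: power2_eq_square)
    also have "exp (- (113 / 32) :: real) \<in> {0..3 / 100}"
      by (rule exp_add_interval[OF exp_quarter_squares(7) exp_quarter_squares(8)]) simp_all
    then have "exp (- (113 / 32) :: real) \<le> 3 / 100" by simp
    finally have "exp (- (x\<^sup>2 / 2) - 2) \<le> 3 / 100" .
    moreover have "x ^ 3 \<le> 2 ^ 3" using x by (intro power_mono) auto
    ultimately have b: "exp (- (x\<^sup>2 / 2) - 2) * x ^ 3 \<le> 3 / 100 * 2 ^ 3"
      using x by (intro mult_mono) auto
    have "exp (- (x\<^sup>2 / 2) - 2) * x ^ 3 * - (6 / 10) \<le> exp (- (x\<^sup>2 / 2) - 2) * x ^ 3 * (slope x - exp 2)"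
      using a x by (intro mult_left_mono) auto
    then show ?thesis using b mixture_slope_eq[of x] x by simp
  qed
qed

section \<open>Lower bounds for the gain integral\<close>

definition gain_factor :: "real \<Rightarrow> real \<Rightarrow> real" where
  "gain_factor l x = x * excess l x / sqrt (1 + x\<^sup>2)"

lemma abs_le_one_plus_square: "\<bar>x\<bar> \<le> 1 + x\<^sup>2" for x :: real
proof -
  have "0 \<le> (\<bar>x\<bar> - 1)\<^sup>2 + \<bar>x\<bar>" by simp
  then show ?thesis by (simp add: power2_eq_square algebra_simps)
qed

lemma sqrt_one_plus_square_pos: "0 < sqrt (1 + x\<^sup>2)" for x :: real
  using one_plus_square_pos by simp

lemma gain_density_eq:
  "gain_density l x = 2 * gain_factor l x * (mixture_slope x / sqrt (1 + x\<^sup>2)) + x\<^sup>2 * (excess l x)\<^sup>2 * mixture x"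
  using one_plus_square_pos[of x] by (simp add: gain_density_def gain_factor_def field_simps)

lemma gain_density_integrable: "gain_density l integrable_on {a..b}"
  by (intro integrable_continuous_real continuous_gain_density)

lemma scaled_mixture_has_integral:
  "a \<le> b \<Longrightarrow> ((\<lambda>x. mixture_slope x / sqrt (1 + x\<^sup>2)) has_integral scaled_mixture b - scaled_mixture a) {a..b}"
  by (intro fundamental_theorem_of_calculus)
     (simp_all add: scaled_mixture_deriv has_field_derivative_at_within has_real_derivative_iff_has_vector_derivative[symmetric])

lemma scaled_mixture_mono: "0 \<le> a \<Longrightarrow> a \<le> b \<Longrightarrow> b \<le> 7 / 4 \<Longrightarrow> scaled_mixture a \<le> scaled_mixture b"
proof (rule DERIV_nonneg_imp_nondecreasing, assumption)
  fix x assume "0 \<le> a" "b \<le> 7 / 4" and "a \<le> x" "x \<le> b"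
  moreover have "0 \<le> mixture_slope 0" by (simp add: mixture_slope_def mixture'_def)
  ultimately have "0 \<le> mixture_slope x" using mixture_slope_nonneg[of x] by (cases "x = 0") auto
  then show "\<exists>y. (scaled_mixture has_real_derivative y) (at x) \<and> 0 \<le> y" using scaled_mixture_deriv by fastforce
qed

text \<open>The derivative of \<open>scaled_mixture\<close> is nonnegative here, so the lower bound
  \<open>c\<close> for \<open>gain_factor\<close> may be pulled out and the increment is what
  remains. In the square term \<open>k\<close> bounds \<open>mixture\<close> from below, because
  \<open>scaled_mixture\<close> is smallest and the root largest at opposite ends of the
  cell.\<close>

lemma integral_gain_increasing:
  assumes ab: "0 < a" "a \<le> b" "b \<le> 7 / 4"
    and c: "0 \<le> c" "\<And>x. a \<le> x \<Longrightarrow> x \<le> b \<Longrightarrow> c \<le> gain_factor l x"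
    and q: "0 \<le> q" "\<And>x. a \<le> x \<Longrightarrow> x \<le> b \<Longrightarrow> q \<le> excess l x"
    and k: "0 \<le> k" "k * sqrt (1 + b\<^sup>2) \<le> scaled_mixture a"
  shows "2 * c * (scaled_mixture b - scaled_mixture a) + a\<^sup>2 * q\<^sup>2 * k * (b - a) \<le> integral {a..b} (gain_density l)"
proof -
  have "((\<lambda>x. 2 * c * (mixture_slope x / sqrt (1 + x\<^sup>2)) + a\<^sup>2 * q\<^sup>2 * k) has_integral
      2 * c * (scaled_mixture b - scaled_mixture a) + (b - a) *\<^sub>R (a\<^sup>2 * q\<^sup>2 * k)) {a..b}"
    using has_integral_add[OF has_integral_mult_right[OF scaled_mixture_has_integral[OF ab(2)]]
        has_integral_const_real[of "a\<^sup>2 * q\<^sup>2 * k"], of "2 * c"] ab by simp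
  then have i: "((\<lambda>x. 2 * c * (mixture_slope x / sqrt (1 + x\<^sup>2)) + a\<^sup>2 * q\<^sup>2 * k) has_integral
      2 * c * (scaled_mixture b - scaled_mixture a) + a\<^sup>2 * q\<^sup>2 * k * (b - a)) {a..b}"
    unfolding real_scaleR_def by (simp only: mult.commute[of "b - a"])
  show ?thesis
  proof (rule has_integral_le[OF i integrable_integral[OF gain_density_integrable]])
    fix x assume "x \<in> {a..b}"
    then have x: "a \<le> x" "x \<le> b" by auto
    have "0 \<le> mixture_slope x" using mixture_slope_nonneg[of x] ab x by auto
    then have 1: "2 * c * (mixture_slope x / sqrt (1 + x\<^sup>2)) \<le> 2 * gain_factor l x * (mixture_slope x / sqrt (1 + x\<^sup>2))"
      using c(2)[OF x] by (intro mult_right_mono) auto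
    have "k \<le> mixture x"
    proof -
      have "k * sqrt (1 + x\<^sup>2) \<le> k * sqrt (1 + b\<^sup>2)"
        using k x ab by (intro mult_left_mono real_sqrt_le_mono add_left_mono power_mono) auto
      also have "\<dots> \<le> scaled_mixture a" by (rule k)
      also have "\<dots> \<le> scaled_mixture x" using scaled_mixture_mono[of a x] ab x by auto
      finally show ?thesis using sqrt_one_plus_square_pos[of x] by (simp add: scaled_mixture_def mult.commute)
    qed
    then have 2: "a\<^sup>2 * q\<^sup>2 * k \<le> x\<^sup>2 * (excess l x)\<^sup>2 * mixture x"
      using q x ab k by (intro mult_mono power_mono) auto
    show "2 * c * (mixture_slope x / sqrt (1 + x\<^sup>2)) + a\<^sup>2 * q\<^sup>2 * k \<le> gain_density l x"
      unfolding gain_density_eq using 1 2 by simp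
  qed
qed

text \<open>With a nonpositive derivative an upper bound for \<open>gain_factor\<close> is the
  useful one; the square term is bounded by zero.\<close>

lemma integral_gain_decreasing:
  assumes ab: "2 \<le> a" "a \<le> b"
    and c: "\<And>x. a \<le> x \<Longrightarrow> x \<le> b \<Longrightarrow> gain_factor l x \<le> c"
  shows "- 2 * c * (scaled_mixture a - scaled_mixture b) \<le> integral {a..b} (gain_density l)"
proof -
  have i: "((\<lambda>x. 2 * c * (mixture_slope x / sqrt (1 + x\<^sup>2))) has_integral 2 * c * (scaled_mixture b - scaled_mixture a)) {a..b}"
    using ab by (intro has_integral_mult_right scaled_mixture_has_integral)
  have "2 * c * (scaled_mixture b - scaled_mixture a) \<le> integral {a..b} (gain_density l)"
  proof (rule has_integral_le[OF i integrable_integral[OF gain_density_integrable]])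
    fix x assume "x \<in> {a..b}"
    then have x: "a \<le> x" "x \<le> b" by auto
    have "mixture_slope x / sqrt (1 + x\<^sup>2) \<le> 0"
      using mixture_slope_nonpos[of x] ab x by (auto intro: divide_nonpos_pos sqrt_one_plus_square_pos)
    then have "2 * c * (mixture_slope x / sqrt (1 + x\<^sup>2)) \<le> 2 * gain_factor l x * (mixture_slope x / sqrt (1 + x\<^sup>2))"
      using c[OF x] by (intro mult_right_mono_neg) auto
    moreover have "0 \<le> x\<^sup>2 * (excess l x)\<^sup>2 * mixture x" using mixture_pos[of x] by simp
    ultimately show "2 * c * (mixture_slope x / sqrt (1 + x\<^sup>2)) \<le> gain_density l x"
      unfolding gain_density_eq by simp
  qed
  then show ?thesis by (simp add: algebra_simps)
qed

text \<open>The derivative may have either sign here. With \<open>mixture_slope x\<close> at least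
  \<open>- 15 / 100\<close> and the root at least \<open>2\<close>, the constant is
  \<open>3 / 80 = 2 * (15 / 100) / 2 * (1 / 4)\<close>, the last factor being the length of the
  cell.\<close>

lemma integral_gain_middle:
  assumes c: "\<And>x. 7 / 4 \<le> x \<Longrightarrow> x \<le> 2 \<Longrightarrow> 0 \<le> gain_factor l x \<and> gain_factor l x \<le> c"
  shows "- (3 / 80) * c \<le> integral {7 / 4..2} (gain_density l)"
proof -
  have i: "((\<lambda>x. - (3 / 20) * c) has_integral (2 - 7 / 4) *\<^sub>R (- (3 / 20) * c)) {7 / 4..2 :: real}"
    using has_integral_const_real[of "- (3 / 20) * c" "7 / 4" 2] by simp
  have "(2 - 7 / 4) *\<^sub>R (- (3 / 20) * c) \<le> integral {7 / 4..2} (gain_density l)"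
  proof (rule has_integral_le[OF i integrable_integral[OF gain_density_integrable]])
    fix x :: real assume "x \<in> {7 / 4..2}"
    then have x: "7 / 4 \<le> x" "x \<le> 2" by auto
    have "(7 / 4) * (7 / 4) \<le> x * x" using x by (intro mult_mono) auto
    then have s: "2 \<le> sqrt (1 + x\<^sup>2)" by (intro real_le_rsqrt) (simp add: power2_eq_square)
    have "- (3 / 40) * sqrt (1 + x\<^sup>2) \<le> mixture_slope x" using mixture_slope_mid[OF x] s by simp
    then have "- (3 / 40) \<le> mixture_slope x / sqrt (1 + x\<^sup>2)"
      using sqrt_one_plus_square_pos[of x] by (simp add: pos_le_divide_eq)
    then have "2 * gain_factor l x * - (3 / 40) \<le> 2 * gain_factor l x * (mixture_slope x / sqrt (1 + x\<^sup>2))"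
      using c[OF x] by (intro mult_left_mono) auto
    moreover have "0 \<le> x\<^sup>2 * (excess l x)\<^sup>2 * mixture x" using mixture_pos[of x] by simp
    ultimately show "- (3 / 20) * c \<le> gain_density l x"
      unfolding gain_density_eq using c[OF x] by simp
  qed
  then show ?thesis by simp
qed

section \<open>Monotonicity of \<open>gain_factor\<close> and \<open>excess\<close> in the threshold
  and on either side of it\<close>

lemma gain_factor_mono: "0 \<le> x \<Longrightarrow> l \<le> l' \<Longrightarrow> gain_factor l x \<le> gain_factor l' x"
  unfolding gain_factor_def by (intro divide_right_mono mult_left_mono excess_mono) auto

lemma gain_factor_nonneg: "0 \<le> x \<Longrightarrow> 0 \<le> l \<Longrightarrow> 0 \<le> gain_factor l x"
  using excess_nonneg by (simp add: gain_factor_def)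

lemma gain_factor_le_1: "0 \<le> x \<Longrightarrow> 0 \<le> l \<Longrightarrow> gain_factor l x \<le> 1"
proof -
  assume "0 \<le> x" "0 \<le> l"
  have "excess l x \<le> 1" using weight_le_1[of l x] weight_pos[of 0 x] by (simp add: excess_def)
  moreover have "x \<le> sqrt (1 + x\<^sup>2)" by (rule real_le_rsqrt) simp
  ultimately have "x * excess l x \<le> sqrt (1 + x\<^sup>2) * 1"
    using \<open>0 \<le> x\<close> \<open>0 \<le> l\<close> excess_nonneg by (intro mult_mono) auto
  then show ?thesis using sqrt_one_plus_square_pos[of x] by (simp add: gain_factor_def divide_le_eq)
qed

lemma gain_factor_square: "(gain_factor l x)\<^sup>2 = x\<^sup>2 * (excess l x)\<^sup>2 / (1 + x\<^sup>2)"
  using one_plus_square_pos[of x] by (simp add: gain_factor_def power_divide power_mult_distrib)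

lemma excess_inner_lower:
  assumes "0 \<le> a" "a \<le> x" "x\<^sup>2 \<le> l" shows "a\<^sup>2 / (1 + a\<^sup>2) \<le> excess l x"
proof -
  have "a\<^sup>2 \<le> x\<^sup>2" using assms by (intro power_mono)
  then show ?thesis unfolding excess_inner[OF assms(3)]
    using one_plus_square_pos[of a] one_plus_square_pos[of x] by (simp add: field_simps)
qed

text \<open>Squaring removes the root: below the threshold the square of \<open>gain_factor\<close>
  is \<open>(x^2 / (1 + x^2))^3\<close>, which increases with \<open>x\<close>, so a rational check
  at the left end suffices.\<close>

lemma gain_factor_inner_lower:
  assumes "0 \<le> a" "a \<le> x" "x\<^sup>2 \<le> l" and c: "c\<^sup>2 * (1 + a\<^sup>2) ^ 3 \<le> a ^ 6"
  shows "c \<le> gain_factor l x"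
proof -
  have ax: "a\<^sup>2 \<le> x\<^sup>2" using assms by (intro power_mono)
  have p: "0 < 1 + a\<^sup>2" "0 < 1 + x\<^sup>2" by (rule one_plus_square_pos)+
  have cube: "(y / A) ^ 3 = y * (y / A)\<^sup>2 / A" for y A :: real
    by (simp add: power2_eq_square power3_eq_cube)
  have "c\<^sup>2 \<le> a ^ 6 / (1 + a\<^sup>2) ^ 3" using c p by (simp add: pos_le_divide_eq)
  also have "\<dots> = (a\<^sup>2 / (1 + a\<^sup>2)) ^ 3" by (simp add: power_divide)
  also have "\<dots> \<le> (x\<^sup>2 / (1 + x\<^sup>2)) ^ 3" using ax p by (intro power_mono) (auto simp: field_simps)
  also have "\<dots> = (gain_factor l x)\<^sup>2"
    unfolding gain_factor_square excess_inner[OF assms(3)]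
    by (rule cube)
  finally have "c\<^sup>2 \<le> (gain_factor l x)\<^sup>2" .
  moreover have "0 \<le> l" using order_trans[OF zero_le_power2 assms(3)] .
  ultimately show ?thesis using assms by (intro power2_le_imp_le[of c] gain_factor_nonneg) auto
qed

lemma excess_outer_lower:
  assumes "0 \<le> l" "l \<le> x\<^sup>2" "0 \<le> x" "x \<le> b"
  shows "l / ((1 + b\<^sup>2) * (1 + b\<^sup>2 - l)) \<le> excess l x"
proof -
  have "x\<^sup>2 \<le> b\<^sup>2" using assms by (intro power_mono)
  moreover from this have "l < 1 + b\<^sup>2" using assms by linarith
  ultimately show ?thesis unfolding excess_outer[OF assms(2,1)]
    using assms one_plus_square_pos[of x] one_plus_square_pos[of b]
    by (intro divide_left_mono mult_mono mult_pos_pos) auto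
qed

lemma gain_factor_outer_square:
  assumes "0 \<le> l" "l \<le> x\<^sup>2"
  shows "(gain_factor l x)\<^sup>2 = l\<^sup>2 * (x\<^sup>2 / ((1 + x\<^sup>2) ^ 3 * (1 + x\<^sup>2 - l)\<^sup>2))"
proof -
  have "y * (l / (A * B))\<^sup>2 / A = l\<^sup>2 * (y / (A ^ 3 * B\<^sup>2))" for y A B :: real
    by (simp add: power2_eq_square power3_eq_cube mult_ac)
  then show ?thesis unfolding gain_factor_square excess_outer[OF assms(2,1)] .
qed

text \<open>With \<open>t = x^2\<close> this is the square of \<open>gain_factor\<close> beyond the
  threshold, divided by \<open>l^2\<close>. The factor \<open>t / (1 + t)^3\<close> peaks at
  \<open>t = 1 / 2\<close>, hence the lower bound on \<open>s\<close> and the bound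
  \<open>3 / 4\<close> on \<open>x\<close> in the lemmas that rely on it.\<close>

lemma outer_antimono:
  fixes s t l :: real
  assumes "1 / 2 \<le> s" "s \<le> t" "0 \<le> l" "l \<le> s"
  shows "t / ((1 + t) ^ 3 * (1 + t - l)\<^sup>2) \<le> s / ((1 + s) ^ 3 * (1 + s - l)\<^sup>2)"
proof -
  have "1 / 2 * (1 / 2) \<le> s * t" using assms by (intro mult_mono) auto
  then have "1 / 4 * 1 \<le> s * t * (s + t)"
    using assms by (intro mult_mono) auto
  moreover have "3 / 4 \<le> 3 * (s * t)" using \<open>1 / 2 * (1 / 2) \<le> s * t\<close> by simp
  ultimately have "0 \<le> 3 * (s * t) + s * t * (s + t) - 1" by simp
  then have "0 \<le> (t - s) * (3 * (s * t) + s * t * (s + t) - 1)"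
    using assms by (intro mult_nonneg_nonneg) auto
  also have "\<dots> = s * (1 + t) ^ 3 - t * (1 + s) ^ 3" by (simp add: algebra_simps power3_eq_cube)
  finally have "t / (1 + t) ^ 3 \<le> s / (1 + s) ^ 3" using assms by (simp add: field_simps)
  moreover have "1 / (1 + t - l)\<^sup>2 \<le> 1 / (1 + s - l)\<^sup>2"
    using assms by (intro divide_left_mono power_mono mult_pos_pos zero_less_power) auto
  ultimately have "t / (1 + t) ^ 3 * (1 / (1 + t - l)\<^sup>2) \<le> s / (1 + s) ^ 3 * (1 / (1 + s - l)\<^sup>2)"
    using assms by (intro mult_mono) auto
  then show ?thesis by simp
qed

lemma half_le_square: "3 / 4 \<le> a \<Longrightarrow> 1 / 2 \<le> a\<^sup>2" for a :: real
  using power_mono[of "3 / 4" a 2] by (simp add: power2_eq_square)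

lemma gain_factor_outer_lower:
  assumes "0 \<le> l" "l \<le> x\<^sup>2" "3 / 4 \<le> x" "x \<le> b"
    and c: "c\<^sup>2 * ((1 + b\<^sup>2) ^ 3 * (1 + b\<^sup>2 - l)\<^sup>2) \<le> l\<^sup>2 * b\<^sup>2"
  shows "c \<le> gain_factor l x"
proof -
  have xb: "x\<^sup>2 \<le> b\<^sup>2" using assms by (intro power_mono) auto
  then have "l < 1 + b\<^sup>2" using assms by linarith
  then have "0 < (1 + b\<^sup>2) ^ 3 * (1 + b\<^sup>2 - l)\<^sup>2"
    using assms one_plus_square_pos[of b] by (intro mult_pos_pos zero_less_power) auto
  then have "c\<^sup>2 \<le> l\<^sup>2 * (b\<^sup>2 / ((1 + b\<^sup>2) ^ 3 * (1 + b\<^sup>2 - l)\<^sup>2))" using c by (simp add: pos_le_divide_eq)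
  also have "\<dots> \<le> (gain_factor l x)\<^sup>2"
    unfolding gain_factor_outer_square[OF assms(1,2)]
    using xb assms(1,2) half_le_square[OF assms(3)] by (intro mult_left_mono outer_antimono) auto
  finally show ?thesis
    using assms(1,3) gain_factor_nonneg[of x l] by (auto intro: power2_le_imp_le)
qed

lemma gain_factor_upper:
  assumes "0 \<le> l" "l \<le> a\<^sup>2" "3 / 4 \<le> a" "a \<le> x"
    and c: "0 \<le> c" "l\<^sup>2 * a\<^sup>2 \<le> c\<^sup>2 * ((1 + a\<^sup>2) ^ 3 * (1 + a\<^sup>2 - l)\<^sup>2)"
  shows "gain_factor l x \<le> c"
proof -
  have ax: "a\<^sup>2 \<le> x\<^sup>2" using assms by (intro power_mono) auto
  have "0 < (1 + a\<^sup>2) ^ 3 * (1 + a\<^sup>2 - l)\<^sup>2"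
    using assms one_plus_square_pos[of a] by (intro mult_pos_pos zero_less_power) auto
  then have "l\<^sup>2 * (a\<^sup>2 / ((1 + a\<^sup>2) ^ 3 * (1 + a\<^sup>2 - l)\<^sup>2)) \<le> c\<^sup>2" using c by (simp add: pos_divide_le_eq)
  moreover have "(gain_factor l x)\<^sup>2 \<le> l\<^sup>2 * (a\<^sup>2 / ((1 + a\<^sup>2) ^ 3 * (1 + a\<^sup>2 - l)\<^sup>2))"
    unfolding gain_factor_outer_square[OF assms(1) order_trans[OF assms(2) ax]]
    using ax assms(1,2) half_le_square[OF assms(3)] by (intro mult_left_mono outer_antimono) auto
  ultimately have "(gain_factor l x)\<^sup>2 \<le> c\<^sup>2" by (rule order_trans[rotated])
  then show ?thesis using c(1) by (rule power2_le_imp_le)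
qed

section \<open>The grid certificate\<close>

lemma scaled_mixture_interval:
  assumes p: "exp (- (p / 32)) \<in> {a..b}" and q: "exp (- (q / 32)) \<in> {c..d}" and r: "exp (- (r / 32)) \<in> {e..f}"
    and pqr: "p = 16 * x\<^sup>2" "q = 16 * (x - 2)\<^sup>2" "r = 16 * (x + 2)\<^sup>2"
    and s: "0 \<le> s" "s\<^sup>2 \<le> 1 + x\<^sup>2" "0 \<le> t" "1 + x\<^sup>2 \<le> t\<^sup>2"
    and "0 \<le> a" "0 \<le> c" "0 \<le> e" "l \<le> s * (a + (c + e) / 2)" "t * (b + (d + f) / 2) \<le> u"
  shows "scaled_mixture x \<in> {l..u}"
proof -
  have x: "x\<^sup>2 / 2 = p / 32" "(x - 2)\<^sup>2 / 2 = q / 32" "(x + 2)\<^sup>2 / 2 = r / 32" using pqr by simp_all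
  have "s \<le> sqrt (1 + x\<^sup>2)" "sqrt (1 + x\<^sup>2) \<le> t" using s by (auto intro: real_le_rsqrt real_le_lsqrt)
  moreover have "a + (c + e) / 2 \<le> mixture x" "mixture x \<le> b + (d + f) / 2"
    unfolding mixture_def x using p q r by (auto intro!: add_mono divide_right_mono)
  ultimately have "s * (a + (c + e) / 2) \<le> scaled_mixture x" "scaled_mixture x \<le> t * (b + (d + f) / 2)"
    unfolding scaled_mixture_def using assms mixture_pos[of x] by (auto intro!: mult_mono)
  then show ?thesis using assms by auto
qed

lemma exp_zero_interval: "exp (- (0 / 32)) \<in> {1..1 :: real}"
  by simp

abbreviation (input) scaled_mixture_enclosed :: "real \<Rightarrow> real \<Rightarrow> real \<Rightarrow> bool" where
  "scaled_mixture_enclosed n a b \<equiv> scaled_mixture (n / 4) \<in> {a / 10 ^ 6..b / 10 ^ 6}"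

lemma scaled_mixture_table:
  shows "scaled_mixture_enclosed 2 1192706 1192713"
    and "scaled_mixture_enclosed 3 1243938 1243945"
    and "scaled_mixture_enclosed 4 1294498 1294505"
    and "scaled_mixture_enclosed 5 1341125 1341132"
    and "scaled_mixture_enclosed 6 1382716 1382723"
    and "scaled_mixture_enclosed 7 1413560 1413567"
    and "scaled_mixture_enclosed 8 1421024 1421031"
    and "scaled_mixture_enclosed 9 1389266 1389273"
    and "scaled_mixture_enclosed 10 1306452 1306459"
    and "scaled_mixture_enclosed 11 1171111 1171118"
    and "scaled_mixture_enclosed 12 994141 994148"
    and "scaled_mixture_enclosed 13 795694 795701"
    and "scaled_mixture_enclosed 14 598836 598843"
    and "scaled_mixture_enclosed 15 423094 423101"
    and "scaled_mixture_enclosed 16 280381 280388"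
proof -
  show "scaled_mixture_enclosed 2 1192706 1192713"
    by (rule scaled_mixture_interval[OF exp_quarter_squares(2) exp_quarter_squares(6) exp_quarter_squares(10), where s = "1118033 / 10 ^ 6" and t = "1118034 / 10 ^ 6"])
      (simp_all add: power2_eq_square)
  show "scaled_mixture_enclosed 3 1243938 1243945"
    by (rule scaled_mixture_interval[OF exp_quarter_squares(3) exp_quarter_squares(5) exp_quarter_squares(11), where s = "1250000 / 10 ^ 6" and t = "1250001 / 10 ^ 6"])
      (simp_all add: power2_eq_square)
  show "scaled_mixture_enclosed 4 1294498 1294505"
    by (rule scaled_mixture_interval[OF exp_quarter_squares(4) exp_quarter_squares(4) exp_quarter_squares(12), where s = "1414213 / 10 ^ 6" and t = "1414214 / 10 ^ 6"])
      (simp_all add: power2_eq_square)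
  show "scaled_mixture_enclosed 5 1341125 1341132"
    by (rule scaled_mixture_interval[OF exp_quarter_squares(5) exp_quarter_squares(3) exp_quarter_squares(13), where s = "1600781 / 10 ^ 6" and t = "1600782 / 10 ^ 6"])
      (simp_all add: power2_eq_square)
  show "scaled_mixture_enclosed 6 1382716 1382723"
    by (rule scaled_mixture_interval[OF exp_quarter_squares(6) exp_quarter_squares(2) exp_quarter_squares(14), where s = "1802775 / 10 ^ 6" and t = "1802776 / 10 ^ 6"])
      (simp_all add: power2_eq_square)
  show "scaled_mixture_enclosed 7 1413560 1413567"
    by (rule scaled_mixture_interval[OF exp_quarter_squares(7) exp_quarter_squares(1) exp_quarter_squares(15), where s = "2015564 / 10 ^ 6" and t = "2015565 / 10 ^ 6"])
      (simp_all add: power2_eq_square)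
  show "scaled_mixture_enclosed 8 1421024 1421031"
    by (rule scaled_mixture_interval[OF exp_quarter_squares(8) exp_zero_interval exp_quarter_squares(16), where s = "2236067 / 10 ^ 6" and t = "2236068 / 10 ^ 6"])
      (simp_all add: power2_eq_square)
  show "scaled_mixture_enclosed 9 1389266 1389273"
    by (rule scaled_mixture_interval[OF exp_quarter_squares(9) exp_quarter_squares(1) exp_quarter_squares(17), where s = "2462214 / 10 ^ 6" and t = "2462215 / 10 ^ 6"])
      (simp_all add: power2_eq_square)
  show "scaled_mixture_enclosed 10 1306452 1306459"
    by (rule scaled_mixture_interval[OF exp_quarter_squares(10) exp_quarter_squares(2) exp_quarter_squares(18), where s = "2692582 / 10 ^ 6" and t = "2692583 / 10 ^ 6"])
      (simp_all add: power2_eq_square)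
  show "scaled_mixture_enclosed 11 1171111 1171118"
    by (rule scaled_mixture_interval[OF exp_quarter_squares(11) exp_quarter_squares(3) exp_quarter_squares(19), where s = "2926174 / 10 ^ 6" and t = "2926175 / 10 ^ 6"])
      (simp_all add: power2_eq_square)
  show "scaled_mixture_enclosed 12 994141 994148"
    by (rule scaled_mixture_interval[OF exp_quarter_squares(12) exp_quarter_squares(4) exp_quarter_squares(20), where s = "3162277 / 10 ^ 6" and t = "3162278 / 10 ^ 6"])
      (simp_all add: power2_eq_square)
  show "scaled_mixture_enclosed 13 795694 795701"
    by (rule scaled_mixture_interval[OF exp_quarter_squares(13) exp_quarter_squares(5) exp_quarter_squares(21), where s = "3400367 / 10 ^ 6" and t = "3400368 / 10 ^ 6"])
      (simp_all add: power2_eq_square)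
  show "scaled_mixture_enclosed 14 598836 598843"
    by (rule scaled_mixture_interval[OF exp_quarter_squares(14) exp_quarter_squares(6) exp_quarter_squares(22), where s = "3640054 / 10 ^ 6" and t = "3640055 / 10 ^ 6"])
      (simp_all add: power2_eq_square)
  show "scaled_mixture_enclosed 15 423094 423101"
    by (rule scaled_mixture_interval[OF exp_quarter_squares(15) exp_quarter_squares(7) exp_quarter_squares(23), where s = "3881043 / 10 ^ 6" and t = "3881044 / 10 ^ 6"])
      (simp_all add: power2_eq_square)
  show "scaled_mixture_enclosed 16 280381 280388"
    by (rule scaled_mixture_interval[OF exp_quarter_squares(16) exp_quarter_squares(8) exp_quarter_squares(24), where s = "4123105 / 10 ^ 6" and t = "4123106 / 10 ^ 6"])
      (simp_all add: power2_eq_square)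
qed

lemma integral_quarters:
  assumes "\<And>i. i < n \<Longrightarrow> I i \<le> integral {real i / 4..real (Suc i) / 4} (gain_density l)"
  shows "(\<Sum>i<n. I i) \<le> integral {0..real n / 4} (gain_density l)"
  using assms
proof (induction n)
  case (Suc n)
  have "integral {0..real n / 4} (gain_density l) + integral {real n / 4..real (Suc n) / 4} (gain_density l)
      = integral {0..real (Suc n) / 4} (gain_density l)"
    by (rule Henstock_Kurzweil_Integration.integral_combine) (auto intro: gain_density_integrable simp: field_simps)
  moreover have "(\<Sum>i<n. I i) + I n \<le> integral {0..real n / 4} (gain_density l) + integral {real n / 4..real (Suc n) / 4} (gain_density l)"
    using Suc.IH Suc.prems by (intro add_mono) auto
  ultimately show ?case by simp
qed simp

lemma gain_density_nonneg: "0 \<le> x \<Longrightarrow> x \<le> 7 / 4 \<Longrightarrow> 0 \<le> l \<Longrightarrow> 0 \<le> gain_density l x"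
  using mixture_slope_nonneg[of x] mixture_pos[of x] excess_nonneg[of l x] one_plus_square_pos[of x]
  by (cases "x = 0") (auto simp: gain_density_def)

text \<open>
  On the grid of mesh \<open>1/4\<close>, \<open>c i\<close> bounds \<open>gain_factor\<close> from below where \<open>scaled_mixture\<close> increases and
  from above where it decreases, so that each cell contributes a difference of two values of
  \<open>scaled_mixture\<close>. The cell \<open>[7/4, 2]\<close> contains the maximum and is estimated directly.
\<close>

definition certificate :: "(nat \<Rightarrow> real) \<Rightarrow> (nat \<Rightarrow> real) \<Rightarrow> (nat \<Rightarrow> real) \<Rightarrow> real" where
  "certificate c q k = (\<Sum>i = 2..6. 2 * c i * (scaled_mixture (real (Suc i) / 4) - scaled_mixture (real i / 4)) + (real i / 4)\<^sup>2 * (q i)\<^sup>2 * k i / 4)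
      - 3 / 80 * c 7 - (\<Sum>i = 8..15. 2 * c i * (scaled_mixture (real i / 4) - scaled_mixture (real (Suc i) / 4))) - 2 * c 16 * scaled_mixture 4"

text \<open>Cells below \<open>1 / 2\<close> contribute a nonnegative amount and are dropped. The
  bound \<open>c 16\<close> holds on all of \<open>[4, B]\<close>, and the term at \<open>B\<close>
  has a favourable sign, so the result is uniform in \<open>B\<close>.\<close>

lemma quarters_certificate:
  fixes c q k :: "nat \<Rightarrow> real"
  assumes l: "0 \<le> l"
    and inc: "\<And>i x. i \<in> {2..6} \<Longrightarrow> real i / 4 \<le> x \<Longrightarrow> x \<le> real (Suc i) / 4 \<Longrightarrow> c i \<le> gain_factor l x \<and> q i \<le> excess l x"
    and cq: "\<And>i. i \<in> {2..6} \<Longrightarrow> 0 \<le> c i \<and> 0 \<le> q i"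
    and k: "\<And>i. i \<in> {2..6} \<Longrightarrow> 0 \<le> k i \<and> k i * sqrt (1 + (real (Suc i) / 4)\<^sup>2) \<le> scaled_mixture (real i / 4)"
    and dec: "\<And>i x. i \<in> {7..16} \<Longrightarrow> real i / 4 \<le> x \<Longrightarrow> gain_factor l x \<le> c i"
    and B: "4 \<le> B"
  shows "certificate c q k \<le> integral {0..B} (gain_density l)"
proof -
  define I where "I i = (if i < 2 then 0 else if i \<le> 6 then
      2 * c i * (scaled_mixture (real (Suc i) / 4) - scaled_mixture (real i / 4)) + (real i / 4)\<^sup>2 * (q i)\<^sup>2 * k i / 4
    else if i = 7 then - (3 / 80) * c 7 else - 2 * c i * (scaled_mixture (real i / 4) - scaled_mixture (real (Suc i) / 4)))" for i :: nat
  have "(\<Sum>i<16. I i) \<le> integral {0..real 16 / 4} (gain_density l)"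
  proof (rule integral_quarters)
    fix i :: nat assume i: "i < 16"
    consider "i < 2" | "i \<in> {2..6}" | "i = 7" | "i \<in> {8..15}" using i by fastforce
    then show "I i \<le> integral {real i / 4..real (Suc i) / 4} (gain_density l)"
    proof cases
      case 1
      then have "real (Suc i) \<le> 2" by simp
      then show ?thesis using l 1
        by (auto simp: I_def intro!: integral_nonneg gain_density_integrable gain_density_nonneg)
    next
      case 2
      then have i': "2 \<le> real i" "real i \<le> 6" by auto
      have quarter: "real (Suc i) / 4 - real i / 4 = 1 / 4" by (simp add: field_simps)
      have "2 * c i * (scaled_mixture (real (Suc i) / 4) - scaled_mixture (real i / 4))
          + (real i / 4)\<^sup>2 * (q i)\<^sup>2 * k i * (real (Suc i) / 4 - real i / 4)
          \<le> integral {real i / 4..real (Suc i) / 4} (gain_density l)"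
        using inc[OF 2] cq[OF 2] k[OF 2] i' by (intro integral_gain_increasing) auto
      then have "2 * c i * (scaled_mixture (real (Suc i) / 4) - scaled_mixture (real i / 4))
          + (real i / 4)\<^sup>2 * (q i)\<^sup>2 * k i * (1 / 4) \<le> integral {real i / 4..real (Suc i) / 4} (gain_density l)"
        unfolding quarter .
      then show ?thesis using i' by (simp add: I_def)
    next
      case 3
      have "- (3 / 80) * c 7 \<le> integral {7 / 4..2} (gain_density l)"
        using dec[of 7] l by (intro integral_gain_middle) (auto intro: gain_factor_nonneg)
      then show ?thesis using 3 by (simp add: I_def)
    next
      case 4
      then have "8 \<le> real i" by auto
      then have "- 2 * c i * (scaled_mixture (real i / 4) - scaled_mixture (real (Suc i) / 4))
          \<le> integral {real i / 4..real (Suc i) / 4} (gain_density l)"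
        using dec[of i] 4 by (intro integral_gain_decreasing) auto
      then show ?thesis using 4 by (simp add: I_def)
    qed
  qed
  moreover have "- 2 * c 16 * (scaled_mixture 4 - scaled_mixture B) \<le> integral {4..B} (gain_density l)"
    using dec[of 16] B by (intro integral_gain_decreasing) auto
  moreover have "integral {0..4} (gain_density l) + integral {4..B} (gain_density l) = integral {0..B} (gain_density l)"
    using B by (intro Henstock_Kurzweil_Integration.integral_combine gain_density_integrable) auto
  moreover have "0 \<le> c 16 * scaled_mixture B"
    using dec[of 16 4] gain_factor_nonneg[of 4 l] l scaled_mixture_pos[of B] by (intro mult_nonneg_nonneg) auto
  moreover have "(\<Sum>i<16. I i) = (\<Sum>i = 2..6. I i) + I 7 + (\<Sum>i = 8..15. I i)"
  proof -
    have "{..<16} = {0, 1} \<union> {2..6} \<union> {7} \<union> {8..15 :: nat}" by auto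
    then have "(\<Sum>i<16. I i) = (\<Sum>i\<in>{0, 1}. I i) + (\<Sum>i = 2..6. I i) + I 7 + (\<Sum>i = 8..15. I i)"
      by (simp add: sum.union_disjoint)
    then show ?thesis by (simp add: I_def)
  qed
  moreover have "(\<Sum>i = 2..6. I i) = (\<Sum>i = 2..6. 2 * c i * (scaled_mixture (real (Suc i) / 4) - scaled_mixture (real i / 4)) + (real i / 4)\<^sup>2 * (q i)\<^sup>2 * k i / 4)"
    by (rule sum.cong) (auto simp: I_def)
  moreover have "(\<Sum>i = 8..15. I i) = - (\<Sum>i = 8..15. 2 * c i * (scaled_mixture (real i / 4) - scaled_mixture (real (Suc i) / 4)))"
    unfolding sum_negf[symmetric] by (rule sum.cong) (auto simp: I_def)
  ultimately show ?thesis by (simp add: certificate_def I_def algebra_simps)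
qed

section \<open>Cellwise bounds and the numerical verification of the certificate\<close>

lemma atLeastAtMost_cases:
  "i \<in> {2..16} \<longleftrightarrow> i = 2 \<or> i = 3 \<or> i = 4 \<or> i = 5 \<or> i = 6 \<or> i = 7 \<or> i = 8 \<or> i = 9 \<or> i = 10
    \<or> i = 11 \<or> i = 12 \<or> i = 13 \<or> i = 14 \<or> i = 15 \<or> i = (16 :: nat)"
  "i \<in> {2..6} \<longleftrightarrow> i = 2 \<or> i = 3 \<or> i = 4 \<or> i = 5 \<or> i = (6 :: nat)"
  "i \<in> {7..16} \<longleftrightarrow> i = 7 \<or> i = 8 \<or> i = 9 \<or> i = 10 \<or> i = 11 \<or> i = 12 \<or> i = 13 \<or> i = 14 \<or> i = 15 \<or> i = (16 :: nat)"
  unfolding atLeastAtMost_iff by presburger+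

lemma sum_numerals:
  "(\<Sum>i = 2..6. f i) = f 2 + f 3 + f 4 + f 5 + f (6 :: nat)"
  "(\<Sum>i = 8..15. f i) = f 8 + f 9 + f 10 + f 11 + f 12 + f 13 + f 14 + f (15 :: nat)"
  for f :: "nat \<Rightarrow> real"
proof -
  have "{2..6} = {2, 3, 4, 5, 6 :: nat}" "{8..15} = {8, 9, 10, 11, 12, 13, 14, 15 :: nat}" by auto
  then show "(\<Sum>i = 2..6. f i) = f 2 + f 3 + f 4 + f 5 + f 6"
    "(\<Sum>i = 8..15. f i) = f 8 + f 9 + f 10 + f 11 + f 12 + f 13 + f 14 + f 15" by simp_all
qed

text \<open>Entry \<open>i\<close> is
  \<open>scaled_mixture (i / 4) / sqrt (1 + ((i + 1) / 4)^2)\<close> rounded down, a lower bound of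
  \<open>mixture\<close> on the cell. The first two entries are placeholders.\<close>

definition mixture_lower :: "nat \<Rightarrow> real" where
  "mixture_lower = (!) [0, 0, 9541 / 10 ^ 4, 8795 / 10 ^ 4, 8086 / 10 ^ 4, 7439 / 10 ^ 4, 6859 / 10 ^ 4]"

lemma mixture_lower:
  assumes "i \<in> {2..6}"
  shows "0 \<le> mixture_lower i \<and> mixture_lower i * sqrt (1 + (real (Suc i) / 4)\<^sup>2) \<le> scaled_mixture (real i / 4)"
proof -
  have *: "k * sqrt y \<le> scaled_mixture x" if "scaled_mixture x \<in> {l..u}" "0 \<le> k" "0 \<le> t" "y \<le> t\<^sup>2" "k * t \<le> l" for k t y x l u
  proof -
    have "k * sqrt y \<le> k * t" using that by (intro mult_left_mono real_le_lsqrt) auto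
    then show ?thesis using that by simp
  qed
  have 2: "9541 / 10 ^ 4 * sqrt (1 + (3 / 4)\<^sup>2) \<le> scaled_mixture (2 / 4)"
    by (rule *[OF scaled_mixture_table(1), where t = "125001 / 10 ^ 5"]) (simp_all add: power2_eq_square)
  have 3: "8795 / 10 ^ 4 * sqrt (1 + (4 / 4)\<^sup>2) \<le> scaled_mixture (3 / 4)"
    by (rule *[OF scaled_mixture_table(2), where t = "141422 / 10 ^ 5"]) (simp_all add: power2_eq_square)
  have 4: "8086 / 10 ^ 4 * sqrt (1 + (5 / 4)\<^sup>2) \<le> scaled_mixture (4 / 4)"
    by (rule *[OF scaled_mixture_table(3), where t = "160079 / 10 ^ 5"]) (simp_all add: power2_eq_square)
  have 5: "7439 / 10 ^ 4 * sqrt (1 + (6 / 4)\<^sup>2) \<le> scaled_mixture (5 / 4)"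
    by (rule *[OF scaled_mixture_table(4), where t = "180278 / 10 ^ 5"]) (simp_all add: power2_eq_square)
  have 6: "6859 / 10 ^ 4 * sqrt (1 + (7 / 4)\<^sup>2) \<le> scaled_mixture (6 / 4)"
    by (rule *[OF scaled_mixture_table(5), where t = "201557 / 10 ^ 5"]) (simp_all add: power2_eq_square)
  show ?thesis
    using assms 2 3 4 5 6 unfolding atLeastAtMost_cases mixture_lower_def by (elim disjE) simp_all
qed

text \<open>For small \<open>l\<close> the gain is of order \<open>l\<close>, so the bounds must be
  proportional to \<open>l\<close>. Beyond the threshold \<open>gain_factor l x / l\<close> is at
  least its limit \<open>x / (1 + x^2)^(5/2)\<close> as \<open>l\<close> tends to 0. The first
  alternative of \<open>outer\<close> bounds numerator and denominator separately; it serves the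
  cell starting at \<open>1 / 2\<close>, to the left of the range of the monotonicity lemma.\<close>

lemma gain_factor_scaled_lower:
  assumes l: "0 < l" "l \<le> 1" and a: "1 / 2 \<le> a" "a \<le> x" "x \<le> b" and c: "0 \<le> c"
    and inner: "a \<le> 1 \<Longrightarrow> c\<^sup>2 * (1 + a\<^sup>2) ^ 3 \<le> a ^ 6"
    and outer: "c\<^sup>2 * (1 + b\<^sup>2) ^ 5 \<le> a\<^sup>2 \<or> 3 / 4 \<le> a \<and> c\<^sup>2 * (1 + b\<^sup>2) ^ 5 \<le> b\<^sup>2"
  shows "l * c \<le> gain_factor l x"
proof (cases "x\<^sup>2 \<le> l")
  case True
  have "l * c \<le> 1 * c" using l c by (intro mult_right_mono) auto
  moreover have "a\<^sup>2 \<le> x\<^sup>2" using a by (intro power_mono) auto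
  moreover have "c \<le> gain_factor l x"
  proof -
    have "a \<le> 1" using True a l power2_le_imp_le[of a 1] \<open>a\<^sup>2 \<le> x\<^sup>2\<close> by simp
    then show ?thesis using inner a True by (intro gain_factor_inner_lower[of a]) auto
  qed
  ultimately show ?thesis by simp
next
  case False
  have x: "0 \<le> x" using a by simp
  have p5: "y ^ 3 * y\<^sup>2 = y ^ 5" for y :: real by (simp add: numeral_eq_Suc)
  have "c\<^sup>2 \<le> x\<^sup>2 / (1 + x\<^sup>2) ^ 5"
    using outer
  proof
    assume c: "c\<^sup>2 * (1 + b\<^sup>2) ^ 5 \<le> a\<^sup>2"
    have "c\<^sup>2 * (1 + x\<^sup>2) ^ 5 \<le> c\<^sup>2 * (1 + b\<^sup>2) ^ 5"
      using a by (intro mult_left_mono power_mono add_left_mono) auto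
    also have "\<dots> \<le> a\<^sup>2" by fact
    also have "\<dots> \<le> x\<^sup>2" using a by (intro power_mono) auto
    finally show ?thesis using one_plus_square_pos[of x] by (simp add: pos_le_divide_eq)
  next
    assume c: "3 / 4 \<le> a \<and> c\<^sup>2 * (1 + b\<^sup>2) ^ 5 \<le> b\<^sup>2"
    have "c\<^sup>2 \<le> b\<^sup>2 / (1 + b\<^sup>2) ^ 5" using c one_plus_square_pos[of b] by (simp add: pos_le_divide_eq)
    also have "\<dots> \<le> x\<^sup>2 / (1 + x\<^sup>2) ^ 5"
      using outer_antimono[of "x\<^sup>2" "b\<^sup>2" 0] half_le_square[of x] a c power_mono[of x b 2] x
      by (simp add: p5)
    finally show ?thesis .
  qed
  also have "\<dots> = x\<^sup>2 / ((1 + x\<^sup>2) ^ 3 * (1 + x\<^sup>2)\<^sup>2)" by (simp add: p5)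
  also have "\<dots> \<le> x\<^sup>2 / ((1 + x\<^sup>2) ^ 3 * (1 + x\<^sup>2 - l)\<^sup>2)"
    using False l one_plus_square_pos[of x] by (intro divide_left_mono mult_left_mono power_mono mult_pos_pos) auto
  finally have "l\<^sup>2 * c\<^sup>2 \<le> l\<^sup>2 * (x\<^sup>2 / ((1 + x\<^sup>2) ^ 3 * (1 + x\<^sup>2 - l)\<^sup>2))" by (intro mult_left_mono) auto
  also have "\<dots> = (gain_factor l x)\<^sup>2" using False l by (intro gain_factor_outer_square[symmetric]) auto
  finally have "(l * c)\<^sup>2 \<le> (gain_factor l x)\<^sup>2" by (simp add: power_mult_distrib)
  then show ?thesis using gain_factor_nonneg[OF x, of l] l by (auto intro: power2_le_imp_le)
qed

lemma gain_factor_scaled_upper: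
  assumes l: "0 < l" "l \<le> 1" and a: "1 \<le> a" "a \<le> x" and c: "0 \<le> c" "1 \<le> c\<^sup>2 * (1 + a\<^sup>2) ^ 3 * a\<^sup>2"
  shows "gain_factor l x \<le> l * c"
proof (rule gain_factor_upper[of l a])
  have a2: "1 \<le> a\<^sup>2" using a by simp
  then show "l \<le> a\<^sup>2" using l by simp
  have "a\<^sup>2 * 1 \<le> a\<^sup>2 * (c\<^sup>2 * (1 + a\<^sup>2) ^ 3 * a\<^sup>2)" using c by (intro mult_left_mono) auto
  also have "\<dots> = c\<^sup>2 * (1 + a\<^sup>2) ^ 3 * (a\<^sup>2)\<^sup>2" by (simp add: power2_eq_square)
  also have "\<dots> \<le> c\<^sup>2 * (1 + a\<^sup>2) ^ 3 * (1 + a\<^sup>2 - l)\<^sup>2"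
    using l a2 by (intro mult_left_mono power_mono) auto
  finally have "l\<^sup>2 * a\<^sup>2 \<le> l\<^sup>2 * (c\<^sup>2 * (1 + a\<^sup>2) ^ 3 * (1 + a\<^sup>2 - l)\<^sup>2)" by (intro mult_left_mono) auto
  then show "l\<^sup>2 * a\<^sup>2 \<le> (l * c)\<^sup>2 * ((1 + a\<^sup>2) ^ 3 * (1 + a\<^sup>2 - l)\<^sup>2)"
    by (simp add: power_mult_distrib mult.assoc)
qed (use assms in auto)

lemmas scaled_mixture_table_lower = scaled_mixture_table[unfolded atLeastAtMost_iff, THEN conjunct1]
lemmas scaled_mixture_table_upper = scaled_mixture_table[unfolded atLeastAtMost_iff, THEN conjunct2]

lemma gain_integral_01:
  assumes l: "0 < l" "l \<le> 1" and B: "4 \<le> B"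
  shows "l / 1000 \<le> integral {0..B} (gain_density l)"
proof -
  \<comment> \<open>Entries 2 to 6 are lower bounds rounded down, entries 7 to 16 upper bounds
    rounded up, all per unit of \<open>l\<close>; the first two are placeholders.\<close>
  define C :: "nat \<Rightarrow> real" where "C = (!) [0, 0, 8944 / 10 ^ 5, 17677 / 10 ^ 5, 11891 / 10 ^ 5, 7877 / 10 ^ 5, 5260 / 10 ^ 5,
    6979 / 10 ^ 5, 4473 / 10 ^ 5, 2978 / 10 ^ 5, 2050 / 10 ^ 5, 1452 / 10 ^ 5, 1055 / 10 ^ 5, 783 / 10 ^ 5, 593 / 10 ^ 5, 457 / 10 ^ 5, 357 / 10 ^ 5]"
  have inc: "l * C i \<le> gain_factor l x"
    if "i \<in> {2..6}" "real i / 4 \<le> x" "x \<le> real (Suc i) / 4" for i x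
    using that unfolding atLeastAtMost_cases
    by (elim disjE; intro gain_factor_scaled_lower[OF l, of "real i / 4" x "real (Suc i) / 4"])
       (simp_all add: C_def power2_eq_square power_divide)
  have dec: "gain_factor l x \<le> l * C i" if "i \<in> {7..16}" "real i / 4 \<le> x" for i x
    using that unfolding atLeastAtMost_cases
    by (elim disjE; intro gain_factor_scaled_upper[OF l, of "real i / 4" x])
       (simp_all add: C_def power2_eq_square power_divide)
  \<comment> \<open>The square terms, of second order in \<open>l\<close>, are estimated by zero,
    which makes the certificate linear in \<open>l\<close>.\<close>
  have "certificate (\<lambda>i. l * C i) (\<lambda>_. 0) mixture_lower \<le> integral {0..B} (gain_density l)"
  proof (rule quarters_certificate[OF _ _ _ mixture_lower dec B])
    show "l * C i \<le> gain_factor l x \<and> 0 \<le> excess l x"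
      if "i \<in> {2..6}" "real i / 4 \<le> x" "x \<le> real (Suc i) / 4" for i x
      using inc[OF that] excess_nonneg l by simp
    show "0 \<le> l * C i \<and> (0 :: real) \<le> 0" if "i \<in> {2..6}" for i
      using that l unfolding atLeastAtMost_cases by (elim disjE) (simp_all add: C_def)
  qed (use l in auto)
  moreover have "certificate (\<lambda>i. l * C i) (\<lambda>_. 0) mixture_lower = l * certificate C (\<lambda>_. 0) mixture_lower"
    by (simp add: certificate_def sum_distrib_left algebra_simps)
  \<comment> \<open>After summation by parts the coefficient of a value of
    \<open>scaled_mixture\<close> is a difference of successive bounds, and its sign decides between
    the upper and the lower table. Item \<open>j\<close> of the tables belongs to the point
    \<open>(j + 1) / 4\<close>.\<close>
  moreover have "1 / 1000 \<le> certificate C (\<lambda>_. 0) mixture_lower"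
    using scaled_mixture_table_upper(1,2,7) scaled_mixture_table_lower(3-6,8-15)
    unfolding certificate_def sum_numerals by (simp add: C_def field_simps)
  then have "l * (1 / 1000) \<le> l * certificate C (\<lambda>_. 0) mixture_lower"
    using l by (intro mult_left_mono) auto
  ultimately show ?thesis by simp
qed

text \<open>Both quantities increase with the threshold, so \<open>l1\<close> is the worst case. As
  functions of \<open>x\<close> they rise up to \<open>x^2 = l1\<close> and fall afterwards, so
  their minimum over a cell sits at an end: \<open>inner\<close> checks \<open>a\<close>,
  \<open>outer\<close> checks \<open>b\<close>.\<close>

lemma gain_factor_excess_lower:
  assumes l: "l1 \<le> l" and a: "1 / 2 \<le> a" "a \<le> x" "x \<le> b" "a < b" and l1: "1 \<le> l1" and cq: "0 \<le> c"
    and inner: "a\<^sup>2 < l1 \<Longrightarrow> c\<^sup>2 * (1 + a\<^sup>2) ^ 3 \<le> a ^ 6 \<and> q * (1 + a\<^sup>2) \<le> a\<^sup>2"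
    and outer: "l1 < b\<^sup>2 \<Longrightarrow> c\<^sup>2 * ((1 + b\<^sup>2) ^ 3 * (1 + b\<^sup>2 - l1)\<^sup>2) \<le> l1\<^sup>2 * b\<^sup>2
      \<and> q * ((1 + b\<^sup>2) * (1 + b\<^sup>2 - l1)) \<le> l1"
  shows "c \<le> gain_factor l x \<and> q \<le> excess l x"
proof -
  have x: "0 \<le> x" and ax: "a\<^sup>2 \<le> x\<^sup>2" and xb: "x\<^sup>2 \<le> b\<^sup>2" using a by (auto intro: power_mono)
  have "c \<le> gain_factor l1 x \<and> q \<le> excess l1 x"
  proof (cases "a\<^sup>2 < l1 \<and> x\<^sup>2 \<le> l1")
    case True
    then have "q \<le> a\<^sup>2 / (1 + a\<^sup>2)" using inner one_plus_square_pos[of a] by (simp add: pos_le_divide_eq)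
    also have "\<dots> \<le> excess l1 x" using True a by (intro excess_inner_lower) auto
    finally show ?thesis using gain_factor_inner_lower[of a x l1 c] inner True a by auto
  next
    case False
    then have lx: "l1 \<le> x\<^sup>2" using ax by auto
    show ?thesis
    proof (cases "l1 < b\<^sup>2")
      case True
      have "0 < (1 + b\<^sup>2) * (1 + b\<^sup>2 - l1)" using True one_plus_square_pos[of b] by (intro mult_pos_pos) auto
      then have "q \<le> l1 / ((1 + b\<^sup>2) * (1 + b\<^sup>2 - l1))" using outer True by (simp add: pos_le_divide_eq)
      also have "\<dots> \<le> excess l1 x" using l1 lx x a by (intro excess_outer_lower) auto
      moreover have "3 / 4 \<le> x" using l1 lx power2_le_imp_le[of 1 x] x by simp
      ultimately show ?thesis using gain_factor_outer_lower[of l1 x b c] outer True l1 lx a by auto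
    next
      case f: False
      then have e: "x\<^sup>2 = l1" "b\<^sup>2 = l1" using lx xb by auto
      show ?thesis
      proof (cases "a\<^sup>2 < l1")
        case True then show ?thesis using False e by simp
      next
        case f2: False
        have "a\<^sup>2 < b\<^sup>2" using a by (intro power_strict_mono) auto
        then show ?thesis using f2 e by simp
      qed
    qed
  qed
  then show ?thesis using gain_factor_mono[OF x l] excess_mono[OF l, of x] by linarith
qed

text \<open>The largest threshold \<open>l2\<close> is the worst case. When it may lie to the right
  of \<open>a\<close>, the trivial bound \<open>1\<close> takes over.\<close>

lemma gain_factor_upper_uniform:
  assumes l: "0 \<le> l" "l \<le> l2" and a: "3 / 4 \<le> a" "a \<le> x"
    and c: "0 \<le> c" "1 \<le> c \<or> l2 \<le> a\<^sup>2 \<and> l2\<^sup>2 * a\<^sup>2 \<le> c\<^sup>2 * ((1 + a\<^sup>2) ^ 3 * (1 + a\<^sup>2 - l2)\<^sup>2)"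
  shows "gain_factor l x \<le> c"
  using c(2)
proof
  assume "1 \<le> c" then show ?thesis using gain_factor_le_1[of x l] a l by simp
next
  assume "l2 \<le> a\<^sup>2 \<and> l2\<^sup>2 * a\<^sup>2 \<le> c\<^sup>2 * ((1 + a\<^sup>2) ^ 3 * (1 + a\<^sup>2 - l2)\<^sup>2)"
  then have "gain_factor l2 x \<le> c" using a c l by (intro gain_factor_upper[of l2 a]) auto
  then show ?thesis using gain_factor_mono[of x l l2] a l by simp
qed

lemma gain_integral_certificate:
  assumes l: "l1 \<le> l" "l \<le> l2" "1 \<le> l1" and B: "4 \<le> B"
    and c: "\<And>i. i \<in> {2..16} \<Longrightarrow> 0 \<le> c i" and q: "\<And>i. i \<in> {2..6} \<Longrightarrow> 0 \<le> q i"
    and inner: "\<And>i a. i \<in> {2..6} \<Longrightarrow> a = real i / 4 \<Longrightarrow> a\<^sup>2 < l1 \<Longrightarrow>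
      (c i)\<^sup>2 * (1 + a\<^sup>2) ^ 3 \<le> a ^ 6 \<and> q i * (1 + a\<^sup>2) \<le> a\<^sup>2"
    and outer: "\<And>i b. i \<in> {2..6} \<Longrightarrow> b = real (Suc i) / 4 \<Longrightarrow> l1 < b\<^sup>2 \<Longrightarrow>
      (c i)\<^sup>2 * ((1 + b\<^sup>2) ^ 3 * (1 + b\<^sup>2 - l1)\<^sup>2) \<le> l1\<^sup>2 * b\<^sup>2 \<and> q i * ((1 + b\<^sup>2) * (1 + b\<^sup>2 - l1)) \<le> l1"
    and right: "\<And>i a. i \<in> {7..16} \<Longrightarrow> a = real i / 4 \<Longrightarrow>
      1 \<le> c i \<or> l2 \<le> a\<^sup>2 \<and> l2\<^sup>2 * a\<^sup>2 \<le> (c i)\<^sup>2 * ((1 + a\<^sup>2) ^ 3 * (1 + a\<^sup>2 - l2)\<^sup>2)"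
  shows "certificate c q mixture_lower \<le> integral {0..B} (gain_density l)"
proof (rule quarters_certificate[OF _ _ _ mixture_lower _ B])
  show "0 \<le> l" using l by simp
  show "0 \<le> c i \<and> 0 \<le> q i" if "i \<in> {2..6}" for i using c[of i] q[of i] that by simp
  show "c i \<le> gain_factor l x \<and> q i \<le> excess l x"
    if i: "i \<in> {2..6}" "real i / 4 \<le> x" "x \<le> real (Suc i) / 4" for i x
    using i by (intro gain_factor_excess_lower[OF l(1) _ i(2,3) _ l(3) c inner[OF i(1) refl] outer[OF i(1) refl]])
      (auto simp: field_simps)
  show "gain_factor l x \<le> c i" if i: "i \<in> {7..16}" "real i / 4 \<le> x" for i x
    using i l by (intro gain_factor_upper_uniform[OF _ l(2) _ i(2) c right[OF i(1) refl]]) auto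
qed

lemma gain_integral_12:
  assumes "1 \<le> l" "l \<le> 2" "4 \<le> B"
  shows "1 / 1000 \<le> integral {0..B} (gain_density l)"
proof -
  \<comment> \<open>Entries 2 to 6 bound the threshold \<open>1\<close> from below, entries 7 to 16
    the threshold \<open>2\<close> from above, each evaluated at the extremal end of its
    cell.\<close>
  define c :: "nat \<Rightarrow> real" where "c = (!) [0, 0, 8944 / 10 ^ 5, 21600 / 10 ^ 5, 19502 / 10 ^ 5, 11378 / 10 ^ 5, 6978 / 10 ^ 5,
    20725 / 10 ^ 5, 11926 / 10 ^ 5, 7421 / 10 ^ 5, 4879 / 10 ^ 5, 3345 / 10 ^ 5, 2372 / 10 ^ 5, 1729 / 10 ^ 5, 1291 / 10 ^ 5, 983 / 10 ^ 5, 761 / 10 ^ 5]"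
  define q :: "nat \<Rightarrow> real" where "q = (!) [0, 0, 20000 / 10 ^ 5, 36000 / 10 ^ 5, 24975 / 10 ^ 5, 13675 / 10 ^ 5, 8037 / 10 ^ 5]"
  have "1 / 1000 \<le> certificate c q mixture_lower"
    using scaled_mixture_table_upper(1,2,7) scaled_mixture_table_lower(3-6,8-15)
    unfolding certificate_def sum_numerals by (simp add: c_def q_def mixture_lower_def field_simps power2_eq_square)
  also have "\<dots> \<le> integral {0..B} (gain_density l)"
    by (rule gain_integral_certificate[OF assms(1,2) _ assms(3)], unfold atLeastAtMost_cases)
      (safe, simp_all add: c_def q_def power2_eq_square power_divide)
  finally show ?thesis .
qed

lemma gain_integral_23:
  assumes "2 \<le> l" "l \<le> 3" "4 \<le> B"
  shows "1 / 1000 \<le> integral {0..B} (gain_density l)"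
proof -
  define c :: "nat \<Rightarrow> real" where "c = (!) [0, 0, 8944 / 10 ^ 5, 21600 / 10 ^ 5, 35355 / 10 ^ 5, 40962 / 10 ^ 5, 20724 / 10 ^ 5,
    60345 / 10 ^ 5, 26833 / 10 ^ 5, 14766 / 10 ^ 5, 9040 / 10 ^ 5, 5920 / 10 ^ 5, 4066 / 10 ^ 5, 2897 / 10 ^ 5, 2124 / 10 ^ 5, 1596 / 10 ^ 5, 1223 / 10 ^ 5]"
  define q :: "nat \<Rightarrow> real" where "q = (!) [0, 0, 20000 / 10 ^ 5, 36000 / 10 ^ 5, 50000 / 10 ^ 5, 49230 / 10 ^ 5, 23869 / 10 ^ 5]"
  have "1 / 1000 \<le> certificate c q mixture_lower"
    using scaled_mixture_table_upper(1-4,7) scaled_mixture_table_lower(5-6,8-15)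
    unfolding certificate_def sum_numerals by (simp add: c_def q_def mixture_lower_def field_simps power2_eq_square)
  also have "\<dots> \<le> integral {0..B} (gain_density l)"
    by (rule gain_integral_certificate[OF assms(1,2) _ assms(3)], unfold atLeastAtMost_cases)
      (safe, simp_all add: c_def q_def power2_eq_square power_divide)
  finally show ?thesis .
qed

lemma gain_integral_34:
  assumes "3 \<le> l" "l \<le> 22 / 5" "4 \<le> B"
  shows "1 / 1000 \<le> integral {0..B} (gain_density l)"
proof -
  \<comment> \<open>\<open>c 7\<close> and \<open>c 8\<close> are the trivial bound
    \<open>1\<close>, because \<open>(7 / 4)^2\<close> and \<open>2^2\<close> both lie below the
    largest threshold \<open>22 / 5\<close>.\<close>
  define c :: "nat \<Rightarrow> real" where "c = (!) [0, 0, 8944 / 10 ^ 5, 21600 / 10 ^ 5, 35355 / 10 ^ 5, 47613 / 10 ^ 5, 57603 / 10 ^ 5,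
    1, 1, 39893 / 10 ^ 5, 19772 / 10 ^ 5, 11602 / 10 ^ 5, 7454 / 10 ^ 5, 5079 / 10 ^ 5, 3608 / 10 ^ 5, 2648 / 10 ^ 5, 1993 / 10 ^ 5]"
  define q :: "nat \<Rightarrow> real" where "q = (!) [0, 0, 20000 / 10 ^ 5, 36000 / 10 ^ 5, 50000 / 10 ^ 5, 60975 / 10 ^ 5, 69230 / 10 ^ 5]"
  have "1 / 1000 \<le> certificate c q mixture_lower"
    using scaled_mixture_table_upper(1-5,7) scaled_mixture_table_lower(6,8-15)
    unfolding certificate_def sum_numerals by (simp add: c_def q_def mixture_lower_def field_simps power2_eq_square)
  also have "\<dots> \<le> integral {0..B} (gain_density l)"
    by (rule gain_integral_certificate[OF assms(1,2) _ assms(3)], unfold atLeastAtMost_cases)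
      (safe, simp_all add: c_def q_def power2_eq_square power_divide)
  finally show ?thesis .
qed

text \<open>The constant depends on \<open>l\<close> but not on \<open>B\<close>, so that it
  survives the passage to the integral over the whole line.\<close>

lemma gain_integral_lower:
  assumes "0 < l" "l \<le> 22 / 5"
  shows "\<exists>e>0. \<forall>B\<ge>4. e \<le> integral {0..B} (gain_density l)"
proof -
  consider "l \<le> 1" | "1 \<le> l" "l \<le> 2" | "2 \<le> l" "l \<le> 3" | "3 \<le> l" by linarith
  then show ?thesis
  proof cases
    case 1
    then show ?thesis using gain_integral_01 assms by (intro exI[of _ "l / 1000"]) auto
  qed (use gain_integral_12 gain_integral_23 gain_integral_34 assms in \<open>intro exI[of _ "1 / 1000"]; auto\<close>)+
qed

section \<open>Stein's identity for the risk\<close>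

abbreviation gauss_mean :: "real \<Rightarrow> (real \<Rightarrow> real) \<Rightarrow> real" where
  "gauss_mean h F \<equiv> (\<integral>x. normal_density h 1 x * F x \<partial>lborel)"

lemma gauss_integrable:
  assumes [measurable]: "F \<in> borel_measurable borel" and F: "\<And>x. \<bar>F x\<bar> \<le> a + b * x\<^sup>2" and b: "0 \<le> b"
  shows "integrable lborel (\<lambda>x. normal_density h 1 x * F x)"
proof (rule Bochner_Integration.integrable_bound)
  show "integrable lborel (\<lambda>x. (a + 2 * b * h\<^sup>2) * normal_density h 1 x + 2 * b * (normal_density h 1 x * (x - h)\<^sup>2))"
    using integrable_normal_moment[of 1 h 2] by (intro Bochner_Integration.integrable_add integrable_mult_right) auto
  show "AE x in lborel. norm (normal_density h 1 x * F x)
      \<le> norm ((a + 2 * b * h\<^sup>2) * normal_density h 1 x + 2 * b * (normal_density h 1 x * (x - h)\<^sup>2))"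
  proof (rule AE_I2)
    fix x
    have "2 * ((x - h)\<^sup>2 + h\<^sup>2) - x\<^sup>2 = (x - 2 * h)\<^sup>2" by (simp add: power2_eq_square algebra_simps)
    then have "x\<^sup>2 \<le> 2 * ((x - h)\<^sup>2 + h\<^sup>2)" by (smt (verit) zero_le_power2)
    then have "b * x\<^sup>2 \<le> b * (2 * ((x - h)\<^sup>2 + h\<^sup>2))" using b by (rule mult_left_mono)
    then have "\<bar>F x\<bar> \<le> a + 2 * b * h\<^sup>2 + 2 * b * (x - h)\<^sup>2" using F[of x] by (simp add: algebra_simps)
    then have "normal_density h 1 x * \<bar>F x\<bar> \<le> normal_density h 1 x * (a + 2 * b * h\<^sup>2 + 2 * b * (x - h)\<^sup>2)"
      by (rule mult_left_mono) simp
    then show "norm (normal_density h 1 x * F x)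
      \<le> norm ((a + 2 * b * h\<^sup>2) * normal_density h 1 x + 2 * b * (normal_density h 1 x * (x - h)\<^sup>2))"
      by (simp add: abs_mult algebra_simps)
  qed
qed measurable

lemma gauss_integrable_bounded:
  assumes "F \<in> borel_measurable borel" and "\<And>x. \<bar>F x\<bar> \<le> a"
  shows "integrable lborel (\<lambda>x. normal_density h 1 x * F x)"
  using gauss_integrable[of F a 0 h] assms by simp

lemma set_integral_symmetric_limit:
  fixes f :: "real \<Rightarrow> real"
  assumes f: "integrable lborel f"
  shows "(\<lambda>n. LINT x:{- real n..real n}|lborel. f x) \<longlonglongrightarrow> (\<integral>x. f x \<partial>lborel)"
  unfolding set_lebesgue_integral_def
proof (rule integral_dominated_convergence[where w = "\<lambda>x. \<bar>f x\<bar>"])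
  show "integrable lborel (\<lambda>x. \<bar>f x\<bar>)" using f by simp
  show "AE x in lborel. (\<lambda>n. indicator {- real n..real n} x *\<^sub>R f x) \<longlonglongrightarrow> f x"
  proof (rule AE_I2)
    fix x
    have "\<forall>\<^sub>F n in sequentially. \<bar>x\<bar> \<le> real n"
      using real_arch_simple[of "\<bar>x\<bar>"] by (meson eventually_sequentially of_nat_mono order_trans)
    then have "\<forall>\<^sub>F n in sequentially. indicator {- real n..real n} x *\<^sub>R f x = f x"
      by eventually_elim (auto simp: indicator_def abs_le_iff)
    then show "(\<lambda>n. indicator {- real n..real n} x *\<^sub>R f x) \<longlonglongrightarrow> f x"
      by (rule tendsto_eventually)
  qed
qed (use f in \<open>auto simp: indicator_def\<close>)

lemma integral_derivative_eq_0:
  fixes F f :: "real \<Rightarrow> real"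
  assumes f: "integrable lborel f" and K: "finite K"
    and F: "\<And>x. x \<notin> K \<Longrightarrow> (F has_real_derivative f x) (at x)" and c: "continuous_on UNIV F"
    and lim: "(\<lambda>n. F (real n)) \<longlonglongrightarrow> 0" "(\<lambda>n. F (- real n)) \<longlonglongrightarrow> 0"
  shows "(\<integral>x. f x \<partial>lborel) = 0"
proof -
  have "(\<lambda>n. LINT x:{- real n..real n}|lborel. f x) \<longlonglongrightarrow> (\<integral>x. f x \<partial>lborel)"
    using f by (rule set_integral_symmetric_limit)
  moreover have "(LINT x:{- real n..real n}|lborel. f x) = F (real n) - F (- real n)" for n
  proof -
    have "(f has_integral F (real n) - F (- real n)) {- real n..real n}"
      using F by (intro fundamental_theorem_of_calculus_strong[OF K])
        (auto intro: continuous_on_subset[OF c] simp: has_real_derivative_iff_has_vector_derivative[symmetric])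
    moreover have "set_integrable lborel {- real n..real n} f"
      using f unfolding set_integrable_def by (intro integrable_mult_indicator) auto
    ultimately show ?thesis by (simp add: set_borel_integral_eq_integral(2) integral_unique)
  qed
  ultimately have "(\<lambda>n. F (real n) - F (- real n)) \<longlonglongrightarrow> (\<integral>x. f x \<partial>lborel)" by simp
  moreover have "(\<lambda>n. F (real n) - F (- real n)) \<longlonglongrightarrow> 0 - 0" using lim by (intro tendsto_diff)
  ultimately show ?thesis using LIMSEQ_unique by fastforce
qed

lemma normal_density_deriv:
  "(normal_density h 1 has_real_derivative - (x - h) * normal_density h 1 x) (at x)"
proof -
  have "((\<lambda>x. c * exp (- (x - h)\<^sup>2 / 2)) has_real_derivative - (x - h) * (c * exp (- (x - h)\<^sup>2 / 2))) (at x)" for c :: real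
    by (auto intro!: derivative_eq_intros simp: field_simps)
  from this[of "1 / sqrt (2 * pi * 1\<^sup>2)"] show ?thesis
    unfolding normal_density_def[abs_def] by simp
qed

lemma continuous_normal_density: "continuous_on A (normal_density h 1)"
  using normal_density_deriv by (meson DERIV_isCont continuous_at_imp_continuous_on)

text \<open>Integration by parts: the derivative of the density times \<open>v\<close> is the
  difference of the two integrands, and the product vanishes at infinity. The finite set
  \<open>K\<close> admits the kinks of \<open>x * weight l x\<close> at
  \<open>\<plusminus> sqrt l\<close>.\<close>

lemma gauss_stein:
  assumes v: "continuous_on UNIV v" "\<And>x. \<bar>v x\<bar> \<le> A" and K: "finite K"
    and v': "\<And>x. x \<notin> K \<Longrightarrow> (v has_real_derivative v' x) (at x)" "v' \<in> borel_measurable borel" "\<And>x. \<bar>v' x\<bar> \<le> A"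
  shows "gauss_mean h (\<lambda>x. (x - h) * v x) = gauss_mean h v'"
proof -
  have [measurable]: "v \<in> borel_measurable borel" "v' \<in> borel_measurable borel"
    using v v' by (auto intro: borel_measurable_continuous_onI)
  have "A \<ge> 0" using v(2)[of 0] by simp
  have "\<bar>(x - h) * v x\<bar> \<le> (1 + \<bar>h\<bar>) * A + A * x\<^sup>2" for x
  proof -
    have "\<bar>x - h\<bar> \<le> 1 + \<bar>h\<bar> + x\<^sup>2" using abs_le_one_plus_square[of x] by simp
    then have "\<bar>(x - h) * v x\<bar> \<le> (1 + \<bar>h\<bar> + x\<^sup>2) * A"
      unfolding abs_mult using v(2)[of x] by (intro mult_mono) auto
    then show ?thesis by (simp add: algebra_simps)
  qed
  then have i1: "integrable lborel (\<lambda>x. normal_density h 1 x * ((x - h) * v x))"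
    using \<open>A \<ge> 0\<close> by (intro gauss_integrable) auto
  have i2: "integrable lborel (\<lambda>x. normal_density h 1 x * v' x)"
    using v' by (intro gauss_integrable_bounded) auto
  have lim: "(\<lambda>n. normal_density h 1 (s * real n) * v (s * real n)) \<longlonglongrightarrow> 0" if "s = 1 \<or> s = -1" for s
  proof (rule Lim_null_comparison)
    show "\<forall>\<^sub>F n in sequentially. norm (normal_density h 1 (s * real n) * v (s * real n)) \<le> normal_density h 1 (s * real n) * A"
      using v(2) by (intro always_eventually) (auto simp: abs_mult intro!: mult_left_mono)
    have "(\<lambda>n. normal_density h 1 (s * real n)) \<longlonglongrightarrow> 0"
      using that unfolding normal_density_def by (elim disjE; simp; real_asymp)
    then show "(\<lambda>n. normal_density h 1 (s * real n) * A) \<longlonglongrightarrow> 0" by (rule tendsto_mult_left_zero)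
  qed
  have "(\<integral>x. normal_density h 1 x * v' x - normal_density h 1 x * ((x - h) * v x) \<partial>lborel) = 0"
  proof (rule integral_derivative_eq_0[OF _ K])
    show "((\<lambda>x. normal_density h 1 x * v x) has_real_derivative
        normal_density h 1 x * v' x - normal_density h 1 x * ((x - h) * v x)) (at x)" if "x \<notin> K" for x
      by (rule derivative_eq_intros normal_density_deriv v'(1)[OF that] refl)+ (simp add: algebra_simps)
    show "continuous_on UNIV (\<lambda>x. normal_density h 1 x * v x)"
      by (intro continuous_intros continuous_normal_density v)
  qed (use i1 i2 lim[of 1] lim[of "-1"] in auto)
  then show ?thesis using i1 i2 by simp
qed

definition shrink :: "real \<Rightarrow> real \<Rightarrow> real" where
  "shrink l x = x * (1 - weight l x)"

definition risk :: "real \<Rightarrow> real \<Rightarrow> real" where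
  "risk l h = gauss_mean h (\<lambda>x. (h - shrink l x)\<^sup>2)"

text \<open>Stein's unbiased estimate: the risk is one minus the mean of \<open>sure l\<close>.\<close>

definition sure :: "real \<Rightarrow> real \<Rightarrow> real" where
  "sure l x = 2 * weight l x - x\<^sup>2 * (weight l x)\<^sup>2 - (if l < x\<^sup>2 then 4 * x\<^sup>2 * (weight l x)\<^sup>2 else 0)"

lemma borel_weight [measurable]: "weight l \<in> borel_measurable borel"
  by (intro borel_measurable_continuous_onI continuous_weight)

lemma borel_sure [measurable]: "sure l \<in> borel_measurable borel"
  unfolding sure_def[abs_def] by measurable

lemma borel_shrink [measurable]: "shrink l \<in> borel_measurable borel"
  unfolding shrink_def[abs_def] by measurable

lemma weight_square_bound:
  assumes "0 \<le> l" shows "x\<^sup>2 * (weight l x)\<^sup>2 \<le> 1 + l"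
proof -
  define m where "m = max 0 (x\<^sup>2 - l) + 1"
  have m: "1 \<le> m" "x\<^sup>2 \<le> m + l" by (auto simp: m_def)
  have "x\<^sup>2 \<le> (1 + l) * m" using m assms mult_left_mono[of 1 m l] by (simp add: algebra_simps)
  also have "\<dots> \<le> (1 + l) * (m * m)" using m assms by (intro mult_left_mono) auto
  finally have "x\<^sup>2 / m\<^sup>2 \<le> 1 + l" using m by (simp add: pos_divide_le_eq power2_eq_square)
  moreover have "weight l x = 1 / m" by (simp add: weight_def m_def)
  ultimately show ?thesis by (simp add: power_divide)
qed

lemma weight_abs_bound:
  assumes "0 \<le> l" shows "\<bar>x * weight l x\<bar> \<le> 1 + l"
proof -
  have "\<bar>x * weight l x\<bar>\<^sup>2 \<le> 1 + l" using weight_square_bound[OF assms, of x] by (simp add: power_mult_distrib)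
  also have "\<dots> \<le> (1 + l)\<^sup>2" using assms by (simp add: power2_eq_square algebra_simps)
  finally show ?thesis using assms by (auto intro: power2_le_imp_le)
qed

lemma weight_deriv:
  assumes "0 \<le> l" "x\<^sup>2 \<noteq> l"
  shows "((\<lambda>x. x * weight l x) has_real_derivative weight l x - (if l < x\<^sup>2 then 2 * x\<^sup>2 * (weight l x)\<^sup>2 else 0)) (at x)"
proof (cases "l < x\<^sup>2")
  case True
  have o: "open {y. l < y\<^sup>2}" by (intro open_Collect_less continuous_intros)
  have e: "y / (y\<^sup>2 - l + 1) = y * weight l y" if "y \<in> {y. l < y\<^sup>2}" for y
    using that by (simp add: weight_def)
  have "((\<lambda>y. y / (y\<^sup>2 - l + 1)) has_real_derivative
      (1 * (x\<^sup>2 - l + 1) - x * (2 * x)) / ((x\<^sup>2 - l + 1) * (x\<^sup>2 - l + 1))) (at x)"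
    using True by (auto intro!: derivative_eq_intros)
  then have "((\<lambda>x. x * weight l x) has_real_derivative
      (1 * (x\<^sup>2 - l + 1) - x * (2 * x)) / ((x\<^sup>2 - l + 1) * (x\<^sup>2 - l + 1))) (at x)"
    by (rule has_field_derivative_transform_within_open[OF _ o]) (use e True in auto)
  moreover have "(1 * (x\<^sup>2 - l + 1) - x * (2 * x)) / ((x\<^sup>2 - l + 1) * (x\<^sup>2 - l + 1)) = weight l x - 2 * x\<^sup>2 * (weight l x)\<^sup>2"
  proof -
    define d where "d = x\<^sup>2 - l + 1"
    have "d \<noteq> 0" using True by (simp add: d_def)
    have w: "weight l x = 1 / d" using True by (simp add: weight_def d_def)
    show ?thesis unfolding d_def[symmetric] w using \<open>d \<noteq> 0\<close> by (simp add: field_simps power2_eq_square)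
  qed
  ultimately show ?thesis using True by simp
next
  case False
  have o: "open {y. y\<^sup>2 < l}" by (intro open_Collect_less continuous_intros)
  have e: "y = y * weight l y" if "y \<in> {y. y\<^sup>2 < l}" for y
    using that by (simp add: weight_def)
  have "((\<lambda>x. x * weight l x) has_real_derivative 1) (at x)"
    by (rule has_field_derivative_transform_within_open[OF DERIV_ident o]) (use e False assms in auto)
  then show ?thesis using False assms by (simp add: weight_def)
qed

text \<open>With \<open>v x = x * weight l x\<close> one has
  \<open>h - shrink l x = v x - (x - h)\<close>. Squaring leaves the variance \<open>1\<close>, a
  bounded square and a cross term that Stein's identity converts into the mean of
  \<open>v'\<close>.\<close>

lemma risk_eq:
  assumes l: "0 \<le> l"
  shows "risk l h = 1 - gauss_mean h (sure l)"
proof -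
  define v where "v x = x * weight l x" for x
  define v' where "v' x = weight l x - (if l < x\<^sup>2 then 2 * x\<^sup>2 * (weight l x)\<^sup>2 else 0)" for x
  have v'b: "\<bar>v' x\<bar> \<le> 2 * (1 + l)" for x
  proof -
    have "\<bar>v' x\<bar> \<le> max (weight l x) (2 * (x\<^sup>2 * (weight l x)\<^sup>2))"
      using weight_pos[of l x] zero_le_mult_iff[of "x\<^sup>2" "(weight l x)\<^sup>2"]
      by (auto simp: v'_def mult.assoc abs_le_iff max_def)
    also have "\<dots> \<le> 2 * (1 + l)" using weight_square_bound[OF l, of x] weight_le_1[of l x] l by simp
    finally show ?thesis .
  qed
  have vb: "\<bar>v x\<bar> \<le> 1 + l" for x using weight_abs_bound[OF l] by (simp add: v_def)
  have vb2: "\<bar>v x\<bar> \<le> 2 * (1 + l)" for x using vb[of x] l by simp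
  have cont: "continuous_on UNIV v" unfolding v_def[abs_def] by (intro continuous_intros)
  have [measurable]: "v \<in> borel_measurable borel" "v' \<in> borel_measurable borel"
    unfolding v_def[abs_def] v'_def[abs_def] by measurable
  have stein: "gauss_mean h (\<lambda>x. (x - h) * v x) = gauss_mean h v'"
  proof (rule gauss_stein[OF cont vb2, of "{- sqrt l, sqrt l}"])
    fix x assume "x \<notin> {- sqrt l, sqrt l}"
    then have "x\<^sup>2 \<noteq> l" by (auto simp: real_sqrt_abs abs_if split: if_splits)
    then show "(v has_real_derivative v' x) (at x)"
      using weight_deriv[OF l, of x] unfolding v_def[abs_def] v'_def by simp
  qed (use v'b in auto)
  have e1: "(h - shrink l x)\<^sup>2 = (x - h)\<^sup>2 - 2 * ((x - h) * v x) + (v x)\<^sup>2" for x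
    by (simp add: shrink_def v_def power2_eq_square algebra_simps)
  have e2: "sure l x = 2 * v' x - (v x)\<^sup>2" for x
    by (simp add: sure_def v_def v'_def power_mult_distrib)
  have v2: "(v x)\<^sup>2 \<le> 1 + l" for x using weight_square_bound[OF l, of x] by (simp add: v_def power_mult_distrib)
  have i1: "integrable lborel (\<lambda>x. normal_density h 1 x * (x - h)\<^sup>2)" by (rule integrable_normal_moment) simp
  have i2: "integrable lborel (\<lambda>x. normal_density h 1 x * ((x - h) * v x))"
  proof (rule gauss_integrable)
    fix x
    have "\<bar>(x - h) * v x\<bar> \<le> (1 + \<bar>h\<bar> + x\<^sup>2) * (1 + l)"
      unfolding abs_mult
      using abs_le_one_plus_square[of x] by (intro mult_mono vb) auto
    then show "\<bar>(x - h) * v x\<bar> \<le> (1 + \<bar>h\<bar>) * (1 + l) + (1 + l) * x\<^sup>2" by (simp add: algebra_simps)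
  qed (use l in auto)
  have i3: "integrable lborel (\<lambda>x. normal_density h 1 x * (v x)\<^sup>2)"
    using v2 by (intro gauss_integrable_bounded[of _ "1 + l"]) auto
  have i4: "integrable lborel (\<lambda>x. normal_density h 1 x * v' x)"
    using v'b by (intro gauss_integrable_bounded) auto
  have m2: "gauss_mean h (\<lambda>x. (x - h)\<^sup>2) = 1"
    using integral_normal_moment_even[of 1 h 1] by simp
  have "risk l h = gauss_mean h (\<lambda>x. (x - h)\<^sup>2) - 2 * gauss_mean h (\<lambda>x. (x - h) * v x) + gauss_mean h (\<lambda>x. (v x)\<^sup>2)"
  proof -
    have "normal_density h 1 x * ((x - h)\<^sup>2 - 2 * ((x - h) * v x) + (v x)\<^sup>2)
      = normal_density h 1 x * (x - h)\<^sup>2 - 2 * (normal_density h 1 x * ((x - h) * v x)) + normal_density h 1 x * (v x)\<^sup>2" for x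
      by (simp add: algebra_simps)
    then show ?thesis unfolding risk_def e1 using i1 i2 i3 by simp
  qed
  moreover have "gauss_mean h (sure l) = 2 * gauss_mean h v' - gauss_mean h (\<lambda>x. (v x)\<^sup>2)"
  proof -
    have "normal_density h 1 x * (2 * v' x - (v x)\<^sup>2)
      = 2 * (normal_density h 1 x * v' x) - normal_density h 1 x * (v x)\<^sup>2" for x
      by (simp add: algebra_simps)
    then show ?thesis unfolding e2 using i3 i4 by simp
  qed
  ultimately show ?thesis using m2 stein by simp
qed

section \<open>The difference of the two unbiased risk estimates as an explicit rational
  function\<close>

lemma sure_bound: "0 \<le> l \<Longrightarrow> \<bar>sure l x\<bar> \<le> 2 + 5 * (1 + l)"
proof -
  assume l: "0 \<le> l"
  define q where "q = x\<^sup>2 * (weight l x)\<^sup>2"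
  have "0 \<le> q" "q \<le> 1 + l" using weight_square_bound[OF l, of x] by (simp_all add: q_def)
  then show ?thesis
    using weight_pos[of l x] weight_le_1[of l x] l by (simp add: sure_def mult.assoc q_def[symmetric] abs_le_iff)
qed

text \<open>Oriented so that a positive mean under \<open>N(h, 1)\<close> is an improvement brought
  by the threshold.\<close>

definition gap :: "real \<Rightarrow> real \<Rightarrow> real" where
  "gap l x = sure l x - sure 0 x"

lemma borel_gap [measurable]: "gap l \<in> borel_measurable borel"
  unfolding gap_def[abs_def] by measurable

lemma gap_minus [simp]: "gap l (- x) = gap l x"
  by (simp add: gap_def sure_def)

lemma gap_bound: "0 \<le> l \<Longrightarrow> \<bar>gap l x\<bar> \<le> 14 + 5 * l"
  using sure_bound[of l x] sure_bound[of 0 x] by (simp add: gap_def)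

lemma gauss_gap_integrable: "0 \<le> l \<Longrightarrow> integrable lborel (\<lambda>x. normal_density h 1 x * gap l x)"
  by (intro gauss_integrable_bounded[OF _ gap_bound]) auto

lemma risk_diff: "0 \<le> l \<Longrightarrow> risk 0 h - risk l h = gauss_mean h (gap l)"
proof -
  assume l: "0 \<le> l"
  have i: "integrable lborel (\<lambda>x. normal_density h 1 x * sure l x)" if "0 \<le> l" for l
    using sure_bound[OF that] by (intro gauss_integrable_bounded) auto
  show ?thesis using i[OF l] i[of 0]
    by (simp add: risk_eq[OF l] risk_eq[of 0] gap_def right_diff_distrib)
qed

lemma sure_0: "sure 0 x = (2 - 3 * x\<^sup>2) / (1 + x\<^sup>2)\<^sup>2"
proof -
  define A where "A = 1 + x\<^sup>2"
  have A: "A \<noteq> 0" "x\<^sup>2 = A - 1" using one_plus_square_pos[of x] by (auto simp: A_def)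
  have "sure 0 x = 2 * (1 / A) - x\<^sup>2 * (1 / A)\<^sup>2 - 4 * x\<^sup>2 * (1 / A)\<^sup>2"
    by (auto simp: sure_def weight_0 A_def)
  also have "\<dots> = (2 - 3 * x\<^sup>2) / A\<^sup>2" unfolding A(2) using A(1) by (simp add: field_simps power2_eq_square)
  finally show ?thesis by (simp add: A_def)
qed

lemma gap_inner:
  assumes "x\<^sup>2 \<le> l" shows "gap l x = x\<^sup>2 * (6 - (x\<^sup>2)\<^sup>2) / (1 + x\<^sup>2)\<^sup>2"
proof -
  define t where "t = x\<^sup>2"
  have t: "0 < (1 + t)\<^sup>2" using one_plus_square_pos[of x] by (simp add: t_def)
  have "sure l x = 2 - t" using assms by (simp add: sure_def weight_def t_def)
  then have "gap l x = (2 - t) - (2 - 3 * t) / (1 + t)\<^sup>2" by (simp add: gap_def sure_0 t_def)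
  also have "\<dots> = ((2 - t) * (1 + t)\<^sup>2 - (2 - 3 * t)) / (1 + t)\<^sup>2" using t by (simp add: diff_divide_distrib)
  also have "(2 - t) * (1 + t)\<^sup>2 - (2 - 3 * t) = t * (6 - t\<^sup>2)" by (simp add: power2_eq_square algebra_simps)
  finally show ?thesis by (simp add: t_def)
qed

lemma gap_outer:
  assumes "l < x\<^sup>2" "0 \<le> l"
  shows "gap l x = l * (2 - 2 * l - (6 - 3 * l) * x\<^sup>2 - 8 * (x\<^sup>2)\<^sup>2) / ((1 + x\<^sup>2)\<^sup>2 * (1 + x\<^sup>2 - l)\<^sup>2)"
proof -
  define t where "t = x\<^sup>2"
  have t: "(1 + t)\<^sup>2 \<noteq> 0" "1 + t - l \<noteq> 0" "(1 + t - l)\<^sup>2 \<noteq> 0" using assms by (auto simp: t_def)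
  have w: "weight l x = 1 / (1 + t - l)" using assms by (simp add: weight_def t_def add.commute)
  have "sure l x = 2 * (1 / (1 + t - l)) - 5 * t * (1 / (1 + t - l))\<^sup>2"
    using assms by (simp add: sure_def w t_def)
  also have "\<dots> = (2 * (1 + t - l) - 5 * t) / (1 + t - l)\<^sup>2"
  proof -
    have "2 * (1 / B) - 5 * t * (1 / B)\<^sup>2 = (2 * B - 5 * t) / B\<^sup>2" if "B \<noteq> 0" for B
      using that by (simp add: field_simps power2_eq_square)
    from this[OF t(2)] show ?thesis .
  qed
  finally have "gap l x = (2 * (1 + t - l) - 5 * t) / (1 + t - l)\<^sup>2 - (2 - 3 * t) / (1 + t)\<^sup>2"
    by (simp add: gap_def sure_0 t_def)
  also have "\<dots> = ((2 * (1 + t - l) - 5 * t) * (1 + t)\<^sup>2 - (2 - 3 * t) * (1 + t - l)\<^sup>2) / ((1 + t - l)\<^sup>2 * (1 + t)\<^sup>2)"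
    using t by (intro diff_frac_eq)
  also have "(2 * (1 + t - l) - 5 * t) * (1 + t)\<^sup>2 - (2 - 3 * t) * (1 + t - l)\<^sup>2
      = l * (2 - 2 * l - (6 - 3 * l) * t - 8 * t\<^sup>2)" by (simp add: power2_eq_square algebra_simps)
  finally show ?thesis by (simp add: t_def mult.commute)
qed

section \<open>The gain is largest at the origin\<close>

lemma gap_outer_sign:
  assumes "l < x\<^sup>2" "0 \<le> l"
  shows "2 - 2 * l - (6 - 3 * l) * x\<^sup>2 - 8 * (x\<^sup>2)\<^sup>2 \<le> 0 \<Longrightarrow> gap l x \<le> 0"
    and "0 \<le> 2 - 2 * l - (6 - 3 * l) * x\<^sup>2 - 8 * (x\<^sup>2)\<^sup>2 \<Longrightarrow> 0 \<le> gap l x"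
  unfolding gap_outer[OF assms] using assms
  by (auto intro!: divide_nonpos_nonneg divide_nonneg_nonneg mult_nonneg_nonpos mult_nonneg_nonneg)

lemma gap_inner_sign:
  assumes "x\<^sup>2 \<le> l"
  shows "6 \<le> (x\<^sup>2)\<^sup>2 \<Longrightarrow> gap l x \<le> 0" and "(x\<^sup>2)\<^sup>2 \<le> 6 \<Longrightarrow> 0 \<le> gap l x"
  unfolding gap_inner[OF assms]
  by (auto intro!: divide_nonpos_nonneg divide_nonneg_nonneg mult_nonneg_nonpos mult_nonneg_nonneg)

lemma gap_outer_nonpos:
  assumes "1 \<le> l" "l < x\<^sup>2" shows "gap l x \<le> 0"
proof (rule gap_outer_sign(1))
  have "l * x\<^sup>2 \<le> x\<^sup>2 * x\<^sup>2" using assms by (intro mult_right_mono) auto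
  then have "3 * (l * x\<^sup>2) \<le> 8 * (x\<^sup>2 * x\<^sup>2)" using zero_le_mult_iff[of "x\<^sup>2" "x\<^sup>2"] by linarith
  then show "2 - 2 * l - (6 - 3 * l) * x\<^sup>2 - 8 * (x\<^sup>2)\<^sup>2 \<le> 0"
    using assms by (simp add: algebra_simps power2_eq_square[of "x\<^sup>2"])
qed (use assms in auto)

text \<open>Inside the threshold the sign is decided by \<open>6 - x^4\<close>, outside by a
  quadratic in \<open>x^2\<close>. For \<open>1 \<le> l\<close> the outside is nonpositive, so the
  change is at \<open>min l (sqrt 6)\<close>. For \<open>l < 1\<close> the quadratic may stay
  positive past the threshold; it decreases and has a root \<open>r\<close> in
  \<open>[0, 1]\<close>, whence \<open>max l r\<close>. The bounds on \<open>c\<close> feed the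
  comparison with \<open>cosh\<close> and the curvature estimate.\<close>

lemma gap_crossing:
  assumes l: "0 < l"
  obtains c where "0 < c" "c \<le> 3" "l \<le> 1 \<Longrightarrow> c \<le> 1"
    "\<And>x. x\<^sup>2 \<le> c \<Longrightarrow> 0 \<le> gap l x" "\<And>x. c < x\<^sup>2 \<Longrightarrow> gap l x \<le> 0"
proof (cases "1 \<le> l")
  case True
  define c where "c = min l (sqrt 6)"
  have s: "sqrt 6 \<le> 3" by (rule real_le_lsqrt) auto
  show ?thesis
  proof (rule that[of c])
    show "0 < c" "c \<le> 3" using l s by (auto simp: c_def)
    show "c \<le> 1" if "l \<le> 1" using that by (simp add: c_def)
    show "0 \<le> gap l x" if "x\<^sup>2 \<le> c" for x
    proof (rule gap_inner_sign(2))
      have "(x\<^sup>2)\<^sup>2 \<le> (sqrt 6)\<^sup>2" using that by (intro power_mono) (auto simp: c_def)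
      then show "(x\<^sup>2)\<^sup>2 \<le> 6" by simp
    qed (use that in \<open>simp add: c_def\<close>)
    show "gap l x \<le> 0" if "c < x\<^sup>2" for x
    proof (cases "x\<^sup>2 \<le> l")
      case f: True
      then have "sqrt 6 \<le> x\<^sup>2" using that by (auto simp: c_def)
      then have "(sqrt 6)\<^sup>2 \<le> (x\<^sup>2)\<^sup>2" by (intro power_mono) auto
      then show ?thesis using gap_inner_sign(1)[OF f] by simp
    next
      case False
      then show ?thesis using gap_outer_nonpos True by simp
    qed
  qed
next
  case False
  define q where "q t = 2 - 2 * l - (6 - 3 * l) * t - 8 * t\<^sup>2" for t
  have "\<exists>r. 0 \<le> r \<and> r \<le> 1 \<and> q r = 0"
  proof (rule IVT2)
    show "q 1 \<le> 0" "0 \<le> q 0" using False l by (auto simp: q_def)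
    show "\<forall>x. 0 \<le> x \<and> x \<le> 1 \<longrightarrow> isCont q x" unfolding q_def by (auto intro!: continuous_intros)
  qed simp
  then obtain r where r: "0 \<le> r" "r \<le> 1" "q r = 0" by blast
  have mono: "q t \<le> q s" if "0 \<le> s" "s \<le> t" for s t
  proof -
    have "(6 - 3 * l) * s \<le> (6 - 3 * l) * t" using that False by (intro mult_left_mono) auto
    moreover have "s\<^sup>2 \<le> t\<^sup>2" using that by (intro power_mono)
    ultimately show ?thesis by (simp add: q_def)
  qed
  show ?thesis
  proof (rule that[of "max l r"])
    show "0 \<le> gap l x" if x: "x\<^sup>2 \<le> max l r" for x
    proof (cases "x\<^sup>2 \<le> l")
      case True
      have "(x\<^sup>2)\<^sup>2 \<le> 1\<^sup>2" using True False by (intro power_mono) auto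
      then show ?thesis using gap_inner_sign(2)[OF True] by simp
    next
      case f: False
      then have "q r \<le> q (x\<^sup>2)" using x by (intro mono) auto
      then show ?thesis using f gap_outer_sign(2)[of l x] r l by (simp add: q_def)
    qed
    show "gap l x \<le> 0" if "max l r < x\<^sup>2" for x
    proof -
      have "q (x\<^sup>2) \<le> q r" using that r by (intro mono) auto
      then show ?thesis using that gap_outer_sign(1)[of l x] r l by (simp add: q_def)
    qed
  qed (use l r False in auto)
qed

section \<open>Comparison of the hyperbolic cosine with quadratics and with Gaussian
  exponentials\<close>

lemma cosh_minus_1_mono:
  fixes a b :: real
  assumes "0 \<le> a" "a \<le> b"
  shows "(cosh a - 1) * b\<^sup>2 \<le> (cosh b - 1) * a\<^sup>2"
proof (cases "a = 0")
  case False
  have s: "sinh x * y \<le> sinh y * x" if "0 < x" "x \<le> y" for x y :: real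
  proof -
    have "sinh x / x \<le> sinh y / y"
    proof (rule DERIV_nonneg_imp_nondecreasing[OF that(2)])
      fix t assume t: "x \<le> t" "t \<le> y"
      have "sinh t \<le> t * cosh t" using t that by (intro sinh_le_mult_cosh) auto
      then show "\<exists>d. ((\<lambda>t. sinh t / t) has_real_derivative d) (at t) \<and> 0 \<le> d"
        using t that by (intro exI[of _ "(cosh t * t - sinh t) / t\<^sup>2"] conjI)
          (auto intro!: derivative_eq_intros simp: power2_eq_square mult.commute)
    qed
    then show ?thesis using that by (simp add: field_simps)
  qed
  \<comment> \<open>The half-angle formula reduces the monotonicity of
    \<open>(cosh x - 1) / x^2\<close> to that of \<open>sinh x / x\<close>.\<close>
  have c: "cosh x - 1 = 2 * (sinh (x / 2))\<^sup>2" for x :: real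
    using cosh_double[of "x / 2"] cosh_square_eq[of "x / 2"] by simp
  have "sinh (a / 2) * (b / 2) \<le> sinh (b / 2) * (a / 2)" using assms False by (intro s) auto
  then have "(sinh (a / 2) * (b / 2))\<^sup>2 \<le> (sinh (b / 2) * (a / 2))\<^sup>2"
    using assms by (intro power_mono) auto
  then show ?thesis unfolding c by (simp add: power_mult_distrib power_divide)
qed simp

text \<open>The power series in \<open>h^2\<close> are compared term by term. With \<open>c\<close>
  in place of \<open>3\<close> the terms of order \<open>h^2\<close> agree for every
  \<open>c\<close>, and those of order \<open>h^4\<close> require \<open>c \<le> 3\<close>; so
  \<open>3\<close> is the largest admissible constant.\<close>

lemma cosh_sqrt3_bound: "cosh (sqrt 3 * h) - 1 \<le> 3 * (exp (h\<^sup>2 / 2) - 1)" for h :: real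
proof -
  have "(\<lambda>n. if even n then (sqrt 3 * h) ^ n / fact n else 0) sums cosh (sqrt 3 * h)"
    using cosh_converges[of "sqrt 3 * h"] by (simp add: divide_inverse mult.commute cong: if_cong)
  then have "(\<lambda>j. if even (2 * j) then (sqrt 3 * h) ^ (2 * j) / fact (2 * j) else 0) sums cosh (sqrt 3 * h)"
    by (subst sums_mono_reindex[of "\<lambda>j. 2 * j"]) (auto simp: strict_mono_def elim!: evenE)
  moreover have "(if even (2 * j) then (sqrt 3 * h) ^ (2 * j) / fact (2 * j) else 0) = (3 * h\<^sup>2) ^ j / fact (2 * j)" for j :: nat
    by (simp add: power_mult power_mult_distrib)
  ultimately have c: "(\<lambda>j. (3 * h\<^sup>2) ^ j / fact (2 * j)) sums cosh (sqrt 3 * h)" by simp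
  have e: "(\<lambda>j. (h\<^sup>2 / 2) ^ j / fact j) sums exp (h\<^sup>2 / 2)"
    using exp_converges[of "h\<^sup>2 / 2"] by (simp add: field_simps)
  have f: "6 ^ j * fact j \<le> (3 * fact (2 * j) :: real)" if "1 \<le> j" for j :: nat
    using that
  proof (induction j rule: nat_induct_at_least)
    case (Suc j)
    have "6 ^ Suc j * fact (Suc j) = 6 * real (Suc j) * (6 ^ j * fact j)" by simp
    also have "\<dots> \<le> 6 * real (Suc j) * (3 * fact (2 * j))" using Suc by (intro mult_left_mono) auto
    also have "\<dots> \<le> (real (2 * j + 2) * real (2 * j + 1)) * (3 * fact (2 * j))"
    proof (intro mult_right_mono)
      have "3 \<le> real (2 * j + 1)" using Suc by simp
      then have "real (j + 1) * 3 \<le> real (j + 1) * real (2 * j + 1)" by (intro mult_left_mono) auto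
      then show "6 * real (Suc j) \<le> real (2 * j + 2) * real (2 * j + 1)" by (simp add: algebra_simps)
    qed auto
    also have "\<dots> = 3 * fact (2 * Suc j)" by simp
    finally show ?case .
  qed simp
  have "cosh (sqrt 3 * h) \<le> 3 * exp (h\<^sup>2 / 2) - 2"
  proof (rule sums_le[OF _ c])
    show "(\<lambda>j. 3 * ((h\<^sup>2 / 2) ^ j / fact j) - (if j = 0 then 2 else 0)) sums (3 * exp (h\<^sup>2 / 2) - 2)"
      by (intro sums_diff sums_mult e) (rule sums_single)
    show "(3 * h\<^sup>2) ^ j / fact (2 * j) \<le> 3 * ((h\<^sup>2 / 2) ^ j / fact j) - (if j = 0 then 2 else 0)" for j
    proof (cases "j = 0")
      case False
      have "6 ^ j / fact (2 * j) \<le> (3 / fact j :: real)" using f[of j] False by (simp add: field_simps)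
      then have "(h\<^sup>2 / 2) ^ j * (6 ^ j / fact (2 * j)) \<le> (h\<^sup>2 / 2) ^ j * (3 / fact j)" by (intro mult_left_mono) auto
      moreover have "(3 * h\<^sup>2) ^ j = (h\<^sup>2 / 2) ^ j * 6 ^ j"
        unfolding power_mult_distrib[symmetric] by (rule arg_cong[where f = "\<lambda>y. y ^ j"]) simp
      ultimately show ?thesis using False by (simp add: mult.commute)
    qed simp
  qed
  then show ?thesis by simp
qed

text \<open>Since \<open>(cosh y - 1) / y^2\<close> increases with \<open>y > 0\<close>, the case
  \<open>c = 3\<close> is the worst one.\<close>

lemma cosh_chord_bound:
  fixes h c :: real
  assumes "0 < c" "c \<le> 3"
  shows "cosh (h * sqrt c) - 1 \<le> c * (exp (h\<^sup>2 / 2) - 1)"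
proof (cases "h = 0")
  case False
  have "(cosh (\<bar>h\<bar> * sqrt c) - 1) * (\<bar>h\<bar> * sqrt 3)\<^sup>2 \<le> (cosh (\<bar>h\<bar> * sqrt 3) - 1) * (\<bar>h\<bar> * sqrt c)\<^sup>2"
    using assms by (intro cosh_minus_1_mono mult_left_mono) auto
  moreover have "cosh (\<bar>h\<bar> * s) = cosh (h * s)" for s by (cases "0 \<le> h") auto
  ultimately have "(cosh (h * sqrt c) - 1) * (h\<^sup>2 * 3) \<le> (cosh (h * sqrt 3) - 1) * (h\<^sup>2 * c)"
    using assms by (simp only: power_mult_distrib power2_abs real_sqrt_pow2 zero_le_numeral less_imp_le)
  then have "h\<^sup>2 * ((cosh (h * sqrt c) - 1) * 3) \<le> h\<^sup>2 * ((cosh (h * sqrt 3) - 1) * c)"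
    by (simp only: mult_ac)
  then have "(cosh (h * sqrt c) - 1) * 3 \<le> (cosh (h * sqrt 3) - 1) * c" using False by simp
  also have "\<dots> \<le> (3 * (exp (h\<^sup>2 / 2) - 1)) * c"
    using cosh_sqrt3_bound[of h] assms by (intro mult_right_mono) (auto simp: mult.commute)
  also have "\<dots> = (c * (exp (h\<^sup>2 / 2) - 1)) * 3" by (simp only: mult_ac)
  finally show ?thesis by (rule mult_right_le_imp_le) simp
qed simp

lemma gauss_mean_reflect: "gauss_mean h F = gauss_mean (- h) (\<lambda>x. F (- x))"
proof -
  have "gauss_mean h F = (\<integral>x. normal_density h 1 (0 + -1 * x) * F (0 + -1 * x) \<partial>lborel)"
    by (subst lborel_integral_real_affine[where c = "-1" and t = 0]) auto
  also have "\<dots> = gauss_mean (- h) (\<lambda>x. F (- x))"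
    by (simp add: normal_density_def power2_eq_square algebra_simps)
  finally show ?thesis .
qed

lemma normal_density_shift:
  "normal_density h 1 x = normal_density 0 1 x * (exp (- (h\<^sup>2 / 2)) * exp (h * x))"
proof -
  have "exp (- ((x - h)\<^sup>2 / 2)) = exp (- (x\<^sup>2 / 2)) * (exp (- (h\<^sup>2 / 2)) * exp (h * x))"
    by (simp add: exp_add[symmetric] power2_eq_square field_simps)
  then show ?thesis by (simp add: normal_density_def)
qed

text \<open>An even function has the same mean under \<open>N(h, 1)\<close> and
  \<open>N(- h, 1)\<close>; averaging the two turns the exponential tilt \<open>exp (h * x)\<close>
  into \<open>cosh (h * x)\<close>.\<close>

lemma gauss_mean_even:
  assumes i: "\<And>h. integrable lborel (\<lambda>x. normal_density h 1 x * F x)" and even: "\<And>x. F (- x) = F x"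
  shows "gauss_mean h F = gauss_mean 0 (\<lambda>x. exp (- (h\<^sup>2 / 2)) * cosh (h * x) * F x)"
    and "integrable lborel (\<lambda>x. normal_density 0 1 x * (exp (- (h\<^sup>2 / 2)) * cosh (h * x) * F x))"
proof -
  have e: "normal_density 0 1 x * (exp (- (h\<^sup>2 / 2)) * cosh (h * x) * F x)
      = (normal_density h 1 x * F x + normal_density (- h) 1 x * F x) / 2" for x
    by (simp add: normal_density_shift[of h] normal_density_shift[of "- h"] cosh_field_def field_simps)
  show "integrable lborel (\<lambda>x. normal_density 0 1 x * (exp (- (h\<^sup>2 / 2)) * cosh (h * x) * F x))"
    unfolding e using i by simp
  have "gauss_mean 0 (\<lambda>x. exp (- (h\<^sup>2 / 2)) * cosh (h * x) * F x) = (gauss_mean h F + gauss_mean (- h) F) / 2"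
    unfolding e using i by simp
  also have "gauss_mean (- h) F = gauss_mean h F"
    using gauss_mean_reflect[of h F] even by simp
  finally show "gauss_mean h F = gauss_mean 0 (\<lambda>x. exp (- (h\<^sup>2 / 2)) * cosh (h * x) * F x)" by simp
qed

lemma shrink_abs_mono:
  assumes "0 \<le> l" "l \<le> l'" shows "(shrink l' x)\<^sup>2 \<le> (shrink l x)\<^sup>2"
proof -
  have "0 \<le> 1 - weight l' x" "1 - weight l' x \<le> 1 - weight l x"
    using weight_mono[OF assms(2)] weight_le_1 by simp_all
  then have "(1 - weight l' x)\<^sup>2 \<le> (1 - weight l x)\<^sup>2" by (intro power_mono)
  then show ?thesis by (simp add: shrink_def power_mult_distrib mult_left_mono)
qed

lemma shrink_square_le: "(shrink l x)\<^sup>2 \<le> x\<^sup>2"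
proof -
  have "(1 - weight l x)\<^sup>2 \<le> 1\<^sup>2" using weight_pos[of l x] weight_le_1[of l x] by (intro power_mono) auto
  then show ?thesis by (simp add: shrink_def power_mult_distrib mult_left_le)
qed

lemma shrink_integrable: "integrable lborel (\<lambda>x. normal_density h 1 x * (shrink l x)\<^sup>2)"
  using shrink_square_le[of l] by (intro gauss_integrable[of _ 0 1]) auto

lemma risk_integrable: "integrable lborel (\<lambda>x. normal_density h 1 x * (h - shrink l x)\<^sup>2)"
proof (rule gauss_integrable)
  fix x
  have "0 \<le> (h + shrink l x)\<^sup>2" by simp
  then have "(h - shrink l x)\<^sup>2 \<le> 2 * h\<^sup>2 + 2 * (shrink l x)\<^sup>2" by (simp add: power2_eq_square algebra_simps)
  then show "\<bar>(h - shrink l x)\<^sup>2\<bar> \<le> 2 * h\<^sup>2 + 2 * x\<^sup>2" using shrink_square_le[of l x] by simp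
qed auto

lemma risk_at_0_mono: "0 \<le> l \<Longrightarrow> l \<le> l' \<Longrightarrow> risk l' 0 \<le> risk l 0"
  unfolding risk_def using shrink_integrable shrink_abs_mono
  by (intro integral_mono) (auto intro!: mult_left_mono)

lemma gap_mean_nonneg: "0 \<le> l \<Longrightarrow> 0 \<le> gauss_mean 0 (gap l)"
  using risk_diff[of l 0] risk_at_0_mono[of 0 l] by simp

lemma gap_curvature_integrable:
  assumes "0 \<le> l" shows "integrable lborel (\<lambda>x. normal_density h 1 x * (gap l x * (x\<^sup>2 - 1)))"
proof (rule gauss_integrable)
  fix x :: real
  have "\<bar>x\<^sup>2 - 1\<bar> \<le> 1 + x\<^sup>2" using zero_le_power2[of x] by linarith
  then have "\<bar>gap l x * (x\<^sup>2 - 1)\<bar> \<le> (14 + 5 * l) * (1 + x\<^sup>2)"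
    unfolding abs_mult using assms gap_bound[OF assms] by (intro mult_mono) auto
  then show "\<bar>gap l x * (x\<^sup>2 - 1)\<bar> \<le> (14 + 5 * l) + (14 + 5 * l) * x\<^sup>2" by (simp only: distrib_left mult_1_right)
qed (use assms in auto)

lemma normal_density_0_antimono: "\<bar>x\<bar> \<le> \<bar>y\<bar> \<Longrightarrow> normal_density 0 1 y \<le> normal_density 0 1 x"
  by (simp add: std_normal_density_def abs_le_square_iff divide_right_mono)

text \<open>
  For \<open>\<bar>x\<bar> \<le> 1\<close> the normal density is replaced by its value at \<open>1\<close> and \<open>1 / (1 + t)\<^sup>2\<close>, with \<open>t = x\<^sup>2\<close>, by
  its minorant \<open>1 - 2t + 5t\<^sup>2/4\<close>. For \<open>1 < \<bar>x\<bar> \<le> 8/5\<close> the constant \<open>14/25\<close> bounds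
  \<open>(6 - t\<^sup>2)(t - 1)/4\<close>; beyond that \<open>gap l\<close> is nonpositive, because \<open>(8/5)\<^sup>4 > 6\<close>.
\<close>

lemma gap_majorant:
  assumes l: "1 \<le> l"
  shows "normal_density 0 1 x * (gap l x * (x\<^sup>2 - 1))
    \<le> normal_density 0 1 1 * (indicator {- (8 / 5)..8 / 5} x * (14 / 25)
        - indicator {- 1..1} x * (14 / 25 + (6 * x\<^sup>2 - 18 * x ^ 4 + 37 / 2 * x ^ 6 - 9 / 2 * x ^ 8 - 13 / 4 * x ^ 10 + 5 / 4 * x ^ 12)))"
proof -
  define t where "t = x\<^sup>2"
  have t0: "0 \<le> t" by (simp add: t_def)
  have nd: "0 \<le> normal_density 0 1 1" by simp
  have pw: "6 * x\<^sup>2 - 18 * x ^ 4 + 37 / 2 * x ^ 6 - 9 / 2 * x ^ 8 - 13 / 4 * x ^ 10 + 5 / 4 * x ^ 12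
    = t * (6 - t\<^sup>2) * (1 - t) * (1 - 2 * t + 5 / 4 * t\<^sup>2)"
    by (simp add: t_def algebra_simps power2_eq_square numeral_eq_Suc)
  consider "\<bar>x\<bar> \<le> 1" | "1 < \<bar>x\<bar>" "\<bar>x\<bar> \<le> 8 / 5" | "8 / 5 < \<bar>x\<bar>" by linarith
  then show ?thesis
  proof cases
    case 1
    then have t1: "t \<le> 1" by (simp add: t_def abs_square_le_1)
    have a: "gap l x = t * (6 - t\<^sup>2) / (1 + t)\<^sup>2" using gap_inner[of x l] t1 l by (simp add: t_def)
    have t6: "0 \<le> 6 - t\<^sup>2" using t0 t1 power_mono[of t 1 2] by simp
    have b: "1 - 2 * t + 5 / 4 * t\<^sup>2 \<le> 1 / (1 + t)\<^sup>2"
    proof -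
      have "(1 - 2 * t + 5 / 4 * t\<^sup>2) * (1 + t)\<^sup>2 = 1 - t\<^sup>2 * (7 / 4 - t / 2 - 5 / 4 * t\<^sup>2)"
        by (simp add: power2_eq_square algebra_simps)
      moreover have "t\<^sup>2 \<le> t" using t0 t1 by (simp add: power2_eq_square mult_left_le)
      then have "0 \<le> t\<^sup>2 * (7 / 4 - t / 2 - 5 / 4 * t\<^sup>2)" using t1 by (intro mult_nonneg_nonneg) auto
      ultimately show ?thesis using t0 by (simp add: pos_le_divide_eq)
    qed
    have k: "0 \<le> t * (6 - t\<^sup>2) * (1 - t)" using t0 t1 t6 by simp
    have "t * (6 - t\<^sup>2) * (1 - t) * (1 - 2 * t + 5 / 4 * t\<^sup>2) \<le> t * (6 - t\<^sup>2) * (1 - t) * (1 / (1 + t)\<^sup>2)"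
      using b k by (rule mult_left_mono)
    then have "normal_density 0 1 1 * (t * (6 - t\<^sup>2) * (1 - t) * (1 - 2 * t + 5 / 4 * t\<^sup>2))
      \<le> normal_density 0 1 1 * (t * (6 - t\<^sup>2) * (1 - t) * (1 / (1 + t)\<^sup>2))"
      using nd by (rule mult_left_mono)
    also have "\<dots> \<le> normal_density 0 1 x * (t * (6 - t\<^sup>2) * (1 - t) * (1 / (1 + t)\<^sup>2))"
      using 1 k normal_density_0_antimono[of x 1] by (intro mult_right_mono) auto
    also have "\<dots> = - (normal_density 0 1 x * (gap l x * (t - 1)))"
    proof -
      have "n * (y * (1 - t) * (1 / d)) = - (n * (y / d * (t - 1)))" for n y d :: real
        by (simp add: divide_inverse algebra_simps)
      then show ?thesis unfolding a .
    qed
    finally show ?thesis unfolding pw using 1 by (simp add: t_def abs_le_iff)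
  next
    case 2
    have t1: "1 < t" using 2(1) abs_square_le_1[of x] unfolding t_def by linarith
    have "gap l x * (t - 1) \<le> 14 / 25"
    proof (cases "0 \<le> gap l x")
      case False
      then show ?thesis using t1 mult_nonpos_nonneg[of "gap l x" "t - 1"] by simp
    next
      case True
      show ?thesis
      proof (cases "t \<le> l")
        case tl: True
        have a: "gap l x = t * (6 - t\<^sup>2) / (1 + t)\<^sup>2" using gap_inner[of x l] tl by (simp add: t_def)
        then have t6: "0 \<le> 6 - t\<^sup>2"
          using True t1 by (simp add: zero_le_divide_iff zero_le_mult_iff)
        have "0 \<le> (1 - t)\<^sup>2" by simp
        then have "t / (1 + t)\<^sup>2 \<le> 1 / 4" using t1 by (simp add: pos_divide_le_eq power2_eq_square algebra_simps)
        then have "t / (1 + t)\<^sup>2 * ((6 - t\<^sup>2) * (t - 1)) \<le> 1 / 4 * ((6 - t\<^sup>2) * (t - 1))"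
          using t6 t1 by (intro mult_right_mono) auto
        moreover have "(6 - t\<^sup>2) * (t - 1) \<le> 56 / 25"
        proof -
          have "t \<le> 3" using t6 power2_le_imp_le[of t 3] by simp
          moreover have "0 \<le> (t - 25 / 14)\<^sup>2 * (t + 18 / 7)" using t1 by simp
          moreover have "56 / 25 - (6 - t\<^sup>2) * (t - 1)
              = (t - 25 / 14)\<^sup>2 * (t + 18 / 7) + (56 / 25 + 6 - 5625 / 686 - t / 196)"
            by (simp add: power2_eq_square field_simps)
          ultimately show ?thesis by linarith
        qed
        moreover have "gap l x * (t - 1) = t / (1 + t)\<^sup>2 * ((6 - t\<^sup>2) * (t - 1))" by (simp add: a)
        ultimately show ?thesis by linarith
      next
        case False
        then show ?thesis using gap_outer_nonpos[OF l, of x] t1 mult_nonpos_nonneg[of "gap l x" "t - 1"] by (simp add: t_def)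
      qed
    qed
    moreover have "normal_density 0 1 x \<le> normal_density 0 1 1" using 2 normal_density_0_antimono[of 1 x] by simp
    ultimately have "normal_density 0 1 x * (gap l x * (t - 1)) \<le> normal_density 0 1 1 * (14 / 25)"
    proof -
      assume a: "gap l x * (t - 1) \<le> 14 / 25" "normal_density 0 1 x \<le> normal_density 0 1 1"
      have "normal_density 0 1 x * (gap l x * (t - 1)) \<le> normal_density 0 1 x * (14 / 25)"
        using a(1) by (rule mult_left_mono) simp
      also have "\<dots> \<le> normal_density 0 1 1 * (14 / 25)" using a(2) by simp
      finally show ?thesis .
    qed
    then show ?thesis using 2 by (auto simp: t_def abs_le_iff indicator_def)
  next
    case 3
    then have "(8 / 5) * (8 / 5) \<le> \<bar>x\<bar> * \<bar>x\<bar>" by (intro mult_mono) auto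
    then have t: "64 / 25 \<le> t" by (simp add: t_def power2_eq_square)
    then have "(64 / 25) * (64 / 25) \<le> t * t" by (intro mult_mono) auto
    then have "6 \<le> t\<^sup>2" by (simp add: power2_eq_square)
    then have "gap l x \<le> 0" using gap_inner_sign(1)[of x l] gap_outer_nonpos[OF l, of x] by (cases "t \<le> l") (auto simp: t_def)
    then have "normal_density 0 1 x * (gap l x * (t - 1)) \<le> 0" using t by (intro mult_nonneg_nonpos mult_nonpos_nonneg) auto
    moreover have "x \<notin> {- (8 / 5)..8 / 5}" "x \<notin> {- 1..1}" using 3 by (auto simp: abs_le_iff)
    ultimately show ?thesis by (simp only: t_def indicator_simps) simp
  qed
qed

text \<open>The integral is the second derivative in \<open>h\<close>, at \<open>0\<close>, of
  \<open>gauss_mean h (gap l)\<close>. If the sign change is at \<open>c \<le> 1\<close>, then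
  \<open>x^2 - 1\<close> may be replaced by the constant \<open>c - 1\<close> and the nonnegative
  mean of \<open>gap l\<close> gives the sign. For larger thresholds a piecewise polynomial majorant
  is integrated exactly.\<close>

lemma gap_curvature_nonpos:
  assumes l: "0 < l"
  shows "gauss_mean 0 (\<lambda>x. gap l x * (x\<^sup>2 - 1)) \<le> 0"
proof (cases "1 \<le> l")
  case True
  define P where "P x = 14 / 25 + (6 * x\<^sup>2 - 18 * x ^ 4 + 37 / 2 * x ^ 6 - 9 / 2 * x ^ 8 - 13 / 4 * x ^ 10 + 5 / 4 * x ^ 12)" for x :: real
  \<comment> \<open>An odd antiderivative of \<open>P\<close>. The final comparison is close:
    \<open>16 / 5 * (14 / 25) = 1.792\<close> against \<open>2 * Q 1\<close>, about
    \<open>1.807\<close>.\<close>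
  define Q where "Q x = 14 / 25 * x + (2 * x ^ 3 - 18 / 5 * x ^ 5 + 37 / 14 * x ^ 7 - 1 / 2 * x ^ 9 - 13 / 44 * x ^ 11 + 5 / 52 * x ^ 13)" for x :: real
  have cP: "continuous_on A P" for A unfolding P_def[abs_def] by (intro continuous_intros)
  have dQ: "(Q has_real_derivative P x) (at x within {- 1..1})" for x
    unfolding Q_def[abs_def] P_def by (auto intro!: derivative_eq_intros)
  have "has_bochner_integral lborel (\<lambda>x. indicator {- 1..1} x *\<^sub>R P x) (Q 1 - Q (- 1))"
    using dQ cP by (intro has_bochner_integral_FTC_Icc)
      (auto simp: has_real_derivative_iff_has_vector_derivative[symmetric])
  then have i1: "has_bochner_integral lborel (\<lambda>x. indicator {- 1..1} x * P x) (Q 1 - Q (- 1))" by simp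
  have i2: "has_bochner_integral lborel (\<lambda>x :: real. indicator {- (8 / 5)..8 / 5} x * (14 / 25)) (16 / 5 * (14 / 25) :: real)"
    using has_bochner_integral_mult_left[OF has_bochner_integral_real_indicator[of "{- (8 / 5)..8 / 5 :: real}" lborel], of "14 / 25"] by simp
  have i3: "has_bochner_integral lborel (\<lambda>x. normal_density 0 1 1 * (indicator {- (8 / 5)..8 / 5} x * (14 / 25) - indicator {- 1..1} x * P x))
    (normal_density 0 1 1 * (16 / 5 * (14 / 25) - (Q 1 - Q (- 1))))"
    by (intro has_bochner_integral_mult_right has_bochner_integral_diff i1 i2)
  have "gauss_mean 0 (\<lambda>x. gap l x * (x\<^sup>2 - 1)) \<le> normal_density 0 1 1 * (16 / 5 * (14 / 25) - (Q 1 - Q (- 1)))"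
    unfolding has_bochner_integral_integral_eq[OF i3, symmetric]
    using gap_majorant[OF True] gap_curvature_integrable[of l 0] l
    by (intro integral_mono integrable.intros[OF i3]) (auto simp: P_def)
  also have "\<dots> \<le> 0" by (intro mult_nonneg_nonpos) (auto simp: Q_def)
  finally show ?thesis .
next
  case False
  obtain c where c: "c \<le> 1" "\<And>x. x\<^sup>2 \<le> c \<Longrightarrow> 0 \<le> gap l x" "\<And>x. c < x\<^sup>2 \<Longrightarrow> gap l x \<le> 0"
    using False by (auto intro: gap_crossing[OF l])
  have "gauss_mean 0 (\<lambda>x. gap l x * (x\<^sup>2 - 1)) \<le> gauss_mean 0 (\<lambda>x. gap l x * (c - 1))"
  proof (rule integral_mono)
    show "integrable lborel (\<lambda>x. normal_density 0 1 x * (gap l x * (x\<^sup>2 - 1)))"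
      using gap_curvature_integrable[of l 0] l by simp
    show "integrable lborel (\<lambda>x. normal_density 0 1 x * (gap l x * (c - 1)))"
      using gauss_gap_integrable[of l 0] l by (simp flip: mult.assoc)
    show "normal_density 0 1 x * (gap l x * (x\<^sup>2 - 1)) \<le> normal_density 0 1 x * (gap l x * (c - 1))" for x
    proof -
      have "gap l x * (x\<^sup>2 - 1) \<le> gap l x * (c - 1)"
      proof (cases "x\<^sup>2 \<le> c")
        case True
        then show ?thesis using c(2)[OF True] by (intro mult_left_mono) auto
      next
        case False
        then show ?thesis using c(3)[of x] by (intro mult_left_mono_neg) auto
      qed
      then show ?thesis by (rule mult_left_mono) simp
    qed
  qed
  also have "\<dots> = gauss_mean 0 (gap l) * (c - 1)" by (simp flip: mult.assoc)
  also have "\<dots> \<le> 0" using gap_mean_nonneg[of l] c l by (intro mult_nonneg_nonpos) auto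
  finally show ?thesis .
qed

text \<open>
  \<open>gap l\<close> changes sign once, at \<open>x\<^sup>2 = c\<close>, and \<open>(cosh (hx) - 1) / x\<^sup>2\<close> is increasing in \<open>\<bar>x\<bar>\<close>. Hence \<open>cosh (hx)\<close>
  may be replaced by the function \<open>1 + D x\<^sup>2 / c\<close> that agrees with it at the sign change.
\<close>

lemma gap_mean_max_at_0:
  assumes l: "0 < l"
  shows "gauss_mean h (gap l) \<le> gauss_mean 0 (gap l)"
proof -
  obtain c where c: "0 < c" "c \<le> 3" "\<And>x. x\<^sup>2 \<le> c \<Longrightarrow> 0 \<le> gap l x" "\<And>x. c < x\<^sup>2 \<Longrightarrow> gap l x \<le> 0"
    by (rule gap_crossing[OF l]) blast
  define e where "e = exp (- (h\<^sup>2 / 2))"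
  define D where "D = cosh (h * sqrt c) - 1"
  have D: "0 \<le> D" using cosh_real_ge_1[of "h * sqrt c"] by (simp add: D_def)
  have e: "0 < e" by (simp add: e_def)
  have s: "\<bar>h * sqrt c\<bar> = \<bar>h\<bar> * sqrt c" "(\<bar>h\<bar> * sqrt c)\<^sup>2 = h\<^sup>2 * c" using c by (auto simp: abs_mult power_mult_distrib)
  have ch: "cosh (\<bar>h\<bar> * \<bar>x\<bar>) = cosh (h * x)" for x by (metis abs_mult cosh_real_abs)
  have D': "cosh (\<bar>h\<bar> * sqrt c) - 1 = D" using ch[of "sqrt c"] c by (simp add: D_def)
  have chord: "(cosh (h * x) - 1) * c \<le> D * x\<^sup>2" if "x\<^sup>2 \<le> c" for x
  proof (cases "h = 0")
    case False
    have "\<bar>x\<bar> \<le> sqrt c" using that by (intro real_le_rsqrt) simp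
    then have "(cosh (\<bar>h\<bar> * \<bar>x\<bar>) - 1) * (\<bar>h\<bar> * sqrt c)\<^sup>2 \<le> (cosh (\<bar>h\<bar> * sqrt c) - 1) * (\<bar>h\<bar> * \<bar>x\<bar>)\<^sup>2"
      by (intro cosh_minus_1_mono mult_left_mono) auto
    then have "h\<^sup>2 * ((cosh (h * x) - 1) * c) \<le> h\<^sup>2 * (D * x\<^sup>2)"
      unfolding ch D' s by (simp add: power_mult_distrib mult_ac)
    then show ?thesis using False by simp
  qed (simp add: D_def)
  have chord': "D * x\<^sup>2 \<le> (cosh (h * x) - 1) * c" if "c < x\<^sup>2" for x
  proof (cases "h = 0")
    case False
    have "sqrt c \<le> \<bar>x\<bar>" using that by (intro real_le_lsqrt) (use c in auto)
    then have "(cosh (\<bar>h\<bar> * sqrt c) - 1) * (\<bar>h\<bar> * \<bar>x\<bar>)\<^sup>2 \<le> (cosh (\<bar>h\<bar> * \<bar>x\<bar>) - 1) * (\<bar>h\<bar> * sqrt c)\<^sup>2"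
      using c by (intro cosh_minus_1_mono mult_left_mono) auto
    then have "h\<^sup>2 * (D * x\<^sup>2) \<le> h\<^sup>2 * ((cosh (h * x) - 1) * c)"
      unfolding ch D' s by (simp add: power_mult_distrib mult_ac)
    then show ?thesis using False by simp
  qed (simp add: D_def)
  have i: "integrable lborel (\<lambda>x. normal_density h 1 x * gap l x)" for h using gauss_gap_integrable l by simp
  have i1: "integrable lborel (\<lambda>x. normal_density 0 1 x * gap l x)"
    and i2: "integrable lborel (\<lambda>x. normal_density 0 1 x * (gap l x * (x\<^sup>2 - 1)))"
    using i gap_curvature_integrable[of l 0] l by auto
  \<comment> \<open>Writing \<open>x^2 = 1 + (x^2 - 1)\<close> separates a multiple of the mean at
    \<open>0\<close>, whose coefficient \<open>e * (1 + D / c)\<close> is at most \<open>1\<close>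
    by the chord bound, from a nonnegative multiple of the curvature.\<close>
  have eq: "normal_density 0 1 x * (gap l x * (e * (1 + D * x\<^sup>2 / c)))
      = e * (1 + D / c) * (normal_density 0 1 x * gap l x) + e * D / c * (normal_density 0 1 x * (gap l x * (x\<^sup>2 - 1)))" for x
    using c by (simp add: field_simps)
  have "gauss_mean h (gap l) = gauss_mean 0 (\<lambda>x. e * cosh (h * x) * gap l x)"
    unfolding e_def by (rule gauss_mean_even(1)[OF i]) simp
  also have "\<dots> \<le> gauss_mean 0 (\<lambda>x. gap l x * (e * (1 + D * x\<^sup>2 / c)))"
  proof (intro integral_mono mult_left_mono)
    show "integrable lborel (\<lambda>x. normal_density 0 1 x * (e * cosh (h * x) * gap l x))"
      unfolding e_def by (rule gauss_mean_even(2)[OF i]) simp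
    show "integrable lborel (\<lambda>x. normal_density 0 1 x * (gap l x * (e * (1 + D * x\<^sup>2 / c))))"
      unfolding eq using i1 i2 by simp
    show "e * cosh (h * x) * gap l x \<le> gap l x * (e * (1 + D * x\<^sup>2 / c))" for x
    proof (cases "x\<^sup>2 \<le> c")
      case True
      have "cosh (h * x) \<le> 1 + D * x\<^sup>2 / c" using chord[OF True] c by (simp add: field_simps)
      then have "gap l x * (e * cosh (h * x)) \<le> gap l x * (e * (1 + D * x\<^sup>2 / c))"
        using e c(3)[OF True] by (intro mult_left_mono) auto
      then show ?thesis by (simp add: mult.commute)
    next
      case False
      have "1 + D * x\<^sup>2 / c \<le> cosh (h * x)" using chord'[of x] False c by (simp add: field_simps)
      then have "gap l x * (e * cosh (h * x)) \<le> gap l x * (e * (1 + D * x\<^sup>2 / c))"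
        using e c(4)[of x] False by (intro mult_left_mono_neg mult_left_mono) auto
      then show ?thesis by (simp add: mult.commute)
    qed
  qed simp
  also have "\<dots> = e * (1 + D / c) * gauss_mean 0 (gap l) + e * D / c * gauss_mean 0 (\<lambda>x. gap l x * (x\<^sup>2 - 1))"
    unfolding eq using i1 i2 by simp
  also have "\<dots> \<le> 1 * gauss_mean 0 (gap l) + 0"
  proof (intro add_mono mult_right_mono)
    have "1 + D / c \<le> exp (h\<^sup>2 / 2)"
      using cosh_chord_bound[of c h] c by (simp add: D_def field_simps)
    then have "e * (1 + D / c) \<le> e * exp (h\<^sup>2 / 2)" using e by simp
    also have "\<dots> = 1" by (simp add: e_def exp_minus)
    finally show "e * (1 + D / c) \<le> 1" .
    show "e * D / c * gauss_mean 0 (\<lambda>x. gap l x * (x\<^sup>2 - 1)) \<le> 0"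
      using gap_curvature_nonpos[OF l] e D c by (intro mult_nonneg_nonpos) auto
  qed (use gap_mean_nonneg[of l] l in auto)
  finally show ?thesis by simp
qed

section \<open>The loss exceeds the gain\<close>

lemma gap_mean_uminus: "gauss_mean (- h) (gap l) = gauss_mean h (gap l)"
  using gauss_mean_reflect[of h "gap l"] by simp

section \<open>Continuity, decay and attained minimum of the mean risk difference\<close>

lemma gauss_mean_shift: "gauss_mean h F = (\<integral>z. normal_density 0 1 z * F (h + z) \<partial>lborel)"
  by (subst lborel_integral_real_affine[where c = 1 and t = h]) (auto simp: normal_density_def)

lemma gauss_integrable_shift:
  "integrable lborel (\<lambda>x. normal_density h 1 x * F x) \<longleftrightarrow> integrable lborel (\<lambda>z. normal_density 0 1 z * F (h + z))"
  using lborel_integrable_real_affine_iff[of 1 "\<lambda>x. normal_density h 1 x * F x" h] by (simp add: normal_density_def)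

lemma isCont_gap:
  assumes "0 < l" "x\<^sup>2 \<noteq> l" shows "isCont (gap l) x"
proof -
  have s: "isCont (sure 0) x"
    unfolding sure_0[abs_def] using one_plus_square_pos[of x] by (intro continuous_intros) auto
  have w: "isCont (weight l) x"
    using continuous_weight[of UNIV l] by (simp add: continuous_on_eq_continuous_at)
  have "isCont (sure l) x"
  proof (cases "l < x\<^sup>2")
    case True
    have "isCont (\<lambda>x. 2 * weight l x - x\<^sup>2 * (weight l x)\<^sup>2 - 4 * x\<^sup>2 * (weight l x)\<^sup>2) x"
      by (intro continuous_intros w)
    moreover have "\<forall>\<^sub>F y in nhds x. sure l y = 2 * weight l y - y\<^sup>2 * (weight l y)\<^sup>2 - 4 * y\<^sup>2 * (weight l y)\<^sup>2"
    proof -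
      have "open {y. l < y\<^sup>2}" by (intro open_Collect_less continuous_intros)
      then have "\<forall>\<^sub>F y in nhds x. y \<in> {y. l < y\<^sup>2}" using True by (intro eventually_nhds_in_open) auto
      then show ?thesis by eventually_elim (simp add: sure_def)
    qed
    ultimately show ?thesis by (simp add: isCont_cong)
  next
    case False
    have "isCont (\<lambda>x. 2 * weight l x - x\<^sup>2 * (weight l x)\<^sup>2) x"
      by (intro continuous_intros w)
    moreover have "\<forall>\<^sub>F y in nhds x. sure l y = 2 * weight l y - y\<^sup>2 * (weight l y)\<^sup>2"
    proof -
      have "open {y. y\<^sup>2 < l}" by (intro open_Collect_less continuous_intros)
      then have "\<forall>\<^sub>F y in nhds x. y \<in> {y. y\<^sup>2 < l}" using False assms by (intro eventually_nhds_in_open) auto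
      then show ?thesis by eventually_elim (simp add: sure_def)
    qed
    ultimately show ?thesis by (simp add: isCont_cong)
  qed
  then show ?thesis unfolding gap_def[abs_def] using s by (intro continuous_intros)
qed

text \<open>\<open>gap l\<close> jumps at the threshold. Once the parameter is moved from the
  density into the argument, the values of \<open>z\<close> at which convergence may fail form a
  finite, hence null, set, and dominated convergence applies.\<close>

lemma gap_mean_tendsto:
  assumes l: "0 < l" and g: "\<And>z. z \<notin> Z \<Longrightarrow> (\<lambda>n. gap l (X n + z)) \<longlonglongrightarrow> g z" and Z: "finite Z"
    and [measurable]: "g \<in> borel_measurable borel"
  shows "(\<lambda>n. gauss_mean (X n) (gap l)) \<longlonglongrightarrow> gauss_mean 0 g"
  unfolding gauss_mean_shift[of _ "gap l"]
proof (rule integral_dominated_convergence[where w = "\<lambda>z. normal_density 0 1 z * (14 + 5 * l)"])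
  show "AE z in lborel. (\<lambda>n. normal_density 0 1 z * gap l (X n + z)) \<longlonglongrightarrow> normal_density 0 1 z * g z"
  proof (rule AE_I')
    show "Z \<in> null_sets lborel" using Z by (rule finite_imp_null_set_lborel)
    show "{z \<in> space lborel. \<not> (\<lambda>n. normal_density 0 1 z * gap l (X n + z)) \<longlonglongrightarrow> normal_density 0 1 z * g z} \<subseteq> Z"
      using g by (auto intro: tendsto_mult_left)
  qed
  show "AE z in lborel. norm (normal_density 0 1 z * gap l (X n + z)) \<le> normal_density 0 1 z * (14 + 5 * l)" for n
    using gap_bound[of l] l by (auto simp: abs_mult intro!: mult_left_mono)
qed auto

lemma continuous_gap_mean:
  assumes l: "0 < l" shows "isCont (\<lambda>h. gauss_mean h (gap l)) h"
  unfolding continuous_at_sequentially comp_def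
proof (intro allI impI)
  fix X assume X: "X \<longlonglongrightarrow> h"
  have "(\<lambda>n. gauss_mean (X n) (gap l)) \<longlonglongrightarrow> gauss_mean 0 (\<lambda>z. gap l (h + z))"
  proof (rule gap_mean_tendsto[OF l, of "{sqrt l - h, - sqrt l - h}"])
    fix z assume "z \<notin> {sqrt l - h, - sqrt l - h}"
    then have "(h + z)\<^sup>2 \<noteq> l" by (auto simp: real_sqrt_abs abs_if split: if_splits)
    then show "(\<lambda>n. gap l (X n + z)) \<longlonglongrightarrow> gap l (h + z)"
      using isCont_gap[OF l] X by (intro isCont_tendsto_compose[where g = "gap l"] tendsto_intros)
  qed auto
  then show "(\<lambda>n. gauss_mean (X n) (gap l)) \<longlonglongrightarrow> gauss_mean h (gap l)"
    by (simp add: gauss_mean_shift[of h])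
qed

lemma gap_at_top:
  assumes l: "0 < l" shows "(gap l \<longlongrightarrow> 0) at_top"
proof (rule Lim_transform_eventually)
  show "((\<lambda>x. l * (2 - 2 * l - (6 - 3 * l) * x\<^sup>2 - 8 * (x\<^sup>2)\<^sup>2) / ((1 + x\<^sup>2)\<^sup>2 * (1 + x\<^sup>2 - l)\<^sup>2)) \<longlongrightarrow> 0) at_top"
    by real_asymp
  have "\<forall>\<^sub>F x in at_top. l < x\<^sup>2" by real_asymp
  then show "\<forall>\<^sub>F x in at_top. l * (2 - 2 * l - (6 - 3 * l) * x\<^sup>2 - 8 * (x\<^sup>2)\<^sup>2) / ((1 + x\<^sup>2)\<^sup>2 * (1 + x\<^sup>2 - l)\<^sup>2) = gap l x"
    by eventually_elim (use l in \<open>simp add: gap_outer\<close>)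
qed

lemma gap_mean_at_top:
  assumes l: "0 < l" shows "((\<lambda>h. gauss_mean h (gap l)) \<longlongrightarrow> 0) at_top"
proof (rule tendsto_at_topI_sequentially)
  fix X :: "nat \<Rightarrow> real" assume X: "filterlim X at_top sequentially"
  have "(\<lambda>n. gauss_mean (X n) (gap l)) \<longlonglongrightarrow> gauss_mean 0 (\<lambda>z. 0)"
  proof (rule gap_mean_tendsto[OF l, of "{}"])
    fix z
    have "filterlim (\<lambda>n. X n + z) at_top sequentially"
      using filterlim_tendsto_add_at_top[OF tendsto_const X, of z] by (simp add: add.commute)
    then show "(\<lambda>n. gap l (X n + z)) \<longlonglongrightarrow> 0" by (rule filterlim_compose[OF gap_at_top[OF l]])
  qed auto
  then show "(\<lambda>n. gauss_mean (X n) (gap l)) \<longlonglongrightarrow> 0" by simp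
qed

text \<open>The negative value at \<open>h0\<close> stays below all values far out, which tend to 0
  in both directions by evenness; so a minimum over a compact interval around \<open>h0\<close> is
  global.\<close>

lemma gap_mean_min_attained:
  assumes l: "0 < l" and neg: "gauss_mean h0 (gap l) < 0"
  obtains h1 where "\<And>h. gauss_mean h1 (gap l) \<le> gauss_mean h (gap l)"
proof -
  let ?f = "\<lambda>h. gauss_mean h (gap l)"
  have "\<forall>\<^sub>F h in at_top. ?f h0 < ?f h"
    using gap_mean_at_top[OF l] neg by (rule order_tendstoD)
  then obtain R where R: "\<And>h. R \<le> h \<Longrightarrow> ?f h0 < ?f h" by (auto simp: eventually_at_top_linorder)
  have R': "?f h0 < ?f h" if "R \<le> \<bar>h\<bar>" for h
    using R[OF that] gap_mean_uminus[of h l] by (auto simp: abs_if split: if_splits)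
  define B where "B = max \<bar>h0\<bar> \<bar>R\<bar>"
  have "\<exists>x\<in>{- B..B}. \<forall>y\<in>{- B..B}. ?f x \<le> ?f y"
  proof (rule continuous_attains_inf)
    show "{- B..B} \<noteq> {}" by (auto simp: B_def)
    show "continuous_on {- B..B} ?f"
      using continuous_gap_mean[OF l] by (intro continuous_at_imp_continuous_on) auto
  qed simp
  then obtain x where x: "\<And>y. y \<in> {- B..B} \<Longrightarrow> ?f x \<le> ?f y" by blast
  have "?f x \<le> ?f h" for h
  proof (cases "h \<in> {- B..B}")
    case False
    then have "R \<le> \<bar>h\<bar>" by (auto simp: B_def)
    moreover have "h0 \<in> {- B..B}" by (auto simp: B_def)
    ultimately show ?thesis using x[of h0] R'[of h] by simp
  qed (rule x)
  then show ?thesis using that by blast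
qed

lemma normal_density_half: "1 / 2 \<le> (\<integral>x. normal_density h 1 x * indicator {..h} x \<partial>lborel)"
proof -
  let ?I = "\<integral>x. normal_density h 1 x * indicator {..h} x \<partial>lborel"
  have i: "integrable lborel (\<lambda>x. normal_density h 1 x * indicator A x)" if "A \<in> sets borel" for A :: "real set"
    using that by (intro gauss_integrable_bounded[of _ 1]) (auto simp: indicator_def)
  have "?I = (\<integral>x. normal_density h 1 (2 * h + -1 * x) * indicator {..h} (2 * h + -1 * x) \<partial>lborel)"
    by (subst lborel_integral_real_affine[where c = "-1" and t = "2 * h"]) auto
  also have "\<dots> = (\<integral>x. normal_density h 1 x * indicator {h..} x \<partial>lborel)"
    by (intro Bochner_Integration.integral_cong)
      (auto simp: normal_density_def indicator_def power2_eq_square algebra_simps)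
  finally have "2 * ?I = (\<integral>x. normal_density h 1 x * indicator {..h} x + normal_density h 1 x * indicator {h..} x \<partial>lborel)"
    using i by simp
  also have "\<dots> \<ge> (\<integral>x. normal_density h 1 x \<partial>lborel)"
  proof (rule integral_mono)
    show "integrable lborel (\<lambda>x. normal_density h 1 x * indicator {..h} x + normal_density h 1 x * indicator {h..} x)"
      using i by simp
  qed (auto simp: indicator_def)
  finally show ?thesis by simp
qed

text \<open>
  At \<open>h = \<surd>l\<close> the thresholded rule estimates \<open>h\<close> by a nonpositive number with probability at least \<open>1/2\<close>,
  which costs \<open>l/2\<close>. This beats \<open>29/20 + 3/4 = 11/5\<close>, the sum of the bounds for the two risks of the
  rule without threshold, as soon as \<open>l > 22/5\<close>.
\<close>

lemma gap_mean_large: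
  assumes l: "22 / 5 < l"
  shows "gauss_mean (sqrt l) (gap l) + gauss_mean 0 (gap l) < 0"
proof -
  define h where "h = sqrt l"
  have h: "0 < h" "h\<^sup>2 = l" using l by (auto simp: h_def)
  have "l * (1 / 2) \<le> l * (\<integral>x. normal_density h 1 x * indicator {..h} x \<partial>lborel)"
    using l normal_density_half by (intro mult_left_mono) auto
  also have "\<dots> = (\<integral>x. normal_density h 1 x * (l * indicator {..h} x) \<partial>lborel)"
    by (simp add: mult_ac)
  also have "\<dots> \<le> risk l h"
    unfolding risk_def
  proof (intro integral_mono mult_left_mono)
    show "integrable lborel (\<lambda>x. normal_density h 1 x * (l * indicator {..h} x))"
      using l by (intro gauss_integrable_bounded[of _ l]) (auto simp: indicator_def)
    show "integrable lborel (\<lambda>x. normal_density h 1 x * (h - shrink l x)\<^sup>2)" by (rule risk_integrable)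
    show "l * indicator {..h} x \<le> (h - shrink l x)\<^sup>2" for x
    proof (cases "x \<le> h")
      case True
      have "shrink l x \<le> 0"
      proof (cases "x\<^sup>2 \<le> l")
        case False
        then have "\<not> 0 \<le> x" using True h power_mono[of x h 2] by auto
        then show ?thesis using weight_le_1[of l x] by (simp add: shrink_def mult_nonpos_nonneg)
      qed (simp add: shrink_def weight_def)
      then have "h\<^sup>2 \<le> (h - shrink l x)\<^sup>2" using h by (intro power_mono) auto
      then show ?thesis using h True by simp
    qed simp
  qed simp
  finally have 1: "l / 2 \<le> risk l h" by simp
  have 2: "risk 0 h \<le> 29 / 20"
  proof -
    have i: "integrable lborel (\<lambda>x. normal_density h 1 x * sure 0 x)"
      using sure_bound[of 0] by (intro gauss_integrable_bounded) auto
    have "(\<integral>x. normal_density h 1 x * - (9 / 20) \<partial>lborel) \<le> gauss_mean h (sure 0)"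
    proof (intro integral_mono i mult_left_mono)
      fix x :: real
      \<comment> \<open>\<open>sure 0\<close> has its minimum \<open>- 9 / 20\<close> at
        \<open>x^2 = 7 / 3\<close>.\<close>
      have "0 \<le> (3 * x\<^sup>2 - 7)\<^sup>2" by simp
      then have "- (9 / 20) * (1 + x\<^sup>2)\<^sup>2 \<le> 2 - 3 * x\<^sup>2" by (simp add: power2_eq_square algebra_simps)
      then show "- (9 / 20) \<le> sure 0 x"
        unfolding sure_0 using one_plus_square_pos[of x] by (simp add: pos_le_divide_eq)
    qed auto
    then show ?thesis by (simp add: risk_eq)
  qed
  have 3: "risk 0 0 \<le> 3 / 4"
  proof -
    \<comment> \<open>The fourth moment \<open>3\<close>, times the maximum \<open>1 / 4\<close> of
      \<open>x^2 / (1 + x^2)^2\<close>, gives the bound.\<close>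
    have m: "has_bochner_integral lborel (\<lambda>x. normal_density 0 1 x * x ^ 4) 3"
      using normal_moment_even[of 1 0 2] by (simp add: numeral_eq_Suc)
    have "risk 0 0 \<le> (\<integral>x. 1 / 4 * (normal_density 0 1 x * x ^ 4) \<partial>lborel)"
      unfolding risk_def
    proof (rule integral_mono)
      show "integrable lborel (\<lambda>x. normal_density 0 1 x * (0 - shrink 0 x)\<^sup>2)"
        using shrink_integrable[of 0 0] by simp
      show "integrable lborel (\<lambda>x. 1 / 4 * (normal_density 0 1 x * x ^ 4))"
        using integrable.intros[OF m] by simp
      fix x :: real
      have "1 - weight 0 x = x\<^sup>2 / (1 + x\<^sup>2)" using one_plus_square_pos[of x] by (simp add: weight_0 field_simps)
      then have "(0 - shrink 0 x)\<^sup>2 = x\<^sup>2 * (x\<^sup>2 / (1 + x\<^sup>2))\<^sup>2"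
        by (simp only: shrink_def diff_0 power2_minus power_mult_distrib)
      also have "\<dots> = x ^ 4 * (x\<^sup>2 / (1 + x\<^sup>2)\<^sup>2)" by (simp add: power_divide)
      also have "\<dots> \<le> x ^ 4 * (1 / 4)"
      proof (intro mult_left_mono)
        have "0 \<le> (1 - x\<^sup>2)\<^sup>2" by simp
        then have "x\<^sup>2 \<le> 1 / 4 * (1 + x\<^sup>2)\<^sup>2"
          by (simp add: power2_eq_square[of "1 + x\<^sup>2"] power2_eq_square[of "1 - x\<^sup>2"] algebra_simps)
        then show "x\<^sup>2 / (1 + x\<^sup>2)\<^sup>2 \<le> 1 / 4"
          using one_plus_square_pos[of x] by (subst pos_divide_le_eq) auto
      qed simp
      finally have "normal_density 0 1 x * (0 - shrink 0 x)\<^sup>2 \<le> normal_density 0 1 x * (x ^ 4 * (1 / 4))"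
        by (rule mult_left_mono) simp
      then show "normal_density 0 1 x * (0 - shrink 0 x)\<^sup>2 \<le> 1 / 4 * (normal_density 0 1 x * x ^ 4)" by simp
    qed
    also have "\<dots> = 3 / 4" using has_bochner_integral_integral_eq[OF m] by simp
    finally show ?thesis .
  qed
  have 4: "0 \<le> risk l 0" unfolding risk_def by (intro integral_nonneg_AE) auto
  show ?thesis
    using 1 2 3 4 l risk_diff[of l h] risk_diff[of l 0] by (simp add: h_def)
qed

text \<open>The means at \<open>2\<close> and \<open>- 2\<close> coincide. Keeping both makes the
  mixing measure symmetric and \<open>gain_density\<close> even, so the bounds on the half line
  extend to the whole line with a factor two.\<close>

lemma gap_mean_moderate:
  assumes l: "0 < l" "l \<le> 22 / 5"
  shows "(gauss_mean 2 (gap l) + gauss_mean (- 2) (gap l)) / 2 + gauss_mean 0 (gap l) < 0"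
proof -
  define c where "c = 1 / sqrt (2 * pi)"
  have c: "0 < c" by (simp add: c_def)
  define d where "d h x = normal_density h 1 x * (h - shrink l x)\<^sup>2 - normal_density h 1 x * (h - shrink 0 x)\<^sup>2" for h x
  have id: "integrable lborel (d h)" for h unfolding d_def using risk_integrable by simp
  have gd: "gauss_mean h (gap l) = - (\<integral>x. d h x \<partial>lborel)" for h
    using risk_diff[of l h] l risk_integrable[of h 0] risk_integrable[of h l] unfolding d_def risk_def by simp
  have eq: "(d 2 x + d (- 2) x) / 2 + d 0 x = c * gain_density l x" for x
  proof -
    define r where "r = excess l x"
    define q where "q = weight 0 x"
    have A: "1 + x\<^sup>2 \<noteq> 0" "q = 1 / (1 + x\<^sup>2)" using one_plus_square_pos[of x] by (auto simp: q_def weight_0)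
    have w: "weight l x = q + r" by (simp add: r_def q_def excess_def)
    have d: "d h x = normal_density h 1 x * ((x * r) * (2 * (h - x) + x * (2 * q + r)))" for h
      by (simp add: d_def shrink_def w q_def[symmetric] power2_eq_square algebra_simps)
    have n: "normal_density h 1 x = c * exp (- ((x - h)\<^sup>2 / 2))" for h
      by (simp add: normal_density_def c_def)
    have "(d 2 x + d (- 2) x) / 2 + d 0 x = c * ((x * r) * (2 * mixture' x + x * (2 * q + r) * mixture x))"
      unfolding d n mixture_def mixture'_def by (simp add: field_simps)
    also have "(x * r) * (2 * mixture' x + x * (2 * q + r) * mixture x) = gain_density l x"
      unfolding gain_density_def mixture_slope_def r_def[symmetric] A(2) using A(1)
      by (simp add: field_simps power2_eq_square)
    finally show ?thesis .
  qed
  have ig: "integrable lborel (gain_density l)"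
  proof -
    have "integrable lborel (\<lambda>x. (1 / c) * ((d 2 x + d (- 2) x) / 2 + d 0 x))" using id by simp
    then show ?thesis unfolding eq using c by simp
  qed
  have even: "gain_density l (- x) = gain_density l x" for x
  proof -
    have "mixture (- x) = mixture x" by (simp add: mixture_def power2_eq_square algebra_simps)
    moreover have "mixture' (- x) = - mixture' x"
    proof -
      have "(- x - 2)\<^sup>2 = (x + 2)\<^sup>2" "(- x + 2)\<^sup>2 = (x - 2)\<^sup>2" by (simp_all add: power2_eq_square algebra_simps)
      then show ?thesis by (simp add: mixture'_def field_simps)
    qed
    ultimately show ?thesis by (simp add: gain_density_def mixture_slope_def excess_def algebra_simps)
  qed
  obtain e where e: "0 < e" "\<And>B. 4 \<le> B \<Longrightarrow> e \<le> integral {0..B} (gain_density l)"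
    using gain_integral_lower[OF l] by blast
  have "(\<lambda>n. LINT x:{- real n..real n}|lborel. gain_density l x) \<longlonglongrightarrow> (\<integral>x. gain_density l x \<partial>lborel)"
    using ig by (rule set_integral_symmetric_limit)
  moreover have "\<forall>\<^sub>F n in sequentially. 2 * e \<le> (LINT x:{- real n..real n}|lborel. gain_density l x)"
    using eventually_ge_at_top[of 4]
  proof eventually_elim
    case (elim n)
    have "(LINT x:{- real n..real n}|lborel. gain_density l x) = integral {- real n..real n} (gain_density l)"
    proof (rule set_borel_integral_eq_integral(2))
      show "set_integrable lborel {- real n..real n} (gain_density l)"
        using ig unfolding set_integrable_def by (intro integrable_mult_indicator) auto
    qed
    also have "\<dots> = integral {- real n..0} (gain_density l) + integral {0..real n} (gain_density l)"
      by (intro Henstock_Kurzweil_Integration.integral_combine[symmetric] gain_density_integrable) auto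
    also have "integral {- real n..0} (gain_density l) = integral {0..real n} (gain_density l)"
      using Henstock_Kurzweil_Integration.integral_reflect_real[of "real n" 0 "gain_density l"] even by simp
    finally show ?case using e(2)[of "real n"] elim by simp
  qed
  ultimately have "2 * e \<le> (\<integral>x. gain_density l x \<partial>lborel)"
    by (rule tendsto_lowerbound) simp
  moreover have "(gauss_mean 2 (gap l) + gauss_mean (- 2) (gap l)) / 2 + gauss_mean 0 (gap l)
    = - (\<integral>x. c * gain_density l x \<partial>lborel)"
    unfolding gd eq[symmetric] using id by (simp add: add_divide_distrib)
  ultimately show ?thesis using e(1) c by simp
qed

lemma gap_mean_asymmetry:
  assumes l: "0 < l" obtains h where "gauss_mean h (gap l) + gauss_mean 0 (gap l) < 0"
proof (cases "l \<le> 22 / 5")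
  case True
  then show ?thesis using that[of 2] gap_mean_moderate[OF l] gap_mean_uminus[of 2 l] by simp
next
  case False
  then show ?thesis using that[of "sqrt l"] gap_mean_large by simp
qed

theorem risk_asymmetry:
  assumes l: "0 < l"
  obtains h1 where "\<And>h. risk l h - risk 0 h \<le> risk l h1 - risk 0 h1"
    and "\<And>h. risk 0 h - risk l h \<le> risk 0 0 - risk l 0"
    and "risk 0 0 - risk l 0 < risk l h1 - risk 0 h1"
proof -
  obtain h0 where h0: "gauss_mean h0 (gap l) + gauss_mean 0 (gap l) < 0" using gap_mean_asymmetry[OF l] .
  have r: "risk 0 h - risk l h = gauss_mean h (gap l)" for h using risk_diff l by simp
  have "gauss_mean h0 (gap l) < 0" using h0 gap_mean_nonneg[of l] l by simp
  then obtain h1 where h1: "\<And>h. gauss_mean h1 (gap l) \<le> gauss_mean h (gap l)"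
    using gap_mean_min_attained[OF l] by blast
  show ?thesis
  proof (rule that[of h1])
    show "risk l h - risk 0 h \<le> risk l h1 - risk 0 h1" for h using h1[of h] r[of h] r[of h1] by simp
    show "risk 0 h - risk l h \<le> risk 0 0 - risk l 0" for h unfolding r by (rule gap_mean_max_at_0[OF l])
    show "risk 0 0 - risk l 0 < risk l h1 - risk 0 h1" using h1[of h0] h0 r[of 0] r[of h1] by simp
  qed
qed

section \<open>The bivariate normal law\<close>

lemma prod_UNIV_2: "(\<Prod>i\<in>UNIV. f i) = f 1 * f (2 :: 2)" for f :: "2 \<Rightarrow> 'a :: comm_monoid_mult"
  by (simp add: UNIV_2)

lemma std_normal_prod:
  "(\<Prod>i\<in>UNIV. std_normal_density (z $ i)) = 1 / (2 * pi) * exp (- (norm z)\<^sup>2 / 2)" for z :: "real ^ 2"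
proof -
  have "(norm z)\<^sup>2 = (z $ 1)\<^sup>2 + (z $ 2)\<^sup>2" by (simp add: norm_vec_def L2_set_def sum_2)
  moreover have "(c * exp (- a / 2)) * (c * exp (- b / 2)) = c\<^sup>2 * exp (- (a + b) / 2)" for a b c :: real
    by (simp add: exp_add[symmetric] power2_eq_square add_divide_distrib mult_exp_exp)
  moreover have "(1 / sqrt (2 * pi))\<^sup>2 = 1 / (2 * pi)" by (simp add: power_divide)
  ultimately show ?thesis unfolding prod_UNIV_2 std_normal_density_def by metis
qed

lemma sets_std_normal_vector [simp, measurable_cong]: "sets std_normal_vector = sets borel"
  and space_std_normal_vector [simp]: "space std_normal_vector = UNIV"
  by (simp_all add: std_normal_vector_def)

lemma measurable_vec_nth [measurable]: "(\<lambda>z :: real ^ 'n. z $ i) \<in> borel_measurable borel"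
  by (intro borel_measurable_continuous_onI continuous_intros)

lemma measurable_vector_2 [measurable]:
  assumes [measurable]: "f \<in> borel_measurable M" "g \<in> borel_measurable M"
  shows "(\<lambda>x. vector [f x, g x] :: real ^ 2) \<in> borel_measurable M"
proof -
  have "(vector [a, b] :: real ^ 2) = axis 1 a + axis 2 b" for a b :: real
    by (simp add: vec_eq_iff forall_2 axis_def)
  then have "(vector [a, b] :: real ^ 2) = a *\<^sub>R axis 1 1 + b *\<^sub>R axis 2 1" for a b :: real
    by (simp add: vec_eq_iff forall_2 axis_def)
  then show ?thesis by simp
qed

lemma lborel_real2:
  "(lborel :: (real ^ 2) measure) = distr (lborel \<Otimes>\<^sub>M lborel) borel (\<lambda>p. vector [fst p, snd p])"
proof (rule lborel_eqI)
  fix l u :: "real ^ 2"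
  assume le: "\<And>b. b \<in> Basis \<Longrightarrow> l \<bullet> b \<le> u \<bullet> b"
  have le': "l $ 1 \<le> u $ 1" "l $ 2 \<le> u $ 2"
    using le[of "axis 1 1"] le[of "axis 2 1"] by (simp_all add: inner_axis axis_in_Basis_iff)
  have B: "(Basis :: (real ^ 2) set) = {axis 1 1, axis 2 1}" by (auto simp: Basis_vec_def UNIV_2)
  have ne: "axis 1 1 \<noteq> (axis 2 1 :: real ^ 2)" by (simp add: axis_eq_axis)
  have [measurable]: "(\<lambda>p. vector [fst p, snd p] :: real ^ 2) \<in> lborel \<Otimes>\<^sub>M lborel \<rightarrow>\<^sub>M borel"
    by measurable
  have "emeasure (distr (lborel \<Otimes>\<^sub>M lborel) borel (\<lambda>p. vector [fst p, snd p] :: real ^ 2)) (box l u)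
      = emeasure (lborel \<Otimes>\<^sub>M lborel) ((\<lambda>p. vector [fst p, snd p] :: real ^ 2) -` box l u \<inter> space (lborel \<Otimes>\<^sub>M lborel))"
    by (intro emeasure_distr) auto
  also have "(\<lambda>p. vector [fst p, snd p] :: real ^ 2) -` box l u \<inter> space (lborel \<Otimes>\<^sub>M lborel) = {l $ 1<..<u $ 1} \<times> {l $ 2<..<u $ 2}"
    by (auto simp: mem_box_cart forall_2 space_pair_measure)
  also have "emeasure (lborel \<Otimes>\<^sub>M lborel) \<dots> = ennreal (u $ 1 - l $ 1) * ennreal (u $ 2 - l $ 2)"
    using le' by (subst lborel.emeasure_pair_measure_Times) auto
  also have "\<dots> = (\<Prod>b\<in>Basis. (u - l) \<bullet> b)"
    unfolding B using ne le' by (simp add: inner_axis ennreal_mult)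
  finally show "emeasure (distr (lborel \<Otimes>\<^sub>M lborel) borel (\<lambda>p. vector [fst p, snd p] :: real ^ 2)) (box l u) = (\<Prod>b\<in>Basis. (u - l) \<bullet> b)" .
qed simp

abbreviation std_normal :: "real measure" where
  "std_normal \<equiv> density lborel std_normal_density"

lemma std_normal_vector_pair:
  "(std_normal_vector :: (real ^ 2) measure) = distr (std_normal \<Otimes>\<^sub>M std_normal) borel (\<lambda>p. vector [fst p, snd p])"
proof -
  have [measurable]: "(\<lambda>p. vector [fst p, snd p] :: real ^ 2) \<in> lborel \<Otimes>\<^sub>M lborel \<rightarrow>\<^sub>M borel"
    by measurable
  have p: "prob_space std_normal" by (rule prob_space_normal_density) simp
  have "std_normal \<Otimes>\<^sub>M std_normal = density (lborel \<Otimes>\<^sub>M lborel) (\<lambda>(x, y). ennreal (std_normal_density x) * ennreal (std_normal_density y))"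
    using p by (intro pair_measure_density)
      (auto intro: prob_space_imp_sigma_finite lborel.sigma_finite_measure_axioms)
  also have "\<dots> = density (lborel \<Otimes>\<^sub>M lborel) (\<lambda>p. ennreal (\<Prod>i\<in>UNIV. std_normal_density ((vector [fst p, snd p] :: real ^ 2) $ i)))"
    by (intro arg_cong2[where f = density] refl ext) (auto simp: prod_UNIV_2 ennreal_mult case_prod_beta)
  finally show ?thesis
    unfolding std_normal_vector_def lborel_real2 by (subst density_distr) auto
qed

lemma prob_space_std_normal: "prob_space std_normal"
  by (rule prob_space_normal_density) simp

lemma prob_space_std_normal_vector: "prob_space (std_normal_vector :: (real ^ 2) measure)"
proof -
  interpret prob_space std_normal by (rule prob_space_std_normal)
  interpret pair_prob_space std_normal std_normal ..
  show ?thesis unfolding std_normal_vector_pair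
    by (intro prob_space_distr) measurable
qed

lemma distr_std_normal_vector_1: "distr std_normal_vector borel (\<lambda>z :: real ^ 2. z $ 1) = distr std_normal borel (\<lambda>x. x)"
proof -
  interpret prob_space std_normal by (rule prob_space_std_normal)
  have "distr std_normal_vector borel (\<lambda>z :: real ^ 2. z $ 1) = distr (std_normal \<Otimes>\<^sub>M std_normal) borel fst"
    unfolding std_normal_vector_pair by (subst distr_distr) (auto simp: comp_def)
  also have "\<dots> = distr (distr (std_normal \<Otimes>\<^sub>M std_normal) std_normal fst) borel (\<lambda>x. x)"
    by (subst distr_distr) (auto simp: comp_def)
  also have "distr (std_normal \<Otimes>\<^sub>M std_normal) std_normal fst = std_normal" by (rule distr_pair_fst)
  finally show ?thesis .
qed

lemma orthogonal_lborel:
  fixes T :: "real ^ 2 \<Rightarrow> real ^ 2"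
  assumes T: "orthogonal_transformation T"
  shows "distr lborel borel T = lborel"
proof (rule lborel_eqI[symmetric])
  fix l u :: "real ^ 2"
  assume le: "\<And>b. b \<in> Basis \<Longrightarrow> l \<bullet> b \<le> u \<bullet> b"
  have lin: "linear T" using T by (rule orthogonal_transformation_linear)
  have [measurable]: "T \<in> borel_measurable borel"
    using lin by (intro borel_measurable_continuous_onI linear_continuous_on linear_conv_bounded_linear[THEN iffD1])
  have bij: "bij T" using T by (rule orthogonal_transformation_bij)
  have T': "orthogonal_transformation (inv T)" using T by (rule orthogonal_transformation_inv)
  have "emeasure (distr lborel borel T) (box l u) = emeasure lborel (T -` box l u)"
    by (subst emeasure_distr) auto
  also have "T -` box l u = inv T ` box l u" using bij by (rule bij_vimage_eq_inv_image)
  also have "emeasure lborel (inv T ` box l u) = emeasure lebesgue (inv T ` box l u)"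
  proof -
    have "inv T ` box l u = T -` box l u \<inter> space borel" using bij by (simp add: bij_vimage_eq_inv_image)
    also have "\<dots> \<in> sets borel" by (rule measurable_sets[of T borel borel]) auto
    finally show ?thesis by simp
  qed
  also have "\<dots> = ennreal (measure lebesgue (inv T ` box l u))"
    using measurable_orthogonal_image[OF T', of "box l u"] by (intro emeasure_eq_measure2) auto
  also have "measure lebesgue (inv T ` box l u) = measure lebesgue (box l u)"
    by (rule measure_orthogonal_image[OF T']) simp
  also have "ennreal \<dots> = (\<Prod>b\<in>Basis. (u - l) \<bullet> b)" using le by (simp add: measure_lborel_box_eq)
  finally show "emeasure (distr lborel borel T) (box l u) = (\<Prod>b\<in>Basis. (u - l) \<bullet> b)" .
qed simp

text \<open>The density depends on the norm alone, and an orthogonal map preserves both the norm and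
  Lebesgue measure.\<close>

lemma orthogonal_std_normal_vector:
  fixes T :: "real ^ 2 \<Rightarrow> real ^ 2"
  assumes T: "orthogonal_transformation T"
  shows "distr std_normal_vector borel T = std_normal_vector"
proof -
  have lin: "linear T" using T by (rule orthogonal_transformation_linear)
  have [measurable]: "T \<in> borel_measurable borel"
    using lin by (intro borel_measurable_continuous_onI linear_continuous_on linear_conv_bounded_linear[THEN iffD1])
  have n: "norm (T z) = norm z" for z using T by (simp add: orthogonal_transformation_norm)
  have "distr std_normal_vector borel T = distr (density lborel (\<lambda>z. ennreal (\<Prod>i\<in>UNIV. std_normal_density (T z $ i)))) borel T"
    unfolding std_normal_vector_def std_normal_prod n ..
  also have "\<dots> = density (distr lborel borel T) (\<lambda>z. ennreal (\<Prod>i\<in>UNIV. std_normal_density (z $ i)))"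
    by (subst density_distr) (auto simp: prod_UNIV_2)
  finally show ?thesis unfolding orthogonal_lborel[OF T] by (simp add: std_normal_vector_def)
qed

lemma inner_real2: "x \<bullet> y = x $ 1 * y $ 1 + x $ 2 * y $ 2" for x y :: "real ^ 2"
  by (simp add: inner_vec_def sum_2)

text \<open>Every orthogonal map of the plane has this form, with \<open>e = \<plusminus>1\<close> its determinant.\<close>

lemma orthogonal_transformation_real2:
  assumes "p\<^sup>2 + q\<^sup>2 = 1" "e\<^sup>2 = 1"
  shows "orthogonal_transformation (\<lambda>z :: real ^ 2. vector [p * z $ 1 + q * z $ 2, e * (p * z $ 2 - q * z $ 1)] :: real ^ 2)"
  unfolding orthogonal_transformation_def
proof (intro conjI allI)
  show "linear (\<lambda>z :: real ^ 2. vector [p * z $ 1 + q * z $ 2, e * (p * z $ 2 - q * z $ 1)] :: real ^ 2)"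
    by (intro linearI) (simp_all add: vec_eq_iff forall_2 algebra_simps)
  fix v w :: "real ^ 2"
  have "(p * v $ 1 + q * v $ 2) * (p * w $ 1 + q * w $ 2) + (e * (p * v $ 2 - q * v $ 1)) * (e * (p * w $ 2 - q * w $ 1))
      = (p\<^sup>2 + q\<^sup>2 * e\<^sup>2) * (v $ 1 * w $ 1) + (q\<^sup>2 + p\<^sup>2 * e\<^sup>2) * (v $ 2 * w $ 2)
        + p * q * (1 - e\<^sup>2) * (v $ 1 * w $ 2 + v $ 2 * w $ 1)"
    by (simp add: algebra_simps power2_eq_square)
  also have "\<dots> = (p\<^sup>2 + q\<^sup>2) * (v $ 1 * w $ 1) + (q\<^sup>2 + p\<^sup>2) * (v $ 2 * w $ 2)" using assms(2) by simp
  also have "\<dots> = v $ 1 * w $ 1 + v $ 2 * w $ 2" using assms(1) by (simp add: add.commute)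
  finally show "(vector [p * v $ 1 + q * v $ 2, e * (p * v $ 2 - q * v $ 1)] :: real ^ 2)
      \<bullet> vector [p * w $ 1 + q * w $ 2, e * (p * w $ 2 - q * w $ 1)] = v \<bullet> w"
    by (simp add: inner_real2)
qed

context
  fixes sigC2 sigE2 :: real
  assumes sig: "0 \<le> sigE2" "sigE2 < sigC2"
begin

abbreviation (input) limit_law :: "(real ^ 2) measure" where
  "limit_law \<equiv> multivariate_normal 0 (vector [vector [sigC2, sigE2], vector [sigE2, sigE2]])"

text \<open>
  Any two square roots \<open>A\<close> of the covariance matrix differ by an orthogonal factor, under which the
  standard normal law is invariant. The factor is built here from the rows of \<open>A\<close>, since the
  matrix may be singular.
\<close>

lemma limit_law_eq:
  "limit_law = distr std_normal_vector borel
     (\<lambda>z :: real ^ 2. vector [sqrt sigE2 * z $ 2 - sqrt (sigC2 - sigE2) * z $ 1, sqrt sigE2 * z $ 2])"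
proof -
  define S :: "real ^ 2 ^ 2" where "S = vector [vector [sigC2, sigE2], vector [sigE2, sigE2]]"
  define s where "s = sqrt sigE2"
  define t where "t = sqrt (sigC2 - sigE2)"
  have s: "0 \<le> s" "s\<^sup>2 = sigE2" and t: "0 < t" "t\<^sup>2 = sigC2 - sigE2" using sig by (auto simp: s_def t_def)
  define A :: "real ^ 2 ^ 2" where "A = (SOME A. A ** transpose A = S)"
  have "(vector [vector [t, s], vector [0, s]] :: real ^ 2 ^ 2) ** transpose (vector [vector [t, s], vector [0, s]]) = S"
    using s t by (simp add: S_def vec_eq_iff forall_2 matrix_matrix_mult_def transpose_def sum_2 power2_eq_square)
  then have A: "A ** transpose A = S" unfolding A_def by (rule someI)
  have a: "(A $ 1 $ 1)\<^sup>2 + (A $ 1 $ 2)\<^sup>2 = sigC2" "A $ 1 $ 1 * A $ 2 $ 1 + A $ 1 $ 2 * A $ 2 $ 2 = sigE2"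
    "(A $ 2 $ 1)\<^sup>2 + (A $ 2 $ 2)\<^sup>2 = sigE2"
    using A by (simp_all add: S_def vec_eq_iff forall_2 matrix_matrix_mult_def transpose_def sum_2 power2_eq_square)
  \<comment> \<open>\<open>(p, q)\<close> is the unit vector along the difference of the two rows of
    \<open>A\<close>, whose squared length is \<open>sigC2 - 2 * sigE2 + sigE2 = t^2\<close>. The
    second row is perpendicular to it, hence equals \<open>k\<close> times
    \<open>(- q, p)\<close>.\<close>
  define p where "p = (A $ 2 $ 1 - A $ 1 $ 1) / t"
  define q where "q = (A $ 2 $ 2 - A $ 1 $ 2) / t"
  define k where "k = A $ 2 $ 2 * p - A $ 2 $ 1 * q"
  have pt: "p * t = A $ 2 $ 1 - A $ 1 $ 1" "q * t = A $ 2 $ 2 - A $ 1 $ 2" using t by (simp_all add: p_def q_def)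
  have "(p\<^sup>2 + q\<^sup>2) * t\<^sup>2 = (p * t)\<^sup>2 + (q * t)\<^sup>2" by (simp add: algebra_simps power2_eq_square)
  also have "\<dots> = t\<^sup>2" unfolding pt t(2) using a by (simp add: power2_diff algebra_simps)
  finally have pq: "p\<^sup>2 + q\<^sup>2 = 1" using t(1) by simp
  have "(A $ 2 $ 1 * p + A $ 2 $ 2 * q) * t = A $ 2 $ 1 * (p * t) + A $ 2 $ 2 * (q * t)" by (simp add: algebra_simps)
  also have "\<dots> = 0" unfolding pt using a by (simp add: algebra_simps power2_eq_square)
  finally have perp: "A $ 2 $ 1 * p + A $ 2 $ 2 * q = 0" using t by simp
  have A21: "A $ 2 $ 1 = - k * q"
  proof -
    have "- k * q = A $ 2 $ 1 * (p\<^sup>2 + q\<^sup>2) - p * (A $ 2 $ 1 * p + A $ 2 $ 2 * q)"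
      by (simp add: k_def algebra_simps power2_eq_square)
    then show ?thesis using pq perp by simp
  qed
  have A22: "A $ 2 $ 2 = k * p"
  proof -
    have "k * p = A $ 2 $ 2 * (p\<^sup>2 + q\<^sup>2) - q * (A $ 2 $ 1 * p + A $ 2 $ 2 * q)"
      by (simp add: k_def algebra_simps power2_eq_square)
    then show ?thesis using pq perp by simp
  qed
  have "k\<^sup>2 * (p\<^sup>2 + q\<^sup>2) = s\<^sup>2" using a(3) unfolding A21 A22 s(2) by (simp add: algebra_simps power2_eq_square)
  then have "\<bar>k\<bar>\<^sup>2 = s\<^sup>2" using pq by simp
  then have "\<bar>k\<bar> = s" by (rule power2_eq_imp_eq) (use s in auto)
  \<comment> \<open>The sign of \<open>k\<close>, set to \<open>1\<close> in the singular case
    \<open>k = 0\<close>, where either sign represents \<open>k\<close> as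
    \<open>s * e\<close>.\<close>
  define e :: real where "e = (if 0 \<le> k then 1 else - 1)"
  have e: "e\<^sup>2 = 1" "k = s * e" using \<open>\<bar>k\<bar> = s\<close> by (auto simp: e_def)
  define T where "T z = (vector [p * z $ 1 + q * z $ 2, e * (p * z $ 2 - q * z $ 1)] :: real ^ 2)" for z :: "real ^ 2"
  have T: "orthogonal_transformation T" unfolding T_def[abs_def] by (rule orthogonal_transformation_real2[OF pq e(1)])
  have [measurable]: "T \<in> borel_measurable borel" unfolding T_def[abs_def] by measurable
  have AT: "A *v z = vector [s * T z $ 2 - t * T z $ 1, s * T z $ 2]" for z
  proof -
    have "(A *v z) $ 2 = s * T z $ 2"
      by (simp add: matrix_vector_mult_def sum_2 T_def A21 A22 e(2) algebra_simps)
    moreover have "(A *v z) $ 1 = (A *v z) $ 2 - t * T z $ 1"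
    proof -
      have "t * T z $ 1 = (p * t) * z $ 1 + (q * t) * z $ 2" by (simp add: T_def algebra_simps)
      then show ?thesis unfolding pt by (simp add: matrix_vector_mult_def sum_2 algebra_simps)
    qed
    ultimately show ?thesis by (simp add: vec_eq_iff forall_2)
  qed
  have "limit_law = distr std_normal_vector borel (\<lambda>z. vector [s * T z $ 2 - t * T z $ 1, s * T z $ 2])"
    unfolding multivariate_normal_def S_def[symmetric] A_def[symmetric] AT by simp
  also have "\<dots> = distr (distr std_normal_vector borel T) borel (\<lambda>z :: real ^ 2. vector [s * z $ 2 - t * z $ 1, s * z $ 2])"
    by (subst distr_distr) (auto simp: comp_def)
  finally show ?thesis unfolding orthogonal_std_normal_vector[OF T] s_def t_def .
qed

lemma sets_limit_law: "sets limit_law = sets borel"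
  by (simp add: multivariate_normal_def)

lemma prob_space_limit_law: "prob_space limit_law"
  by (subst limit_law_eq, rule prob_space.prob_space_distr[OF prob_space_std_normal_vector]) measurable

lemma limit_law_1: "distr limit_law borel (\<lambda>x. x $ 1) = normal_distribution 0 sigC2"
proof -
  define c where "c = sqrt sigC2"
  define s where "s = sqrt sigE2"
  define t where "t = sqrt (sigC2 - sigE2)"
  have c: "0 < c" "c\<^sup>2 = s\<^sup>2 + t\<^sup>2" using sig by (auto simp: c_def s_def t_def)
  \<comment> \<open>The first row is the coefficient vector \<open>(- t, s)\<close> of
    \<open>s * z $ 2 - t * z $ 1\<close> divided by its length \<open>c\<close>, so this combination
    becomes \<open>c\<close> times a standard normal coordinate.\<close>
  define T where "T z = (vector [(- t / c) * z $ 1 + (s / c) * z $ 2, 1 * ((- t / c) * z $ 2 - (s / c) * z $ 1)] :: real ^ 2)" for z :: "real ^ 2"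
  have T: "orthogonal_transformation T"
    unfolding T_def[abs_def]
  proof (rule orthogonal_transformation_real2)
    have "(- t / c)\<^sup>2 + (s / c)\<^sup>2 = (s\<^sup>2 + t\<^sup>2) / c\<^sup>2" by (simp add: power_divide add_divide_distrib)
    then show "(- t / c)\<^sup>2 + (s / c)\<^sup>2 = 1" using c(1) unfolding c(2)[symmetric] by simp
  qed simp
  have [measurable]: "T \<in> borel_measurable borel" unfolding T_def[abs_def] by measurable
  have "distr limit_law borel (\<lambda>x. x $ 1) = distr std_normal_vector borel (\<lambda>z :: real ^ 2. s * z $ 2 - t * z $ 1)"
    unfolding s_def t_def by (subst limit_law_eq, subst distr_distr) (auto simp: comp_def)
  also have "(\<lambda>z :: real ^ 2. s * z $ 2 - t * z $ 1) = (\<lambda>z. c * T z $ 1)"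
    using c by (auto simp: T_def field_simps)
  also have "distr std_normal_vector borel (\<lambda>z. c * T z $ 1) = distr (distr std_normal_vector borel T) borel (\<lambda>z :: real ^ 2. c * z $ 1)"
    by (subst distr_distr) (auto simp: comp_def)
  also have "\<dots> = distr std_normal_vector borel (\<lambda>z :: real ^ 2. c * z $ 1)"
    unfolding orthogonal_std_normal_vector[OF T] ..
  also have "\<dots> = distr (distr std_normal_vector borel (\<lambda>z :: real ^ 2. z $ 1)) borel (\<lambda>x. c * x)"
    by (subst distr_distr) (auto simp: comp_def)
  also have "\<dots> = distr std_normal borel (\<lambda>x. 0 + c * x)"
    unfolding distr_std_normal_vector_1 by (subst distr_distr) (auto simp: comp_def)
  also have "\<dots> = normal_distribution 0 sigC2"
  proof -
    interpret prob_space std_normal by (rule prob_space_std_normal)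
    have "distributed std_normal lborel (\<lambda>x. x) std_normal_density"
      unfolding distributed_def by (auto simp: distr_id2)
    then have "distributed std_normal lborel (\<lambda>x. 0 + c * x) (normal_density (0 + c * 0) (\<bar>c\<bar> * 1))"
      using c by (intro normal_density_affine) auto
    then have "distr std_normal lborel (\<lambda>x. 0 + c * x) = density lborel (normal_density 0 c)"
      using c by (simp add: distributed_def)
    moreover have "distr std_normal lborel (\<lambda>x. 0 + c * x) = distr std_normal borel (\<lambda>x. 0 + c * x)"
      by (intro distr_cong) auto
    ultimately show ?thesis by (simp add: c_def)
  qed
  finally show ?thesis .
qed

end

section \<open>Moments under the standard normal law of the plane\<close>

lemma std_normal_vector_integral_1:
  fixes f :: "real \<Rightarrow> real"
  assumes [measurable]: "f \<in> borel_measurable borel"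
  shows "(\<integral>z. f (z $ 1) \<partial>(std_normal_vector :: (real ^ 2) measure)) = (\<integral>x. std_normal_density x * f x \<partial>lborel)"
    and "integrable (std_normal_vector :: (real ^ 2) measure) (\<lambda>z. f (z $ 1)) \<longleftrightarrow> integrable lborel (\<lambda>x. std_normal_density x * f x)"
proof -
  have "(\<integral>z. f (z $ 1) \<partial>(std_normal_vector :: (real ^ 2) measure)) = (\<integral>x. f x \<partial>distr std_normal_vector borel (\<lambda>z :: real ^ 2. z $ 1))"
    by (subst integral_distr) auto
  also have "\<dots> = (\<integral>x. f x \<partial>std_normal)" unfolding distr_std_normal_vector_1 by (subst integral_distr) auto
  finally show "(\<integral>z. f (z $ 1) \<partial>(std_normal_vector :: (real ^ 2) measure)) = (\<integral>x. std_normal_density x * f x \<partial>lborel)"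
    by (simp add: integral_density)
  have "integrable (std_normal_vector :: (real ^ 2) measure) (\<lambda>z. f (z $ 1)) \<longleftrightarrow> integrable (distr std_normal_vector borel (\<lambda>z :: real ^ 2. z $ 1)) f"
    by (subst integrable_distr_eq) auto
  also have "\<dots> \<longleftrightarrow> integrable std_normal f" unfolding distr_std_normal_vector_1 by (subst integrable_distr_eq) auto
  finally show "integrable (std_normal_vector :: (real ^ 2) measure) (\<lambda>z. f (z $ 1)) \<longleftrightarrow> integrable lborel (\<lambda>x. std_normal_density x * f x)"
    by (simp add: integrable_density)
qed

lemma std_normal_vector_orthogonal:
  fixes f :: "real ^ 2 \<Rightarrow> real" and T :: "real ^ 2 \<Rightarrow> real ^ 2"
  assumes T: "orthogonal_transformation T" and [measurable]: "T \<in> borel_measurable borel" "f \<in> borel_measurable borel"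
  shows "(\<integral>z. f (T z) \<partial>std_normal_vector) = (\<integral>z. f z \<partial>std_normal_vector)"
    and "integrable std_normal_vector (\<lambda>z. f (T z)) \<longleftrightarrow> integrable std_normal_vector f"
proof -
  have "(\<integral>z. f (T z) \<partial>std_normal_vector) = (\<integral>z. f z \<partial>distr std_normal_vector borel T)"
    by (subst integral_distr) auto
  then show "(\<integral>z. f (T z) \<partial>std_normal_vector) = (\<integral>z. f z \<partial>std_normal_vector)"
    unfolding orthogonal_std_normal_vector[OF T] .
  have "integrable std_normal_vector (\<lambda>z. f (T z)) \<longleftrightarrow> integrable (distr std_normal_vector borel T) f"
    by (subst integrable_distr_eq) auto
  then show "integrable std_normal_vector (\<lambda>z. f (T z)) \<longleftrightarrow> integrable std_normal_vector f"
    unfolding orthogonal_std_normal_vector[OF T] .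
qed

lemma std_normal_vector_second:
  shows "integrable std_normal_vector (\<lambda>z :: real ^ 2. (z $ 2)\<^sup>2)"
    and "(\<integral>z. (z $ 2)\<^sup>2 \<partial>(std_normal_vector :: (real ^ 2) measure)) = 1"
    and "integrable std_normal_vector (\<lambda>z :: real ^ 2. z $ 2)"
    and "(\<integral>z. z $ 2 \<partial>(std_normal_vector :: (real ^ 2) measure)) = 0"
proof -
  \<comment> \<open>A rotation by a right angle carries statements about the first coordinate over
    to the second.\<close>
  define T where "T z = (vector [0 * z $ 1 + 1 * z $ 2, 1 * (0 * z $ 2 - 1 * z $ 1)] :: real ^ 2)" for z :: "real ^ 2"
  have T: "orthogonal_transformation T" unfolding T_def[abs_def] by (rule orthogonal_transformation_real2) auto
  have m: "T \<in> borel_measurable borel" unfolding T_def[abs_def] by measurable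
  have 2: "T z $ 1 = z $ 2" for z by (simp add: T_def)
  note e = std_normal_vector_orthogonal[OF T m]
  have s2: "(\<lambda>x. x\<^sup>2) \<in> borel_measurable (borel :: real measure)" by measurable
  have s1: "(\<lambda>x. x) \<in> borel_measurable (borel :: real measure)" by measurable
  show "integrable std_normal_vector (\<lambda>z :: real ^ 2. (z $ 2)\<^sup>2)"
    using e(2)[of "\<lambda>z. (z $ 1)\<^sup>2"] std_normal_vector_integral_1(2)[OF s2] integrable_std_normal_moment[of 2] by (simp add: 2)
  show "(\<integral>z. (z $ 2)\<^sup>2 \<partial>(std_normal_vector :: (real ^ 2) measure)) = 1"
    using e(1)[of "\<lambda>z. (z $ 1)\<^sup>2"] std_normal_vector_integral_1(1)[OF s2] integral_std_normal_moment_even[of 1] by (simp add: 2)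
  show "integrable std_normal_vector (\<lambda>z :: real ^ 2. z $ 2)"
    using e(2)[of "\<lambda>z. z $ 1"] std_normal_vector_integral_1(2)[OF s1] integrable_std_normal_moment[of 1] by (simp add: 2)
  show "(\<integral>z. z $ 2 \<partial>(std_normal_vector :: (real ^ 2) measure)) = 0"
    using e(1)[of "\<lambda>z. z $ 1"] std_normal_vector_integral_1(1)[OF s1] integral_std_normal_moment_odd[of 0] by (simp add: 2)
qed

text \<open>Reflecting the second coordinate preserves the law and changes the sign of the
  integrand, so the integral equals its own negative.\<close>

lemma std_normal_vector_uncorrelated:
  fixes w :: "real \<Rightarrow> real"
  assumes [measurable]: "w \<in> borel_measurable borel"
  shows "(\<integral>z. z $ 2 * w (z $ 1) \<partial>(std_normal_vector :: (real ^ 2) measure)) = 0"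
proof -
  define T where "T z = (vector [1 * z $ 1 + 0 * z $ 2, - 1 * (1 * z $ 2 - 0 * z $ 1)] :: real ^ 2)" for z :: "real ^ 2"
  have T: "orthogonal_transformation T" unfolding T_def[abs_def] by (rule orthogonal_transformation_real2) auto
  have m: "T \<in> borel_measurable borel" unfolding T_def[abs_def] by measurable
  have "(\<integral>z. T z $ 2 * w (T z $ 1) \<partial>std_normal_vector) = (\<integral>z. z $ 2 * w (z $ 1) \<partial>(std_normal_vector :: (real ^ 2) measure))"
    by (rule std_normal_vector_orthogonal(1)[OF T m]) measurable
  then show ?thesis by (simp add: T_def)
qed

lemma std_normal_vector_second_moment:
  fixes w :: "real \<Rightarrow> real"
  assumes [measurable]: "w \<in> borel_measurable borel" and i: "integrable lborel (\<lambda>x. std_normal_density x * (w x)\<^sup>2)"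
  shows "integrable (std_normal_vector :: (real ^ 2) measure) (\<lambda>z. (s * z $ 2 + t * w (z $ 1))\<^sup>2)"
    and "(\<integral>z. (s * z $ 2 + t * w (z $ 1))\<^sup>2 \<partial>(std_normal_vector :: (real ^ 2) measure))
      = s\<^sup>2 + t\<^sup>2 * (\<integral>x. std_normal_density x * (w x)\<^sup>2 \<partial>lborel)"
proof -
  let ?P = "std_normal_vector :: (real ^ 2) measure"
  have iw: "integrable ?P (\<lambda>z. (w (z $ 1))\<^sup>2)" using i std_normal_vector_integral_1(2)[of "\<lambda>x. (w x)\<^sup>2"] by simp
  have ic: "integrable ?P (\<lambda>z. z $ 2 * w (z $ 1))"
  proof (rule Bochner_Integration.integrable_bound)
    show "integrable ?P (\<lambda>z. (z $ 2)\<^sup>2 + (w (z $ 1))\<^sup>2)" using iw std_normal_vector_second(1) by simp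
    show "AE z in ?P. norm (z $ 2 * w (z $ 1)) \<le> norm ((z $ 2)\<^sup>2 + (w (z $ 1))\<^sup>2)"
    proof (rule AE_I2)
      fix z :: "real ^ 2"
      have "2 * (\<bar>z $ 2\<bar> * \<bar>w (z $ 1)\<bar>) \<le> (z $ 2)\<^sup>2 + (w (z $ 1))\<^sup>2"
        using zero_le_power2[of "\<bar>z $ 2\<bar> - \<bar>w (z $ 1)\<bar>"] by (simp add: power2_diff)
      then show "norm (z $ 2 * w (z $ 1)) \<le> norm ((z $ 2)\<^sup>2 + (w (z $ 1))\<^sup>2)"
        using mult_nonneg_nonneg[OF abs_ge_zero abs_ge_zero, of "z $ 2" "w (z $ 1)"]
        unfolding real_norm_def abs_mult by linarith
    qed
  qed measurable
  have e: "(s * z $ 2 + t * w (z $ 1))\<^sup>2 = s\<^sup>2 * (z $ 2)\<^sup>2 + 2 * s * t * (z $ 2 * w (z $ 1)) + t\<^sup>2 * (w (z $ 1))\<^sup>2" for z :: "real ^ 2"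
    by (simp add: power2_eq_square algebra_simps)
  show "integrable ?P (\<lambda>z. (s * z $ 2 + t * w (z $ 1))\<^sup>2)"
    unfolding e using iw ic std_normal_vector_second(1) by simp
  show "(\<integral>z. (s * z $ 2 + t * w (z $ 1))\<^sup>2 \<partial>?P) = s\<^sup>2 + t\<^sup>2 * (\<integral>x. std_normal_density x * (w x)\<^sup>2 \<partial>lborel)"
    unfolding e using iw ic std_normal_vector_second(1,2) std_normal_vector_uncorrelated[of w]
      std_normal_vector_integral_1(1)[of "\<lambda>x. (w x)\<^sup>2"] by simp
qed

section \<open>Slutsky's theorem and the limit of the estimator\<close>

lemma cmod_iexp_diff_le: "cmod (iexp a - iexp b) \<le> \<bar>a - b\<bar>"
proof -
  have "iexp a - iexp b = iexp b * (iexp (a - b) - 1)"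
    by (simp add: right_diff_distrib exp_add[symmetric] of_real_diff)
  then have "cmod (iexp a - iexp b) = cmod (iexp (a - b) - 1)" by (simp add: norm_mult)
  also have "\<dots> \<le> \<bar>a - b\<bar>" using iexp_approx1[of "a - b" 0] by simp
  finally show ?thesis .
qed

text \<open>Since \<open>iexp\<close> is Lipschitz with constant \<open>1\<close> and bounded by
  \<open>1\<close>, the characteristic functions of \<open>Z n\<close> and \<open>Y n\<close> at
  \<open>t\<close> differ by at most \<open>\<bar>t\<bar> * d\<close> plus twice the probability
  that the variables are more than \<open>d\<close> apart.\<close>

lemma slutsky:
  fixes Y Z :: "nat \<Rightarrow> 'a \<Rightarrow> real"
  assumes M: "\<And>n. prob_space (M n)"
    and Y [measurable]: "\<And>n. Y n \<in> borel_measurable (M n)" and Z [measurable]: "\<And>n. Z n \<in> borel_measurable (M n)"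
    and N: "real_distribution N" and conv: "converges_in_distribution M Y N"
    and diff: "converges_in_probability M (\<lambda>n \<omega>. Z n \<omega> - Y n \<omega>) 0"
  shows "weak_conv_m (\<lambda>n. distr (M n) borel (Z n)) N"
proof (rule levy_continuity)
  show "real_distribution (distr (M n) borel (Z n))" for n
    using prob_space.real_distribution_distr[OF M Z] .
  fix t
  have ch: "char (distr (M n) borel (V n)) t = (\<integral>\<omega>. iexp (t * V n \<omega>) \<partial>M n)"
    if [measurable]: "V n \<in> borel_measurable (M n)" for V :: "nat \<Rightarrow> 'a \<Rightarrow> real" and n
    unfolding char_def by (subst integral_distr) auto
  have "weak_conv_m (\<lambda>n. distr (M n) borel (Y n)) N"
    using conv converges_in_distribution_real[OF M Y N] by simp
  then have cY: "(\<lambda>n. char (distr (M n) borel (Y n)) t) \<longlonglongrightarrow> char N t"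
    by (intro levy_continuity1 N prob_space.real_distribution_distr[OF M Y])
  have "(\<lambda>n. char (distr (M n) borel (Z n)) t - char (distr (M n) borel (Y n)) t) \<longlonglongrightarrow> 0"
  proof (rule tendstoI)
    fix e :: real assume e: "0 < e"
    define d where "d = e / (2 * (\<bar>t\<bar> + 1))"
    have d: "0 < d" "\<bar>t\<bar> * d < e / 2"
    proof -
      show "0 < d" using e by (simp add: d_def)
      have "\<bar>t\<bar> * d < (\<bar>t\<bar> + 1) * d" using \<open>0 < d\<close> by (intro mult_strict_right_mono) auto
      also have "\<dots> = e / 2" by (simp add: d_def field_simps add_nonneg_eq_0_iff)
      finally show "\<bar>t\<bar> * d < e / 2" .
    qed
    let ?B = "\<lambda>n. {\<omega> \<in> space (M n). \<bar>Z n \<omega> - Y n \<omega>\<bar> > d}"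
    have "(\<lambda>n. measure (M n) (?B n)) \<longlonglongrightarrow> 0"
      using diff d(1) unfolding converges_in_probability_def by simp
    then have "\<forall>\<^sub>F n in sequentially. measure (M n) (?B n) < e / 4"
      by (rule order_tendstoD) (use e in simp)
    then show "\<forall>\<^sub>F n in sequentially.
        dist (char (distr (M n) borel (Z n)) t - char (distr (M n) borel (Y n)) t) 0 < e"
    proof eventually_elim
      case (elim n)
      interpret prob_space "M n" by (rule M)
      have B [measurable]: "?B n \<in> sets (M n)" by measurable
      have i: "integrable (M n) (\<lambda>\<omega>. iexp (t * V \<omega>))" if [measurable]: "V \<in> borel_measurable (M n)" for V
        by (rule integrable_const_bound[of _ 1]) auto
      have "char (distr (M n) borel (Z n)) t - char (distr (M n) borel (Y n)) t
          = (\<integral>\<omega>. iexp (t * Z n \<omega>) - iexp (t * Y n \<omega>) \<partial>M n)"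
        using Bochner_Integration.integral_diff[OF i[OF Z] i[OF Y]] by (simp only: ch[of Z n, OF Z] ch[of Y n, OF Y])
      also have "cmod \<dots> \<le> (\<integral>\<omega>. \<bar>t\<bar> * d + 2 * indicator (?B n) \<omega> \<partial>M n)"
      proof (rule order_trans[OF integral_norm_bound integral_mono])
        show "integrable (M n) (\<lambda>\<omega>. cmod (iexp (t * Z n \<omega>) - iexp (t * Y n \<omega>)))"
          by (intro integrable_norm Bochner_Integration.integrable_diff i Y Z)
        show "integrable (M n) (\<lambda>\<omega>. \<bar>t\<bar> * d + 2 * indicator (?B n) \<omega>)"
          by (intro Bochner_Integration.integrable_add integrable_mult_right integrable_real_indicator B)
            (auto simp: emeasure_eq_measure)
        fix \<omega> assume \<omega>: "\<omega> \<in> space (M n)"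
        show "cmod (iexp (t * Z n \<omega>) - iexp (t * Y n \<omega>)) \<le> \<bar>t\<bar> * d + 2 * indicator (?B n) \<omega>"
        proof (cases "\<omega> \<in> ?B n")
          case True
          have "cmod (iexp (t * Z n \<omega>) - iexp (t * Y n \<omega>)) \<le> cmod (iexp (t * Z n \<omega>)) + cmod (iexp (t * Y n \<omega>))"
            by (rule norm_triangle_ineq4)
          then show ?thesis using True d(1) by (simp add: add_nonneg_nonneg add_increasing)
        next
          case False
          have "cmod (iexp (t * Z n \<omega>) - iexp (t * Y n \<omega>)) \<le> \<bar>t * Z n \<omega> - t * Y n \<omega>\<bar>"
            by (rule cmod_iexp_diff_le)
          also have "\<dots> = \<bar>t\<bar> * \<bar>Z n \<omega> - Y n \<omega>\<bar>" unfolding abs_mult[symmetric] by (simp add: right_diff_distrib)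
          also have "\<dots> \<le> \<bar>t\<bar> * d" using False \<omega> by (intro mult_left_mono) auto
          finally show ?thesis using False by simp
        qed
      qed
      also have "\<dots> = \<bar>t\<bar> * d + 2 * measure (M n) (?B n)"
      proof -
        have "integrable (M n) (indicator (?B n) :: 'a \<Rightarrow> real)"
          using B by (intro integrable_real_indicator) (auto simp: emeasure_eq_measure)
        then show ?thesis using B by (simp add: prob_space)
      qed
      also have "\<dots> < e" using d(2) elim by simp
      finally show ?case by simp
    qed
  qed
  from tendsto_add[OF this cY] show "(\<lambda>n. char (distr (M n) borel (Z n)) t) \<longlonglongrightarrow> char N t" by simp
qed (rule N)

lemma converges_in_distribution_continuous_map:
  fixes u :: "'b::t2_space \<Rightarrow> real"
  assumes X: "converges_in_distribution M X N" and u: "continuous_on UNIV u" and N: "sets N = sets borel"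
  shows "converges_in_distribution M (\<lambda>n \<omega>. u (X n \<omega>)) (distr N borel u)"
  unfolding converges_in_distribution_def
proof (intro allI impI)
  fix f :: "real \<Rightarrow> real" assume f: "continuous_on UNIV f" "bounded (range f)"
  have um: "u \<in> borel_measurable N" using u N borel_measurable_continuous_onI measurable_cong_sets by blast
  have fm: "f \<in> borel_measurable borel" using f(1) by (rule borel_measurable_continuous_onI)
  have "continuous_on UNIV (\<lambda>x. f (u x))" using continuous_on_compose2[OF f(1) u] by simp
  moreover have "bounded (range (\<lambda>x. f (u x)))" using f(2) by (rule bounded_subset) auto
  ultimately have "(\<lambda>n. \<integral>\<omega>. f (u (X n \<omega>)) \<partial>M n) \<longlonglongrightarrow> (\<integral>x. f (u x) \<partial>N)"
    using X unfolding converges_in_distribution_def by blast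
  also have "(\<integral>x. f (u x) \<partial>N) = (\<integral>y. f y \<partial>distr N borel u)" using um fm by (simp add: integral_distr)
  finally show "(\<lambda>n. \<integral>\<omega>. f (u (X n \<omega>)) \<partial>M n) \<longlonglongrightarrow> (\<integral>y. f y \<partial>distr N borel u)" .
qed

lemma converges_in_probability_mono:
  assumes "\<And>e. 0 < e \<Longrightarrow> (\<lambda>n. measure (M n) (B e n)) \<longlonglongrightarrow> 0"
    and "\<And>n e. 0 < e \<Longrightarrow> B e n \<in> sets (M n)" "\<And>n. prob_space (M n)"
    and "\<And>e. 0 < e \<Longrightarrow> \<forall>\<^sub>F n in sequentially. {\<omega> \<in> space (M n). \<bar>X n \<omega> - c\<bar> > e} \<subseteq> B e n"
  shows "converges_in_probability M X c"
  unfolding converges_in_probability_def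
proof (intro allI impI)
  fix e :: real assume e: "0 < e"
  show "(\<lambda>n. measure (M n) {\<omega> \<in> space (M n). \<bar>X n \<omega> - c\<bar> > e}) \<longlonglongrightarrow> 0"
  proof (rule tendsto_sandwich[OF _ _ tendsto_const assms(1)[OF e]])
    show "\<forall>\<^sub>F n in sequentially. measure (M n) {\<omega> \<in> space (M n). \<bar>X n \<omega> - c\<bar> > e} \<le> measure (M n) (B e n)"
      using assms(4)[OF e]
    proof eventually_elim
      case (elim n)
      interpret prob_space "M n" by (rule assms)
      show ?case using elim assms(2)[OF e] by (intro finite_measure_mono)
    qed
  qed auto
qed

section \<open>The estimator as a function of the normalised statistics\<close>

definition weight_denominator :: "real \<Rightarrow> real \<Rightarrow> real \<Rightarrow> real \<Rightarrow> real \<Rightarrow> real \<Rightarrow> real" where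
  "weight_denominator lam bC bE vC vE cv = max 0 ((bE - bC)\<^sup>2 - lam * var_diff vC vE cv) + var_diff vC vE cv"

text \<open>
  The junk values of \<^const>\<open>arg_min\<close> matter for measurability only: there are just two of them.
\<close>

lemma p_hat_cases:
  "p_hat lam bC bE vC vE cv =
    (if 0 < weight_denominator lam bC bE vC vE cv then (vC - cv) / weight_denominator lam bC bE vC vE cv
     else if weight_denominator lam bC bE vC vE cv = 0 \<and> vC = cv then (SOME x. True) else (SOME x. False))"
proof -
  let ?f = "mse_criterion lam bC bE vC vE cv"
  define D where "D = weight_denominator lam bC bE vC vE cv"
  define a where "a = vC - cv"
  have f: "?f p = D * p\<^sup>2 - 2 * p * a + vC" for p
    unfolding mse_criterion_def D_def a_def weight_denominator_def var_diff_def by (simp add: algebra_simps power2_eq_square)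
  consider "0 < D" | "D = 0" "a = 0" | "D < 0" | "D = 0" "a \<noteq> 0" by linarith
  then show ?thesis
  proof cases
    case 1
    then show ?thesis using p_hat_eq[of bE bC lam vC vE cv] by (simp add: D_def weight_denominator_def)
  next
    case 2
    then have "is_arg_min ?f (\<lambda>_. True) = (\<lambda>_. True)" by (auto simp: is_arg_min_def f fun_eq_iff)
    then show ?thesis using 2 by (simp add: p_hat_def arg_min_def D_def a_def)
  next
    case 3
    have "\<exists>y. ?f y < ?f x" for x
    proof -
      \<comment> \<open>A nonzero step that goes against the derivative
        \<open>2 * (D * x - a)\<close>, or starts at its zero; as \<open>D < 0\<close>, the value
        drops strictly.\<close>
      define s where "s = (if D * x = a then 1 else a - D * x)"
      have "s * (D * x - a) \<le> 0" "s \<noteq> 0"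
        using zero_le_square[of "a - D * x"] by (auto simp: s_def algebra_simps)
      moreover have "D * s\<^sup>2 < 0" using 3 \<open>s \<noteq> 0\<close> by (simp add: mult_neg_pos)
      moreover have "?f (x + s) = ?f x + 2 * (s * (D * x - a)) + D * s\<^sup>2" unfolding f by (simp add: algebra_simps power2_eq_square)
      ultimately have "?f (x + s) < ?f x" by simp
      then show ?thesis ..
    qed
    then have "is_arg_min ?f (\<lambda>_. True) = (\<lambda>_. False)" by (auto simp: is_arg_min_def fun_eq_iff)
    then show ?thesis using 3 by (simp add: p_hat_def arg_min_def D_def)
  next
    case 4
    have "?f (x + a) < ?f x" for x
    proof -
      have "?f (x + a) = ?f x - 2 * a\<^sup>2" unfolding f using 4(1) by (simp add: algebra_simps power2_eq_square)
      then show ?thesis using 4(2) by simp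
    qed
    then have "is_arg_min ?f (\<lambda>_. True) = (\<lambda>_. False)" by (auto simp: is_arg_min_def fun_eq_iff)
    then show ?thesis using 4 by (simp add: p_hat_def arg_min_def D_def a_def)
  qed
qed

lemma borel_measurable_beta_mse [measurable]:
  assumes [measurable]: "bC \<in> borel_measurable M" "bE \<in> borel_measurable M" "vC \<in> borel_measurable M"
    "vE \<in> borel_measurable M" "cv \<in> borel_measurable M"
  shows "(\<lambda>\<omega>. beta_mse lam (bC \<omega>) (bE \<omega>) (vC \<omega>) (vE \<omega>) (cv \<omega>)) \<in> borel_measurable M"
proof -
  define D where "D \<omega> = weight_denominator lam (bC \<omega>) (bE \<omega>) (vC \<omega>) (vE \<omega>) (cv \<omega>)" for \<omega>
  have [measurable]: "D \<in> borel_measurable M"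
    unfolding D_def[abs_def] weight_denominator_def var_diff_def by measurable
  define p where "p \<omega> = p_hat lam (bC \<omega>) (bE \<omega>) (vC \<omega>) (vE \<omega>) (cv \<omega>)" for \<omega>
  have "p \<in> borel_measurable M"
    unfolding p_def[abs_def] p_hat_cases D_def[symmetric] by measurable
  then show ?thesis unfolding beta_mse_def p_def[symmetric] by measurable
qed

text \<open>Numerator and denominator of \<open>p_hat\<close> are homogeneous of the same degree.
  With \<open>c = sqrt n\<close> the right-hand side involves only the scaled variances and
  covariance, whose limits are known, and the scaled differences.\<close>

lemma beta_mse_scaled:
  fixes bC bE :: real
  assumes c: "0 < c" and d: "0 < c\<^sup>2 * var_diff vC vE cv"
  defines "W \<equiv> c * (bE - bC)"
  shows "c * (beta_mse lam bC bE vC vE cv - b0)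
    = c * (bC - b0) + W * (c\<^sup>2 * vC - c\<^sup>2 * cv) / (max 0 (W\<^sup>2 - lam * (c\<^sup>2 * var_diff vC vE cv)) + c\<^sup>2 * var_diff vC vE cv)"
proof -
  define D where "D = weight_denominator lam bC bE vC vE cv"
  have vd: "0 < var_diff vC vE cv" using d c by (simp add: zero_less_mult_iff)
  then have D: "0 < D" by (simp add: D_def weight_denominator_def add_nonneg_pos)
  have "max 0 (W\<^sup>2 - lam * (c\<^sup>2 * var_diff vC vE cv)) + c\<^sup>2 * var_diff vC vE cv = c\<^sup>2 * D"
  proof -
    have "W\<^sup>2 - lam * (c\<^sup>2 * var_diff vC vE cv) = c\<^sup>2 * ((bE - bC)\<^sup>2 - lam * var_diff vC vE cv)"
      unfolding W_def power_mult_distrib by (simp only: right_diff_distrib) (simp add: mult_ac)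
    then have "max 0 (W\<^sup>2 - lam * (c\<^sup>2 * var_diff vC vE cv)) = c\<^sup>2 * max 0 ((bE - bC)\<^sup>2 - lam * var_diff vC vE cv)"
      using c by (simp add: max_mult_distrib_left)
    then show ?thesis by (simp add: D_def weight_denominator_def algebra_simps)
  qed
  moreover have "beta_mse lam bC bE vC vE cv = bC + (vC - cv) / D * (bE - bC)"
  proof -
    have "p_hat lam bC bE vC vE cv = (vC - cv) / D" using D by (simp add: p_hat_cases D_def)
    then show ?thesis unfolding beta_mse_def by (simp only: left_diff_distrib right_diff_distrib)
  qed
  moreover have "W * (c\<^sup>2 * vC - c\<^sup>2 * cv) / (c\<^sup>2 * D) = c * ((vC - cv) / D * (bE - bC))"
  proof -
    have "c\<^sup>2 * vC - c\<^sup>2 * cv = c\<^sup>2 * (vC - cv)" by (simp add: algebra_simps)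
    then show ?thesis using c D by (simp add: W_def)
  qed
  ultimately show ?thesis by (simp add: algebra_simps)
qed

text \<open>The bound must be uniform in \<open>W\<close>, which has only a limit law. It is,
  because \<open>W^2\<close> is at most \<open>(1 + lam)\<close> times the denominator, so
  \<open>W\<close> divided by the denominator stays bounded.\<close>

lemma pretest_perturbation:
  fixes W a d v lam e :: real
  assumes v: "0 < v" and lam: "0 \<le> lam" and a: "\<bar>a - v\<bar> \<le> e" and d: "\<bar>d - v\<bar> \<le> e" and e: "e \<le> v / 2"
  shows "\<bar>W * a / (max 0 (W\<^sup>2 - lam * d) + d) - W * v / (max 0 (W\<^sup>2 - lam * v) + v)\<bar>
    \<le> sqrt (2 * (1 + lam) / v) * (lam + 2) * e"
proof -
  define m where "m = max 0 (W\<^sup>2 - lam * v) + v"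
  define k where "k = max 0 (W\<^sup>2 - lam * d) + d"
  have dv: "v / 2 \<le> d" using d e by linarith
  have dk: "d \<le> k" and m: "v \<le> m" "0 < m" using v by (auto simp: k_def m_def add_nonneg_pos)
  then have k: "v / 2 \<le> k" "0 < k" "d \<le> k" using dv v by linarith+
  have "W\<^sup>2 \<le> k + lam * d"
    using dv v by (auto simp: k_def max_def)
  also have "\<dots> \<le> (1 + lam) * k" using lam k mult_left_mono[of d k lam] by (simp add: algebra_simps)
  finally have "W\<^sup>2 / k\<^sup>2 \<le> (1 + lam) * k / k\<^sup>2" by (rule divide_right_mono) simp
  also have "\<dots> = (1 + lam) / k" using k by (simp add: power2_eq_square)
  also have "\<dots> \<le> (1 + lam) / (v / 2)" using k lam v by (intro divide_left_mono) auto
  finally have "(W / k)\<^sup>2 \<le> 2 * (1 + lam) / v" by (simp add: power_divide mult.commute)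
  then have Wk: "\<bar>W / k\<bar> \<le> sqrt (2 * (1 + lam) / v)" by (intro real_le_rsqrt) (simp only: power2_abs)
  have "\<bar>max 0 (W\<^sup>2 - lam * d) - max 0 (W\<^sup>2 - lam * v)\<bar> \<le> \<bar>lam * v - lam * d\<bar>" by (auto simp: max_def)
  also have "\<dots> = lam * \<bar>d - v\<bar>"
  proof -
    have "lam * v - lam * d = lam * (v - d)" by (simp add: algebra_simps)
    then show ?thesis using lam by (simp add: abs_mult abs_minus_commute)
  qed
  also have "\<dots> \<le> lam * e" using d lam by (rule mult_left_mono)
  finally have "\<bar>m - k\<bar> \<le> lam * e + e" using d by (simp add: m_def k_def)
  have "\<bar>v * (m - k) / m\<bar> \<le> \<bar>m - k\<bar>"
  proof -
    have "\<bar>v * (m - k) / m\<bar> = (v / m) * \<bar>m - k\<bar>" using v m by (simp add: abs_mult)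
    also have "\<dots> \<le> 1 * \<bar>m - k\<bar>" using v m by (intro mult_right_mono) auto
    finally show ?thesis by simp
  qed
  then have r: "\<bar>(a - v) + v * (m - k) / m\<bar> \<le> (lam + 2) * e"
  proof -
    have "(lam + 2) * e = e + (lam * e + e)" by (simp add: algebra_simps)
    then show ?thesis using a \<open>\<bar>m - k\<bar> \<le> lam * e + e\<close> \<open>\<bar>v * (m - k) / m\<bar> \<le> \<bar>m - k\<bar>\<close> by linarith
  qed
  \<comment> \<open>Factoring out \<open>W / k\<close> leaves the change of the numerator and the
    relative change of the denominator, both of order \<open>e\<close>.\<close>
  have "W * a / k - W * v / m = W / k * ((a - v) + v * (m - k) / m)"
    using k m by (simp add: field_simps)
  then have "\<bar>W * a / k - W * v / m\<bar> = \<bar>W / k\<bar> * \<bar>(a - v) + v * (m - k) / m\<bar>" by (simp only: abs_mult)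
  also have "\<dots> \<le> sqrt (2 * (1 + lam) / v) * ((lam + 2) * e)"
    using Wk r order_trans[OF abs_ge_zero Wk] by (intro mult_mono) auto
  finally show ?thesis by (simp add: m_def k_def mult.assoc)
qed

text \<open>For large \<open>\<bar>W\<bar>\<close> the denominator is at least
  \<open>W^2 / 2\<close>, so the correction is of order \<open>1 / \<bar>W\<bar>\<close>.\<close>

lemma pretest_far:
  fixes W a d v lam e :: real
  assumes v: "0 < v" and lam: "0 \<le> lam" and a: "\<bar>a - v\<bar> \<le> v / 2" and d: "\<bar>d - v\<bar> \<le> v / 2"
    and e: "0 < e" and W: "4 * v / e \<le> \<bar>W\<bar>" "4 * lam * v \<le> W\<^sup>2"
  shows "\<bar>W * a / (max 0 (W\<^sup>2 - lam * d) + d)\<bar> \<le> e"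
proof -
  define k where "k = max 0 (W\<^sup>2 - lam * d) + d"
  have d': "v / 2 \<le> d" "d \<le> 2 * v" using d v by linarith+
  have a': "\<bar>a\<bar> \<le> 2 * v" using a v by linarith
  have W0: "0 < \<bar>W\<bar>" using W(1) v e by (smt (verit) divide_pos_pos mult_pos_pos)
  have "lam * d \<le> lam * (2 * v)" using d' lam by (intro mult_left_mono)
  then have k: "W\<^sup>2 / 2 \<le> k" using W(2) d' v by (auto simp: k_def max_def)
  moreover have "0 < W\<^sup>2" using W0 by simp
  ultimately have k0: "0 < k" by linarith
  have "\<bar>W * a / k\<bar> = \<bar>W\<bar> * \<bar>a\<bar> / k" using k0 by (simp add: abs_mult)
  also have "\<dots> \<le> \<bar>W\<bar> * (2 * v) / (W\<^sup>2 / 2)"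
    using a' k W0 v by (intro frac_le mult_left_mono) auto
  also have "\<dots> = 4 * v / \<bar>W\<bar>"
  proof -
    have "y * (2 * v) / (y\<^sup>2 / 2) = 4 * v / y" if "0 < y" for y
      using that by (simp add: power2_eq_square)
    from this[OF W0] show ?thesis by simp
  qed
  also have "\<dots> \<le> e" using W(1) W0 e by (simp add: field_simps)
  finally show ?thesis by (simp add: k_def)
qed

text \<open>The normalised estimator with the scaled variance estimates replaced by their limits:
  \<open>x\<close> stands for the normalised pair, and \<open>x $ 2 - x $ 1 + h\<close> for the
  scaled difference of the two estimators.\<close>

definition studentized :: "real \<Rightarrow> real \<Rightarrow> real \<Rightarrow> real ^ 2 \<Rightarrow> real" where
  "studentized v h lam x = x $ 1
    + (x $ 2 - x $ 1 + h) * v / (max 0 ((x $ 2 - x $ 1 + h)\<^sup>2 - lam * v) + v)"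

lemma continuous_studentized: "0 < v \<Longrightarrow> continuous_on UNIV (studentized v h lam)"
  unfolding studentized_def by (intro continuous_intros) (auto simp: max_def)

lemma pos_if_near: "\<bar>t - c\<bar> \<le> c / 2 \<Longrightarrow> 0 < c \<Longrightarrow> 0 < t" for t c :: real
  by linarith

section \<open>Limit laws along a sequence of samples\<close>

locale estimators =
  fixes sigC2 sigE2 :: real and M :: "nat \<Rightarrow> 'a measure" and b0 b1 :: "nat \<Rightarrow> real"
    and bC bE VC VE Cov :: "nat \<Rightarrow> 'a \<Rightarrow> real"
  assumes sig: "0 \<le> sigE2" "sigE2 < sigC2"
    and hyps: "asymptotic_hyps sigC2 sigE2 M b0 b1 bC bE VC VE Cov"
begin

lemma prob: "prob_space (M n)"
  and meas [measurable]: "bC n \<in> borel_measurable (M n)" "bE n \<in> borel_measurable (M n)"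
    "VC n \<in> borel_measurable (M n)" "VE n \<in> borel_measurable (M n)" "Cov n \<in> borel_measurable (M n)"
  using hyps unfolding asymptotic_hyps_def by auto

abbreviation v :: real where "v \<equiv> sigC2 - sigE2"

abbreviation limit :: "(real ^ 2) measure" where
  "limit \<equiv> multivariate_normal 0 (vector [vector [sigC2, sigE2], vector [sigE2, sigE2]])"

definition X :: "nat \<Rightarrow> 'a \<Rightarrow> real ^ 2" where
  "X n \<omega> = sqrt (real n) *\<^sub>R (vector [bC n \<omega> - b0 n, bE n \<omega> - b1 n] :: real ^ 2)"

lemma X_nth: "X n \<omega> $ 1 = sqrt (real n) * (bC n \<omega> - b0 n)" "X n \<omega> $ 2 = sqrt (real n) * (bE n \<omega> - b1 n)"
  by (simp_all add: X_def)

lemma measurable_X [measurable]: "X n \<in> borel_measurable (M n)"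
  unfolding X_def[abs_def] by measurable

lemma X_limit: "converges_in_distribution M X limit"
  using hyps unfolding asymptotic_hyps_def X_def[abs_def] by simp

text \<open>The tolerance is \<open>e / 4\<close> because \<open>var_diff\<close> weighs its three
  arguments by \<open>1\<close>, \<open>1\<close> and \<open>2\<close>.\<close>

definition bad :: "real \<Rightarrow> nat \<Rightarrow> 'a set" where
  "bad e n = {\<omega> \<in> space (M n). \<bar>real n * VC n \<omega> - sigC2\<bar> > e / 4} \<union>
    ({\<omega> \<in> space (M n). \<bar>real n * VE n \<omega> - sigE2\<bar> > e / 4} \<union> {\<omega> \<in> space (M n). \<bar>real n * Cov n \<omega> - sigE2\<bar> > e / 4})"

lemma bad_sets [measurable]: "bad e n \<in> sets (M n)"
  unfolding bad_def by measurable

lemma bad_tendsto: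
  assumes e: "0 < e" shows "(\<lambda>n. measure (M n) (bad e n)) \<longlonglongrightarrow> 0"
proof -
  let ?p = "\<lambda>V c n. measure (M n) {\<omega> \<in> space (M n). \<bar>real n * V n \<omega> - c\<bar> > e / 4}"
  have c: "converges_in_probability M (\<lambda>n \<omega>. real n * VC n \<omega>) sigC2"
    "converges_in_probability M (\<lambda>n \<omega>. real n * VE n \<omega>) sigE2"
    "converges_in_probability M (\<lambda>n \<omega>. real n * Cov n \<omega>) sigE2"
    using hyps unfolding asymptotic_hyps_def by auto
  have l: "(\<lambda>n. ?p VC sigC2 n + (?p VE sigE2 n + ?p Cov sigE2 n)) \<longlonglongrightarrow> 0 + (0 + 0)"
    by (intro tendsto_add c[unfolded converges_in_probability_def, rule_format]) (use e in simp_all)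
  show ?thesis
  proof (rule tendsto_sandwich[OF _ _ tendsto_const])
    show "(\<lambda>n. ?p VC sigC2 n + (?p VE sigE2 n + ?p Cov sigE2 n)) \<longlonglongrightarrow> 0" using l by simp
    show "\<forall>\<^sub>F n in sequentially. measure (M n) (bad e n) \<le> ?p VC sigC2 n + (?p VE sigE2 n + ?p Cov sigE2 n)"
    proof (intro always_eventually allI)
      fix n
      interpret prob_space "M n" by (rule prob)
      have 1: "{\<omega> \<in> space (M n). \<bar>real n * VC n \<omega> - sigC2\<bar> > e / 4} \<in> sets (M n)"
        "{\<omega> \<in> space (M n). \<bar>real n * VE n \<omega> - sigE2\<bar> > e / 4} \<in> sets (M n)"
        "{\<omega> \<in> space (M n). \<bar>real n * Cov n \<omega> - sigE2\<bar> > e / 4} \<in> sets (M n)" by measurable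
      show "measure (M n) (bad e n) \<le> ?p VC sigC2 n + (?p VE sigE2 n + ?p Cov sigE2 n)"
        unfolding bad_def using 1
        by (intro order_trans[OF measure_Un_le] add_left_mono measure_Un_le) auto
    qed
  qed auto
qed

lemma good_bounds:
  assumes "\<omega> \<in> space (M n)" "\<omega> \<notin> bad e n"
  shows "\<bar>real n * VC n \<omega> - real n * Cov n \<omega> - v\<bar> \<le> e"
    and "\<bar>real n * var_diff (VC n \<omega>) (VE n \<omega>) (Cov n \<omega>) - v\<bar> \<le> e"
proof -
  have "\<bar>real n * VC n \<omega> - sigC2\<bar> \<le> e / 4" "\<bar>real n * VE n \<omega> - sigE2\<bar> \<le> e / 4" "\<bar>real n * Cov n \<omega> - sigE2\<bar> \<le> e / 4"
    using assms by (auto simp: bad_def)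
  moreover have "real n * var_diff (VC n \<omega>) (VE n \<omega>) (Cov n \<omega>) = real n * VE n \<omega> + real n * VC n \<omega> - 2 * (real n * Cov n \<omega>)"
    by (simp add: var_diff_def algebra_simps)
  ultimately show "\<bar>real n * VC n \<omega> - real n * Cov n \<omega> - v\<bar> \<le> e"
    and "\<bar>real n * var_diff (VC n \<omega>) (VE n \<omega>) (Cov n \<omega>) - v\<bar> \<le> e" by linarith+
qed

definition W :: "nat \<Rightarrow> 'a \<Rightarrow> real" where
  "W n \<omega> = sqrt (real n) * (bE n \<omega> - bC n \<omega>)"

definition Z :: "real \<Rightarrow> nat \<Rightarrow> 'a \<Rightarrow> real" where
  "Z lam n \<omega> = sqrt (real n) * (beta_mse lam (bC n \<omega>) (bE n \<omega>) (VC n \<omega>) (VE n \<omega>) (Cov n \<omega>) - b0 n)"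

lemma mse_law_Z: "mse_law lam M b0 bC bE VC VE Cov = (\<lambda>n. distr (M n) borel (Z lam n))"
  by (simp add: mse_law_def Z_def[abs_def] fun_eq_iff)

lemma measurable_Z [measurable]: "Z lam n \<in> borel_measurable (M n)"
  unfolding Z_def[abs_def] by measurable

lemma Z_eq:
  assumes "0 < n" "0 < real n * var_diff (VC n \<omega>) (VE n \<omega>) (Cov n \<omega>)"
  shows "Z lam n \<omega> = X n \<omega> $ 1 + W n \<omega> * (real n * VC n \<omega> - real n * Cov n \<omega>)
    / (max 0 ((W n \<omega>)\<^sup>2 - lam * (real n * var_diff (VC n \<omega>) (VE n \<omega>) (Cov n \<omega>))) + real n * var_diff (VC n \<omega>) (VE n \<omega>) (Cov n \<omega>))"
  using beta_mse_scaled[of "sqrt (real n)" "VC n \<omega>" "VE n \<omega>" "Cov n \<omega>" lam "bC n \<omega>" "bE n \<omega>" "b0 n"] assms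
  by (simp add: Z_def X_nth W_def)

text \<open>The estimator is compared with \<open>studentized\<close> at the same sample, so only
  the variance and covariance estimates differ. Outside \<open>bad (d e) n\<close> the perturbation
  bound is at most \<open>e\<close> whatever the value of \<open>W n\<close>.\<close>

theorem local_limit:
  assumes b1: "\<And>n. b1 n = b0 n + h / sqrt (real n)" and lam: "0 \<le> lam"
  shows "weak_conv_m (mse_law lam M b0 bC bE VC VE Cov) (distr limit borel (studentized v h lam))"
  unfolding mse_law_Z
proof (rule slutsky[where Y = "\<lambda>n \<omega>. studentized v h lam (X n \<omega>)", OF prob])
  have v: "0 < v" using sig by simp
  have cont: "continuous_on UNIV (studentized v h lam)" using v by (rule continuous_studentized)
  then have m [measurable]: "studentized v h lam \<in> borel_measurable borel" by (rule borel_measurable_continuous_onI)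
  show "(\<lambda>\<omega>. studentized v h lam (X n \<omega>)) \<in> borel_measurable (M n)" for n by measurable
  have m': "studentized v h lam \<in> borel_measurable limit"
    using m by (subst measurable_cong_sets[OF sets_limit_law[OF sig] refl])
  show "real_distribution (distr limit borel (studentized v h lam))"
    using prob_space_limit_law[OF sig] m' by (rule prob_space.real_distribution_distr)
  show "converges_in_distribution M (\<lambda>n \<omega>. studentized v h lam (X n \<omega>)) (distr limit borel (studentized v h lam))"
    using X_limit cont sets_limit_law[OF sig] by (rule converges_in_distribution_continuous_map)
  define K where "K = sqrt (2 * (1 + lam) / v) * (lam + 2)"
  have K: "0 \<le> K" using lam v by (simp add: K_def)
  define d where "d e = min (v / 2) (e / (K + 1))" for e
  have d: "0 < d e" "d e \<le> v / 2" "K * d e \<le> e" if "0 < e" for e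
  proof -
    show "0 < d e" using that v K by (auto simp: d_def)
    show "d e \<le> v / 2" unfolding d_def by (rule min.cobounded1)
    have "K * d e \<le> K * (e / (K + 1))" using K by (intro mult_left_mono) (auto simp: d_def)
    also have "\<dots> \<le> e" using K that by (simp add: field_simps)
    finally show "K * d e \<le> e" .
  qed
  show "converges_in_probability M (\<lambda>n \<omega>. Z lam n \<omega> - studentized v h lam (X n \<omega>)) 0"
  proof (rule converges_in_probability_mono[where B = "\<lambda>e. bad (d e)"])
    fix e :: real assume e: "0 < e"
    show "(\<lambda>n. measure (M n) (bad (d e) n)) \<longlonglongrightarrow> 0" using d(1)[OF e] by (rule bad_tendsto)
    show "\<forall>\<^sub>F n in sequentially. {\<omega> \<in> space (M n). \<bar>Z lam n \<omega> - studentized v h lam (X n \<omega>) - 0\<bar> > e} \<subseteq> bad (d e) n"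
      using eventually_gt_at_top[of 0]
    proof eventually_elim
      case (elim n)
      have "\<bar>Z lam n \<omega> - studentized v h lam (X n \<omega>)\<bar> \<le> e" if \<omega>: "\<omega> \<in> space (M n)" "\<omega> \<notin> bad (d e) n" for \<omega>
      proof -
        note g = good_bounds[OF \<omega>]
        have pos: "0 < real n * var_diff (VC n \<omega>) (VE n \<omega>) (Cov n \<omega>)" using pos_if_near[OF order_trans[OF g(2) d(2)[OF e]] v] .
        \<comment> \<open>\<open>sqrt n * (h / sqrt n) = h\<close> holds for positive
          \<open>n\<close>; at \<open>n = 0\<close> the product is \<open>0\<close>.\<close>
        have w: "X n \<omega> $ 2 - X n \<omega> $ 1 + h = W n \<omega>"
          using elim by (simp add: X_nth W_def b1 algebra_simps)
        have "\<bar>Z lam n \<omega> - studentized v h lam (X n \<omega>)\<bar> \<le> K * d e"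
          unfolding Z_eq[OF elim pos] studentized_def w K_def
          using pretest_perturbation[OF v lam g d(2)[OF e], of "W n \<omega>"] by simp
        also have "\<dots> \<le> e" by (rule d(3)[OF e])
        finally show ?thesis .
      qed
      then show ?case by force
    qed
  qed (auto intro: prob)
qed auto

text \<open>Convergence in distribution controls integrals of continuous functions, so the tail
  event is dominated by the ramp \<open>f k\<close>, which is 0 up to \<open>k\<close> and 1 from
  \<open>k + 1\<close> on.\<close>

lemma X_diff_tight:
  assumes e: "0 < e"
  obtains K where "\<forall>\<^sub>F n in sequentially. measure (M n) {\<omega> \<in> space (M n). \<bar>X n \<omega> $ 2 - X n \<omega> $ 1\<bar> > K} < e"
proof -
  interpret N: prob_space limit by (rule prob_space_limit_law[OF sig])
  define f where "f k x = min 1 (max 0 (\<bar>x $ 2 - x $ 1\<bar> - real k))" for k and x :: "real ^ 2"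
  have fc: "continuous_on UNIV (f k)" for k unfolding f_def[abs_def] by (intro continuous_intros)
  have fb: "0 \<le> f k x" "f k x \<le> 1" for k x by (auto simp: f_def)
  have fm [measurable]: "f k \<in> borel_measurable borel" for k using fc by (rule borel_measurable_continuous_onI)
  have fN: "f k \<in> borel_measurable limit" for k
    using fm by (subst measurable_cong_sets[OF sets_limit_law[OF sig] refl])
  have "(\<lambda>k. \<integral>x. f k x \<partial>limit) \<longlonglongrightarrow> (\<integral>x. 0 \<partial>limit)"
  proof (rule integral_dominated_convergence[where w = "\<lambda>_. 1"])
    show "AE x in limit. (\<lambda>k. f k x) \<longlonglongrightarrow> 0"
    proof (intro AE_I2 tendsto_eventually)
      fix x :: "real ^ 2"
      obtain k0 where "\<bar>x $ 2 - x $ 1\<bar> \<le> real k0" using real_arch_simple by blast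
      then show "\<forall>\<^sub>F k in sequentially. f k x = 0"
        unfolding eventually_sequentially f_def by (intro exI[of _ k0]) auto
    qed
  qed (use fN fb in auto)
  then have "\<forall>\<^sub>F k in sequentially. (\<integral>x. f k x \<partial>limit) < e" by (rule order_tendstoD) (use e in simp)
  then obtain k where k: "(\<integral>x. f k x \<partial>limit) < e" using eventually_happens by fastforce
  have "(\<lambda>n. \<integral>\<omega>. f k (X n \<omega>) \<partial>M n) \<longlonglongrightarrow> (\<integral>x. f k x \<partial>limit)"
    using X_limit fc[of k] fb[of k] unfolding converges_in_distribution_def
    by (auto simp: bounded_iff intro!: exI[of _ 1])
  then have ev: "\<forall>\<^sub>F n in sequentially. (\<integral>\<omega>. f k (X n \<omega>) \<partial>M n) < e" using k by (rule order_tendstoD)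
  show ?thesis
  proof (rule that[of "real k + 1"])
    show "\<forall>\<^sub>F n in sequentially. measure (M n) {\<omega> \<in> space (M n). \<bar>X n \<omega> $ 2 - X n \<omega> $ 1\<bar> > real k + 1} < e"
      using ev
    proof eventually_elim
      case (elim n)
      interpret prob_space "M n" by (rule prob)
      let ?A = "{\<omega> \<in> space (M n). \<bar>X n \<omega> $ 2 - X n \<omega> $ 1\<bar> > real k + 1}"
      have A: "?A \<in> sets (M n)" by measurable
      have "measure (M n) ?A = (\<integral>\<omega>. indicator ?A \<omega> \<partial>M n)" using A by simp
      also have "\<dots> \<le> (\<integral>\<omega>. f k (X n \<omega>) \<partial>M n)"
      proof (rule integral_mono)
        show "integrable (M n) (indicator ?A :: 'a \<Rightarrow> real)"
          using A by (intro integrable_real_indicator) (auto simp: emeasure_eq_measure)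
        show "integrable (M n) (\<lambda>\<omega>. f k (X n \<omega>))"
          using fb by (intro integrable_const_bound[of _ 1]) auto
        show "indicator ?A \<omega> \<le> f k (X n \<omega>)" for \<omega> using fb by (auto simp: indicator_def f_def)
      qed
      finally show ?case using elim by simp
    qed
  qed
qed

text \<open>The scaled difference of the estimators is a tight fluctuation plus a drift of order
  \<open>sqrt n\<close>, so with high probability it is far out, where the correction to the first
  coordinate is small.\<close>

theorem fixed_limit:
  assumes b: "\<And>n. b0 n = \<beta>0" "\<And>n. b1 n = \<beta>1" and ne: "\<beta>0 \<noteq> \<beta>1" and lam: "0 \<le> lam"
  shows "weak_conv_m (mse_law lam M b0 bC bE VC VE Cov) (normal_distribution 0 sigC2)"
  unfolding mse_law_Z limit_law_1[OF sig, symmetric]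
proof (rule slutsky[where Y = "\<lambda>n \<omega>. X n \<omega> $ 1", OF prob])
  have v: "0 < v" using sig by simp
  show "(\<lambda>\<omega>. X n \<omega> $ 1) \<in> borel_measurable (M n)" for n by measurable
  have "(\<lambda>x. x $ 1) \<in> borel_measurable limit"
    using measurable_vec_nth[of 1] by (subst measurable_cong_sets[OF sets_limit_law[OF sig] refl])
  with prob_space_limit_law[OF sig] show "real_distribution (distr limit borel (\<lambda>x. x $ 1))"
    by (rule prob_space.real_distribution_distr)
  show "converges_in_distribution M (\<lambda>n \<omega>. X n \<omega> $ 1) (distr limit borel (\<lambda>x. x $ 1))"
    by (rule converges_in_distribution_continuous_map[OF X_limit _ sets_limit_law[OF sig]]) (intro continuous_intros)
  show "converges_in_probability M (\<lambda>n \<omega>. Z lam n \<omega> - X n \<omega> $ 1) 0"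
    unfolding converges_in_probability_def
  proof (intro allI impI tendstoI)
    fix e r :: real assume e: "0 < e" and r: "0 < r"
    obtain K where K: "\<forall>\<^sub>F n in sequentially. measure (M n) {\<omega> \<in> space (M n). \<bar>X n \<omega> $ 2 - X n \<omega> $ 1\<bar> > K} < r / 2"
      using X_diff_tight[of "r / 2"] r by auto
    have b: "\<forall>\<^sub>F n in sequentially. measure (M n) (bad (v / 2) n) < r / 2"
      using bad_tendsto[of "v / 2"] v r by (intro order_tendstoD) auto
    \<comment> \<open>The summand \<open>1\<close> guarantees \<open>1 \<le> L\<close>, hence
      \<open>L \<le> L * L\<close>; one bound on \<open>\<bar>W n \<omega>\<bar>\<close> then yields
      both the linear and the quadratic condition.\<close>
    define L where "L = max (4 * v / e) (4 * lam * v + 1)"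
    have "filterlim (\<lambda>n. sqrt (real n) * \<bar>\<beta>1 - \<beta>0\<bar>) at_top sequentially"
      using ne by (intro filterlim_at_top_mult_tendsto_pos[OF tendsto_const] filterlim_compose[OF sqrt_at_top] filterlim_real_sequentially) auto
    then have far: "\<forall>\<^sub>F n in sequentially. K + L \<le> sqrt (real n) * \<bar>\<beta>1 - \<beta>0\<bar>"
      by (simp add: filterlim_at_top)
    show "\<forall>\<^sub>F n in sequentially. dist (measure (M n) {\<omega> \<in> space (M n). \<bar>Z lam n \<omega> - X n \<omega> $ 1 - 0\<bar> > e}) 0 < r"
      using K b far eventually_gt_at_top[of 0]
    proof eventually_elim
      case (elim n)
      interpret prob_space "M n" by (rule prob)
      let ?A = "{\<omega> \<in> space (M n). \<bar>X n \<omega> $ 2 - X n \<omega> $ 1\<bar> > K}"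
      have A: "?A \<in> sets (M n)" by measurable
      have "\<bar>Z lam n \<omega> - X n \<omega> $ 1\<bar> \<le> e" if \<omega>: "\<omega> \<in> space (M n)" "\<omega> \<notin> bad (v / 2) n" "\<omega> \<notin> ?A" for \<omega>
      proof -
        note g = good_bounds[OF \<omega>(1,2)]
        have pos: "0 < real n * var_diff (VC n \<omega>) (VE n \<omega>) (Cov n \<omega>)" using pos_if_near[OF g(2) v] .
        have "W n \<omega> = (X n \<omega> $ 2 - X n \<omega> $ 1) + sqrt (real n) * (\<beta>1 - \<beta>0)"
          by (simp add: X_nth W_def assms(1,2) algebra_simps)
        moreover have "\<bar>sqrt (real n) * (\<beta>1 - \<beta>0)\<bar> = sqrt (real n) * \<bar>\<beta>1 - \<beta>0\<bar>" by (simp add: abs_mult)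
        moreover have "\<bar>X n \<omega> $ 2 - X n \<omega> $ 1\<bar> \<le> K" using \<omega> by auto
        ultimately have L: "L \<le> \<bar>W n \<omega>\<bar>" using elim by linarith
        have W1: "4 * v / e \<le> \<bar>W n \<omega>\<bar>" using L by (simp add: L_def)
        have l1: "1 \<le> L" using lam v by (auto simp: L_def le_max_iff_disj)
        have "4 * lam * v \<le> L" by (simp add: L_def)
        also have "\<dots> \<le> L * L" using l1 by simp
        also have "\<dots> \<le> \<bar>W n \<omega>\<bar> * \<bar>W n \<omega>\<bar>" using L l1 by (intro mult_mono) auto
        finally have W2: "4 * lam * v \<le> (W n \<omega>)\<^sup>2" by (simp add: power2_eq_square)
        show ?thesis unfolding Z_eq[OF elim(4) pos] using pretest_far[OF v lam g e W1 W2] by simp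
      qed
      then have "{\<omega> \<in> space (M n). \<bar>Z lam n \<omega> - X n \<omega> $ 1 - 0\<bar> > e} \<subseteq> bad (v / 2) n \<union> ?A" by force
      then have "prob {\<omega> \<in> space (M n). \<bar>Z lam n \<omega> - X n \<omega> $ 1 - 0\<bar> > e} \<le> prob (bad (v / 2) n \<union> ?A)"
        using A by (intro finite_measure_mono) auto
      also have "\<dots> \<le> prob (bad (v / 2) n) + prob ?A" using A by (intro measure_Un_le) auto
      also have "\<dots> < r" using elim by simp
      finally show ?case by simp
    qed
  qed
qed auto

end

section \<open>The limiting risk\<close>

definition limit_variable :: "real \<Rightarrow> real \<Rightarrow> real \<Rightarrow> real \<Rightarrow> real ^ 2 \<Rightarrow> real" where
  "limit_variable s t h l z = s * z $ 2 + t * (h / t - shrink l (h / t + z $ 1))"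

lemma borel_limit_variable [measurable]: "limit_variable s t h l \<in> borel_measurable borel"
  unfolding limit_variable_def[abs_def] by measurable

lemma studentized_limit:
  assumes t: "0 < t"
  shows "studentized (t\<^sup>2) h l (vector [s * z $ 2 - t * z $ 1, s * z $ 2]) = limit_variable s t h l z"
proof -
  define y where "y = h / t + z $ 1"
  have ty: "s * z $ 2 - (s * z $ 2 - t * z $ 1) + h = t * y" using t by (simp add: y_def field_simps)
  have "max 0 ((t * y)\<^sup>2 - l * t\<^sup>2) + t\<^sup>2 = t\<^sup>2 * (max 0 (y\<^sup>2 - l) + 1)"
  proof -
    have "(t * y)\<^sup>2 - l * t\<^sup>2 = t\<^sup>2 * (y\<^sup>2 - l)" by (simp add: power_mult_distrib algebra_simps)
    then have "max 0 ((t * y)\<^sup>2 - l * t\<^sup>2) = t\<^sup>2 * max 0 (y\<^sup>2 - l)" using t by (simp add: max_mult_distrib_left)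
    then show ?thesis by (simp add: algebra_simps)
  qed
  then have "t * y * t\<^sup>2 / (max 0 ((t * y)\<^sup>2 - l * t\<^sup>2) + t\<^sup>2) = t * y * weight l y"
    using t by (simp add: weight_def)
  then have "studentized (t\<^sup>2) h l (vector [s * z $ 2 - t * z $ 1, s * z $ 2]) = s * z $ 2 - t * z $ 1 + t * y * weight l y"
    unfolding studentized_def vector_2 ty by simp
  also have "\<dots> = limit_variable s t h l z"
    using t by (simp add: limit_variable_def shrink_def y_def[symmetric]) (simp add: y_def field_simps)
  finally show ?thesis .
qed

lemma limit_variable_law:
  assumes sig: "0 \<le> sigE2" "sigE2 < sigC2"
  shows "distr (multivariate_normal 0 (vector [vector [sigC2, sigE2], vector [sigE2, sigE2]])) borel (studentized (sigC2 - sigE2) h l)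
    = distr std_normal_vector borel (limit_variable (sqrt sigE2) (sqrt (sigC2 - sigE2)) h l)"
proof -
  define t where "t = sqrt (sigC2 - sigE2)"
  have t: "0 < t" "t\<^sup>2 = sigC2 - sigE2" using sig by (simp_all add: t_def)
  have "continuous_on UNIV (studentized (t\<^sup>2) h l)" using t(1) by (intro continuous_studentized) simp
  then have [measurable]: "studentized (t\<^sup>2) h l \<in> borel_measurable borel" by (rule borel_measurable_continuous_onI)
  have t_sqrt: "sqrt (t\<^sup>2) = t" using t(1) by simp
  show ?thesis
    unfolding limit_law_eq[OF sig] t_def[symmetric] t(2)[symmetric]
    by (subst distr_distr) (simp_all only: comp_def t_sqrt studentized_limit[OF t(1)], measurable)
qed

lemma risk_shift: "risk l h = (\<integral>x. std_normal_density x * (h - shrink l (h + x))\<^sup>2 \<partial>lborel)"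
  unfolding risk_def gauss_mean_shift[of h] ..

lemma limit_variable_second_moment:
  shows "integrable std_normal_vector (\<lambda>z. (limit_variable s t h l z)\<^sup>2)"
    and "(\<integral>z. (limit_variable s t h l z)\<^sup>2 \<partial>std_normal_vector) = s\<^sup>2 + t\<^sup>2 * risk l (h / t)"
  using std_normal_vector_second_moment[of "\<lambda>x. h / t - shrink l (h / t + x)" s t] risk_integrable[of "h / t" l]
  unfolding limit_variable_def risk_shift gauss_integrable_shift[of "h / t"] by auto

lemma shrink_minus [simp]: "shrink l (- x) = - shrink l x"
  by (simp add: shrink_def)

lemma limit_variable_mean_0: "(\<integral>z. limit_variable s t 0 l z \<partial>std_normal_vector) = 0"
proof -
  have b: "\<bar>shrink l x\<bar> \<le> 1 + x\<^sup>2" for x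
    using shrink_square_le[of l x] abs_le_one_plus_square[of x] by (simp add: abs_le_square_iff[symmetric])
  have "integrable lborel (\<lambda>x. std_normal_density x * shrink l x)"
    using b by (intro gauss_integrable[of _ 1 1]) auto
  then have i: "integrable std_normal_vector (\<lambda>z :: real ^ 2. shrink l (z $ 1))"
    by (subst std_normal_vector_integral_1) auto
  have "(\<integral>z. shrink l (z $ 1) \<partial>(std_normal_vector :: (real ^ 2) measure)) = gauss_mean 0 (shrink l)"
    by (subst std_normal_vector_integral_1) auto
  also have "\<dots> = 0" using gauss_mean_reflect[of 0 "shrink l"] by simp
  finally show ?thesis
    using i std_normal_vector_second(3,4) by (simp add: limit_variable_def)
qed

text \<open>Both rules estimate 0, and beyond \<open>sqrt l\<close> the larger threshold shrinks
  strictly more; an interval there has positive measure.\<close>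

lemma risk_at_0_strict:
  assumes "0 \<le> l" "l < l'" shows "risk l' 0 < risk l 0"
proof -
  let ?d = "\<lambda>x. normal_density 0 1 x * ((shrink l x)\<^sup>2 - (shrink l' x)\<^sup>2)"
  have i: "integrable lborel (\<lambda>x. normal_density 0 1 x * (shrink l x)\<^sup>2)" for l by (rule shrink_integrable)
  have nn: "0 \<le> ?d x" for x using shrink_abs_mono[of l l' x] assms by simp
  have pos: "0 < ?d x" if "sqrt l < x" for x
  proof -
    have x: "0 < x" "l < x\<^sup>2" using that assms(1) real_sqrt_ge_zero[of l] real_le_rsqrt[of x l] by linarith+
    have "weight l x < weight l' x"
      unfolding weight_def using assms x by (intro divide_strict_left_mono) (auto simp: max_def)
    then have "(1 - weight l' x)\<^sup>2 < (1 - weight l x)\<^sup>2"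
      using weight_le_1[of l' x] by (intro power_strict_mono) auto
    then have "(shrink l' x)\<^sup>2 < (shrink l x)\<^sup>2" using x by (simp add: shrink_def power_mult_distrib)
    then show ?thesis by (simp add: normal_density_pos)
  qed
  have "0 < (\<integral>x. ?d x \<partial>lborel)"
  proof (rule ccontr)
    assume "\<not> ?thesis"
    then have "(\<integral>x. ?d x \<partial>lborel) = 0" using integral_nonneg_AE[of ?d lborel] nn by (simp add: order_antisym)
    moreover have "integrable lborel ?d" using i by (simp add: right_diff_distrib)
    ultimately have "AE x in lborel. ?d x = 0" using nn by (simp add: integral_nonneg_eq_0_iff_AE)
    then have "AE x in lborel. x \<notin> {sqrt l<..<sqrt l + 1}" by eventually_elim (use pos in force)
    then have "emeasure lborel {sqrt l<..<sqrt l + 1} = 0"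
      by (subst (asm) AE_iff_measurable[OF _ refl]) (simp_all del: greaterThanLessThan_iff)
    then show False by simp
  qed
  also have "\<dots> = risk l 0 - risk l' 0" unfolding risk_def using i by (simp add: right_diff_distrib)
  finally show ?thesis by simp
qed

lemma risk_at_0_tendsto: "((\<lambda>l. risk l 0) \<longlongrightarrow> 0) at_top"
proof (rule tendsto_at_topI_sequentially)
  fix X :: "nat \<Rightarrow> real" assume X: "filterlim X at_top sequentially"
  have "(\<lambda>n. risk (X n) 0) \<longlonglongrightarrow> gauss_mean 0 (\<lambda>x. 0)"
    unfolding risk_def
  proof (rule integral_dominated_convergence[where w = "\<lambda>x. normal_density 0 1 x * x\<^sup>2"])
    show "integrable lborel (\<lambda>x. normal_density 0 1 x * x\<^sup>2)" by (rule integrable_std_normal_moment)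
    show "AE x in lborel. norm (normal_density 0 1 x * (0 - shrink (X n) x)\<^sup>2) \<le> normal_density 0 1 x * x\<^sup>2" for n
      using shrink_square_le by (auto simp: abs_mult intro!: mult_left_mono)
    show "AE x in lborel. (\<lambda>n. normal_density 0 1 x * (0 - shrink (X n) x)\<^sup>2) \<longlonglongrightarrow> normal_density 0 1 x * 0"
    proof (intro AE_I2 tendsto_eventually)
      fix x :: real
      have "\<forall>\<^sub>F n in sequentially. x\<^sup>2 \<le> X n" using X by (simp add: filterlim_at_top)
      then show "\<forall>\<^sub>F n in sequentially. normal_density 0 1 x * (0 - shrink (X n) x)\<^sup>2 = normal_density 0 1 x * 0"
        by eventually_elim (simp add: shrink_def weight_def)
    qed
  qed auto
  then show "(\<lambda>n. risk (X n) 0) \<longlonglongrightarrow> 0" by simp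
qed

text \<open>The standard normal plane carries the limits for all \<open>h\<close> and
  \<open>lam\<close> at once. Differences of second moments are \<open>t^2\<close> times risk
  differences at \<open>h / t\<close>, so maximisers correspond under
  \<open>h = t * \<theta>\<close>, and the second maximum is attained at \<open>0\<close>. The
  variances of the second part are the second moments at \<open>h = 0\<close>, where the mean
  vanishes.\<close>

theorem proposition3p1:
  fixes sigC2 sigE2 :: real
  assumes "0 \<le> sigE2" and "sigE2 < sigC2"
  shows
    "(\<forall>(M :: nat \<Rightarrow> 'a measure) (\<beta>0 :: real) (\<beta>E :: real) bC bE VC VE Cov.
        asymptotic_hyps sigC2 sigE2 M (\<lambda>_. \<beta>0) (\<lambda>_. \<beta>E) bC bE VC VE Cov \<longrightarrow> \<beta>0 \<noteq> \<beta>E \<longrightarrow>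
        (\<forall>lam\<ge>0. weak_conv_m (mse_law lam M (\<lambda>_. \<beta>0) bC bE VC VE Cov)
                   (normal_distribution 0 sigC2)))
     \<and>
     (\<exists>(P :: (real ^ 2) measure) (U :: real \<Rightarrow> real \<Rightarrow> real ^ 2 \<Rightarrow> real).
        prob_space P
      \<and> (\<forall>h. \<forall>lam\<ge>0. U h lam \<in> borel_measurable P \<and> integrable P (\<lambda>x. (U h lam x)\<^sup>2))
      \<and> ((\<forall>(M :: nat \<Rightarrow> 'a measure) (\<beta> :: nat \<Rightarrow> real) bC bE VC VE Cov.
            asymptotic_hyps sigC2 sigE2 M \<beta> \<beta> bC bE VC VE Cov \<longrightarrow>
            (\<forall>lam\<ge>0. weak_conv_m (mse_law lam M \<beta> bC bE VC VE Cov)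
                       (distr P borel (U 0 lam))))
         \<and> (\<forall>lam\<ge>0. prob_space.expectation P (U 0 lam) = 0)
         \<and> strict_antimono_on {0..} (\<lambda>lam. prob_space.variance P (U 0 lam))
         \<and> ((\<lambda>lam. prob_space.variance P (U 0 lam)) \<longlongrightarrow> sigE2) at_top)
      \<and> ((\<forall>h. \<forall>(M :: nat \<Rightarrow> 'a measure) (\<beta>0 :: nat \<Rightarrow> real) bC bE VC VE Cov.
            asymptotic_hyps sigC2 sigE2 M \<beta>0 (\<lambda>n. \<beta>0 n + h / sqrt (real n)) bC bE VC VE Cov \<longrightarrow>
            (\<forall>lam\<ge>0. weak_conv_m (mse_law lam M \<beta>0 bC bE VC VE Cov)
                       (distr P borel (U h lam))))
         \<and> (\<forall>lam>0.
              let R = (\<lambda>h l. prob_space.expectation P (\<lambda>x. (U h l x)\<^sup>2)) in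
              \<exists>h1 h2. is_arg_max (\<lambda>h. R h lam - R h 0) (\<lambda>_. True) h1
                    \<and> is_arg_max (\<lambda>h. R h 0 - R h lam) (\<lambda>_. True) h2
                    \<and> R h1 lam - R h1 0 > R h2 0 - R h2 lam)))"
proof -
  define s where "s = sqrt sigE2"
  define t where "t = sqrt (sigC2 - sigE2)"
  have s: "s\<^sup>2 = sigE2" and t: "0 < t" using assms by (simp_all add: s_def t_def)
  define P :: "(real ^ 2) measure" where "P = std_normal_vector"
  define U where "U = limit_variable s t"
  have fixed: "weak_conv_m (mse_law lam M (\<lambda>_. \<beta>0) bC bE VC VE Cov) (normal_distribution 0 sigC2)"
    if "asymptotic_hyps sigC2 sigE2 M (\<lambda>_. \<beta>0) (\<lambda>_. \<beta>E) bC bE VC VE Cov" "\<beta>0 \<noteq> \<beta>E" "0 \<le> lam"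
    for M :: "nat \<Rightarrow> 'a measure" and \<beta>0 \<beta>E bC bE VC VE Cov lam
  proof -
    interpret estimators sigC2 sigE2 M "\<lambda>_. \<beta>0" "\<lambda>_. \<beta>E" bC bE VC VE Cov
      by unfold_locales (use assms that in auto)
    show ?thesis by (rule fixed_limit) (use that in auto)
  qed
  have local: "weak_conv_m (mse_law lam M \<beta>0 bC bE VC VE Cov) (distr P borel (U h lam))"
    if "asymptotic_hyps sigC2 sigE2 M \<beta>0 (\<lambda>n. \<beta>0 n + h / sqrt (real n)) bC bE VC VE Cov" "0 \<le> lam"
    for M :: "nat \<Rightarrow> 'a measure" and \<beta>0 bC bE VC VE Cov h lam
  proof -
    interpret estimators sigC2 sigE2 M \<beta>0 "\<lambda>n. \<beta>0 n + h / sqrt (real n)" bC bE VC VE Cov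
      by unfold_locales (use assms that in auto)
    show ?thesis
      using local_limit[of h lam] that(2) unfolding limit_variable_law[OF assms] P_def U_def s_def t_def by simp
  qed
  have local0: "weak_conv_m (mse_law lam M \<beta> bC bE VC VE Cov) (distr P borel (U 0 lam))"
    if "asymptotic_hyps sigC2 sigE2 M \<beta> \<beta> bC bE VC VE Cov" "0 \<le> lam"
    for M :: "nat \<Rightarrow> 'a measure" and \<beta> bC bE VC VE Cov lam
    using local[of M \<beta> 0] that by simp
  have R: "(\<integral>x. (U h l x)\<^sup>2 \<partial>P) = sigE2 + t\<^sup>2 * risk l (h / t)" for h l
    unfolding U_def P_def limit_variable_second_moment s ..
  have E0: "(\<integral>x. U 0 l x \<partial>P) = 0" for l unfolding U_def P_def by (rule limit_variable_mean_0)
  have V: "(\<integral>x. (U 0 l x - (\<integral>x. U 0 l x \<partial>P))\<^sup>2 \<partial>P) = sigE2 + t\<^sup>2 * risk l 0" for l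
    unfolding E0 using R[of 0 l] by simp
  have anti: "strict_antimono_on {0..} (\<lambda>lam. \<integral>x. (U 0 lam x - (\<integral>x. U 0 lam x \<partial>P))\<^sup>2 \<partial>P)"
    unfolding V using t risk_at_0_strict by (intro monotone_onI) auto
  have lim: "((\<lambda>lam. \<integral>x. (U 0 lam x - (\<integral>x. U 0 lam x \<partial>P))\<^sup>2 \<partial>P) \<longlongrightarrow> sigE2) at_top"
    unfolding V using tendsto_add[OF tendsto_const tendsto_mult_left[OF risk_at_0_tendsto], of sigE2 "t\<^sup>2"] by simp
  have asym: "\<exists>h1 h2. is_arg_max (\<lambda>h. R h lam - R h 0) (\<lambda>_. True) h1
      \<and> is_arg_max (\<lambda>h. R h 0 - R h lam) (\<lambda>_. True) h2
      \<and> R h1 lam - R h1 0 > R h2 0 - R h2 lam"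
    if lam: "0 < lam" and R_def: "R = (\<lambda>h l. \<integral>x. (U h l x)\<^sup>2 \<partial>P)" for lam R
  proof -
    obtain h1 where h1: "\<And>h. risk lam h - risk 0 h \<le> risk lam h1 - risk 0 h1"
      and h2: "\<And>h. risk 0 h - risk lam h \<le> risk 0 0 - risk lam 0"
      and lt: "risk 0 0 - risk lam 0 < risk lam h1 - risk 0 h1"
      using risk_asymmetry[OF lam] by blast
    have d: "R h a - R h b = t\<^sup>2 * (risk a (h / t) - risk b (h / t))" for h a b
      by (simp add: R_def R algebra_simps)
    have "is_arg_max (\<lambda>h. R h lam - R h 0) (\<lambda>_. True) (t * h1)"
      unfolding d is_arg_max_linorder using t h1 by (auto intro: mult_left_mono)
    moreover have "is_arg_max (\<lambda>h. R h 0 - R h lam) (\<lambda>_. True) 0"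
      unfolding d is_arg_max_linorder using h2 by (auto intro: mult_left_mono)
    moreover have "R (t * h1) lam - R (t * h1) 0 > R 0 0 - R 0 lam"
      unfolding d using t lt by simp
    ultimately show ?thesis by blast
  qed
  have "prob_space P" unfolding P_def by (rule prob_space_std_normal_vector)
  moreover have "U h lam \<in> borel_measurable P" "integrable P (\<lambda>x. (U h lam x)\<^sup>2)" for h lam
    unfolding P_def U_def using limit_variable_second_moment(1) by auto
  ultimately show ?thesis
    using fixed
    by (intro conjI allI impI exI[of _ P] exI[of _ U])
      (use local local0 E0 anti lim asym in \<open>auto simp: Let_def\<close>)
qed

end
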